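(* Let $G$ be a hyperbolic group. Then the subset sum optimization problem $\mathbf{SSOP}(G)$ is in $\mathbf{P}$ (i.e., solvable in polynomial time).
   Context: Fix a finite generating set $X$ of $G$. Elements of $G$ are given as words over $X\cup X^{-1}$, and the size of a tuple of words is the sum of their lengths. $\mathbf{SSOP}(G)$: given $g_1,\ldots,g_k,g\in G$, find, if it exists, a tuple $\varepsilon_1,\ldots,\varepsilon_k\in\{0,1\}$ such that $g=g_1^{\varepsilon_1}\cdots g_k^{\varepsilon_k}$ in $G$ and the sum $\sum_i\varepsilon_i$ is minimal among all such tuples; otherwise, output "No solutions". The group $G$ is fixed (not part of the input). *)

theory Defs
  imports "HOL-Algebra.Generated_Groups" "HOL-Computational_Algebra.Polynomial"
begin

section \<open>Words, the word metric and hyperbolic groups\<close>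

datatype 'a letter = Pos 'a | Neg 'a

definition letters :: "'a set \<Rightarrow> 'a letter set" where
  "letters X = Pos ` X \<union> Neg ` X"

fun letter_val :: "('a, 'b) monoid_scheme \<Rightarrow> 'a letter \<Rightarrow> 'a" where
  "letter_val G (Pos x) = x"
| "letter_val G (Neg x) = inv\<^bsub>G\<^esub> x"

definition word_val :: "('a, 'b) monoid_scheme \<Rightarrow> 'a letter list \<Rightarrow> 'a" where
  "word_val G w = foldr (\<otimes>\<^bsub>G\<^esub>) (map (letter_val G) w) \<one>\<^bsub>G\<^esub>"

definition finite_generating_set :: "('a, 'b) monoid_scheme \<Rightarrow> 'a set \<Rightarrow> bool" where
  "finite_generating_set G X \<longleftrightarrow> finite X \<and> X \<subseteq> carrier G \<and> generate G X = carrier G"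

definition word_length :: "('a, 'b) monoid_scheme \<Rightarrow> 'a set \<Rightarrow> 'a \<Rightarrow> nat" where
  "word_length G X g = (LEAST n. \<exists>w\<in>lists (letters X). length w = n \<and> word_val G w = g)"

definition word_dist :: "('a, 'b) monoid_scheme \<Rightarrow> 'a set \<Rightarrow> 'a \<Rightarrow> 'a \<Rightarrow> real" where
  "word_dist G X g h = real (word_length G X (inv\<^bsub>G\<^esub> g \<otimes>\<^bsub>G\<^esub> h))"

definition gromov_product :: "('p \<Rightarrow> 'p \<Rightarrow> real) \<Rightarrow> 'p \<Rightarrow> 'p \<Rightarrow> 'p \<Rightarrow> real" where
  "gromov_product d w x y = (d x w + d y w - d x y) / 2"

definition gromov_hyperbolic :: "'p set \<Rightarrow> ('p \<Rightarrow> 'p \<Rightarrow> real) \<Rightarrow> bool" where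
  "gromov_hyperbolic M d \<longleftrightarrow>
     (\<exists>\<delta>\<ge>0. \<forall>w\<in>M. \<forall>x\<in>M. \<forall>y\<in>M. \<forall>z\<in>M.
        gromov_product d w x z \<ge> min (gromov_product d w x y) (gromov_product d w y z) - \<delta>)"

text \<open>Hyperbolicity does not depend on the generating set, so asking for one suitable
  generating set is the usual notion.\<close>

definition hyperbolic_group :: "('a, 'b) monoid_scheme \<Rightarrow> bool" where
  "hyperbolic_group G \<longleftrightarrow>
     group G \<and> (\<exists>S. finite_generating_set G S \<and> gromov_hyperbolic (carrier G) (word_dist G S))"

section \<open>Deterministic multi-tape Turing machines and polynomial time\<close>

text \<open>Tapes are infinite in both directions. A machine working on strings over the type
  \<open>'c\<close> may use, besides symbols of that type and the blank, finitely many of the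
  auxiliary symbols.\<close>

datatype 'c tape_symbol = Blank | Sym 'c | Aux nat

datatype move = Left | Stay | Right

fun offset :: "move \<Rightarrow> int" where
  "offset Left = -1"
| "offset Stay = 0"
| "offset Right = 1"

record 'c turing_machine =
  num_tapes :: nat
  alphabet :: "'c tape_symbol set"
  states :: "nat set"
  start_state :: nat
  halt_state :: nat
  delta :: "nat \<Rightarrow> 'c tape_symbol list \<Rightarrow> nat \<times> ('c tape_symbol \<times> move) list"

definition turing_machine_over :: "'c set \<Rightarrow> 'c turing_machine \<Rightarrow> bool" where
  "turing_machine_over A M \<longleftrightarrow>
     num_tapes M \<ge> 1 \<and>
     finite (alphabet M) \<and> Blank \<in> alphabet M \<and> Sym ` A \<subseteq> alphabet M \<and>
     finite (states M) \<and> start_state M \<in> states M \<and> halt_state M \<in> states M \<and>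
     (\<forall>q\<in>states M. \<forall>ss\<in>lists (alphabet M). length ss = num_tapes M \<longrightarrow>
        (case delta M q ss of (q', as) \<Rightarrow>
           q' \<in> states M \<and> length as = num_tapes M \<and> fst ` set as \<subseteq> alphabet M))"

type_synonym 'c tape = "(int \<Rightarrow> 'c tape_symbol) \<times> int"

type_synonym 'c config = "nat \<times> 'c tape list"

fun act :: "'c tape \<Rightarrow> 'c tape_symbol \<times> move \<Rightarrow> 'c tape" where
  "act (t, h) (s, m) = (t(h := s), h + offset m)"

fun step :: "'c turing_machine \<Rightarrow> 'c config \<Rightarrow> 'c config" where
  "step M (q, ts) =
     (if q = halt_state M then (q, ts)
      else case delta M q (map (\<lambda>(t, h). t h) ts) of (q', as) \<Rightarrow> (q', map2 act ts as))"

definition tape_content :: "'c list \<Rightarrow> int \<Rightarrow> 'c tape_symbol" where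
  "tape_content w i = (if 0 \<le> i \<and> i < int (length w) then Sym (w ! nat i) else Blank)"

definition initial :: "'c turing_machine \<Rightarrow> 'c list \<Rightarrow> 'c config" where
  "initial M w =
     (start_state M, (tape_content w, 0) # replicate (num_tapes M - 1) (tape_content [], 0))"

text \<open>The input is written on the first tape, the output is read from the last one. As the
  halting state is absorbing, the following means that \<open>M\<close> halts after at most
  \<open>t\<close> steps.\<close>

definition outputs_within :: "'c turing_machine \<Rightarrow> 'c list \<Rightarrow> nat \<Rightarrow> 'c list \<Rightarrow> bool" where
  "outputs_within M w t v \<longleftrightarrow>
     (case (step M ^^ t) (initial M w) of (q, ts) \<Rightarrow>
        q = halt_state M \<and> fst (last ts) = tape_content v)"

definition poly_time_computable :: "'c set \<Rightarrow> ('c list \<Rightarrow> 'c list) \<Rightarrow> bool" where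
  "poly_time_computable A f \<longleftrightarrow>
     (\<exists>M (p :: nat poly). turing_machine_over A M \<and>
        (\<forall>w\<in>lists A. outputs_within M w (poly p (length w)) (f w)))"

text \<open>A search problem is given by the relation between inputs and their admissible answers.\<close>

definition search_problem_in_P :: "'c set \<Rightarrow> ('c list \<Rightarrow> 'c list \<Rightarrow> bool) \<Rightarrow> bool" where
  "search_problem_in_P A R \<longleftrightarrow>
     (\<exists>f. poly_time_computable A f \<and> (\<forall>w\<in>lists A. R w (f w)))"

section \<open>The subset sum optimization problem\<close>

definition subset_product ::
    "('a, 'b) monoid_scheme \<Rightarrow> 'a letter list list \<Rightarrow> bool list \<Rightarrow> 'a" where
  "subset_product G gs \<epsilon> =
     foldr (\<otimes>\<^bsub>G\<^esub>) (map2 (\<lambda>w e. word_val G w [^]\<^bsub>G\<^esub> (of_bool e :: nat)) gs \<epsilon>) \<one>\<^bsub>G\<^esub>"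

definition ssop_feasible ::
    "('a, 'b) monoid_scheme \<Rightarrow> 'a letter list list \<Rightarrow> 'a letter list \<Rightarrow> bool list \<Rightarrow> bool" where
  "ssop_feasible G gs g \<epsilon> \<longleftrightarrow>
     length \<epsilon> = length gs \<and> word_val G g = subset_product G gs \<epsilon>"

definition ssop_cost :: "bool list \<Rightarrow> nat" where
  "ssop_cost \<epsilon> = (\<Sum>e\<leftarrow>\<epsilon>. of_bool e)"

text \<open>\<open>None\<close> is the answer ``No solutions''.\<close>

fun ssop_correct ::
    "('a, 'b) monoid_scheme \<Rightarrow> 'a letter list list \<Rightarrow> 'a letter list \<Rightarrow> bool list option \<Rightarrow> bool" where
  "ssop_correct G gs g None \<longleftrightarrow> (\<nexists>\<epsilon>. ssop_feasible G gs g \<epsilon>)"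
| "ssop_correct G gs g (Some \<epsilon>) \<longleftrightarrow>
     ssop_feasible G gs g \<epsilon> \<and> (\<forall>\<epsilon>'. ssop_feasible G gs g \<epsilon>' \<longrightarrow> ssop_cost \<epsilon> \<le> ssop_cost \<epsilon>')"

datatype 'a ssop_symbol = Letter "'a letter" | Sep | Bit bool | NoSolutions

definition ssop_alphabet :: "'a set \<Rightarrow> 'a ssop_symbol set" where
  "ssop_alphabet X = insert Sep (Letter ` letters X)"

definition encode_input :: "'a letter list list \<Rightarrow> 'a letter list \<Rightarrow> 'a ssop_symbol list" where
  "encode_input gs g = concat (map (\<lambda>w. map Letter w @ [Sep]) gs) @ map Letter g"

fun encode_output :: "bool list option \<Rightarrow> 'a ssop_symbol list" where
  "encode_output None = [NoSolutions]"
| "encode_output (Some \<epsilon>) = map Bit \<epsilon>"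

definition SSOP ::
    "('a, 'b) monoid_scheme \<Rightarrow> 'a set \<Rightarrow> 'a ssop_symbol list \<Rightarrow> 'a ssop_symbol list \<Rightarrow> bool" where
  "SSOP G X u v \<longleftrightarrow>
     (\<exists>gs\<in>lists (lists (letters X)). \<exists>g\<in>lists (letters X). \<exists>a.
        u = encode_input gs g \<and> v = encode_output a \<and> ssop_correct G gs g a)"

text \<open>Every string over the input alphabet encodes exactly one instance, and the length of the
  code of \<open>g\<^sub>1, \<dots>, g\<^sub>k, g\<close> is the sum of the lengths of these words plus \<open>k\<close>. The
  summand \<open>k\<close> matters only in the presence of empty words.\<close>

lemma length_encode_input:
  "length (encode_input gs g) = (\<Sum>w\<leftarrow>gs. length w) + length g + length gs"
  by (induction gs) (auto simp: encode_input_def)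

lemma encode_input_Nil [simp]: "encode_input [] g = map Letter g"
  by (simp add: encode_input_def)

lemma encode_input_Cons [simp]:
  "encode_input (w # gs) g = map Letter w @ Sep # encode_input gs g"
  by (simp add: encode_input_def)

lemma map_Letter_append_Sep_eq_iff:
  "map Letter w @ Sep # u = map Letter w' @ Sep # u' \<longleftrightarrow> w = w' \<and> u = u'"
proof (induction w arbitrary: w')
  case Nil
  then show ?case by (cases w') auto
next
  case (Cons a w)
  then show ?case by (cases w') auto
qed

lemma encode_input_eq_iff: "encode_input gs g = encode_input gs' g' \<longleftrightarrow> gs = gs' \<and> g = g'"
proof (induction gs arbitrary: gs')
  case Nil
  have "map Letter g \<noteq> map Letter w @ Sep # u" for w and u :: "'a ssop_symbol list"
  proof
    assume "map Letter g = map Letter w @ Sep # u"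
    then have "Sep \<in> set (map Letter g)" by simp
    then show False by auto
  qed
  then show ?case by (cases gs') (auto simp: inj_map_eq_map inj_def)
next
  case (Cons w gs)
  have "map Letter g' \<noteq> map Letter w @ Sep # u" for u :: "'a ssop_symbol list"
  proof
    assume "map Letter g' = map Letter w @ Sep # u"
    then have "Sep \<in> set (map Letter g')" by simp
    then show False by auto
  qed
  then show ?case
    by (cases gs') (use Cons in \<open>auto simp: map_Letter_append_Sep_eq_iff dest: sym\<close>)
qed

lemma encode_input_surj:
  assumes "u \<in> lists (ssop_alphabet X)"
  shows "\<exists>gs\<in>lists (lists (letters X)). \<exists>g\<in>lists (letters X). u = encode_input gs g"
  using assms
proof (induction u rule: list.induct)
  case Nil
  then show ?case by (intro bexI[of _ "[]"]) auto
next
  case (Cons s u)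
  from Cons.prems have s: "s = Sep \<or> (\<exists>a\<in>letters X. s = Letter a)" and
      u: "u \<in> lists (ssop_alphabet X)"
    by (simp_all add: ssop_alphabet_def image_iff)
  from Cons.IH u obtain gs g where
    *: "gs \<in> lists (lists (letters X))" "g \<in> lists (letters X)" "u = encode_input gs g" by blast
  from s show ?case
  proof
    assume "s = Sep"
    then show ?thesis using * by (intro bexI[of _ "[] # gs"] bexI[of _ g]) auto
  next
    assume "\<exists>a\<in>letters X. s = Letter a"
    then obtain a where a: "a \<in> letters X" "s = Letter a" by blast
    show ?thesis
    proof (cases gs)
      case Nil
      then show ?thesis using * a by (intro bexI[of _ "[]"] bexI[of _ "a # g"]) auto
    next
      case (Cons w gs')
      then show ?thesis using * a by (intro bexI[of _ "(a # w) # gs'"] bexI[of _ g]) auto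
    qed
  qed
qed

lemma encode_input_in_lists:
  assumes "gs \<in> lists (lists (letters X))" "g \<in> lists (letters X)"
  shows "encode_input gs g \<in> lists (ssop_alphabet X)"
  using assms by (induction gs) (auto simp: ssop_alphabet_def)

end

theory Submission imports Defs begin

text \<open>Write the equation as $g^{-1} g_1^{\varepsilon_1} \cdots g_k^{\varepsilon_k} = 1$ and read its left-hand
  side along the paths of an acyclic labelled graph with linearly many edges, where each $g_i$ can be
  skipped. By hyperbolicity the midpoint of a geodesic is at distance $O(\log n)$ from any path of
  length $n$ with the same ends. Hence a path whose ends are at distance at most $L = O(\log n)$ can be
  cut into two shorter ones with the same property, so that an optimal path is found by dynamic
  programming over triples of two vertices and a word of length at most $L$, of which there are
  polynomially many. The group elements involved are compared by Dehn's algorithm.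

  Polynomial time is established for functions on data encoded as binary trees. A tree written in
  prefix notation on the top of a stack can be copied, swapped and dropped by a machine with a unary
  counter, and bounded iteration stays polynomial as long as the sizes of the intermediate results
  do. What has to be checked for each function is therefore only a bound on sizes.\<close>

section \<open>Geometry of the word metric\<close>

text \<open>With the inverse of g in front, the paths sought are those of value 1, so their ends are
  at distance 0 and the cutting argument can start. Balls grow exponentially with the radius, so
  tabulating their words is affordable only up to radius O(log n). This is why the cut has to
  reproduce the bound on the distance of the ends without any loss, and why \<open>L\<close> is a
  multiple of the logarithm plus a constant. The cut need not be balanced, so the number of rounds
  is linear rather than logarithmic in the length of the path. Optimality survives because costs are
  additive under concatenation: either half may be replaced by the cheapest known path with the same
  ends and value. The generators of the instances need not be those for which hyperbolicity is
  assumed; a letter of an instance becomes an edge labelled by a word over the latter, and the bound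
  \<open>c0\<close> on the lengths of these words enters \<open>L\<close>. Tables that depend on the
  group alone, such as the rules of Dehn's algorithm, are constants built into the machine; only
  their existence matters, so they may be obtained by choice.\<close>

locale word_group = group G for G (structure) +
  fixes m :: nat and v :: "nat \<Rightarrow> 'a" and iv :: "nat \<Rightarrow> nat"
  assumes v_closed [simp]: "v j \<in> carrier G"
    and iv_less: "j < m \<Longrightarrow> iv j < m"
    and v_iv: "j < m \<Longrightarrow> v (iv j) = inv (v j)"
begin

definition ev :: "nat list \<Rightarrow> 'a" where "ev w = foldr (\<lambda>j x. v j \<otimes> x) w \<one>"

definition nrm :: "'a \<Rightarrow> nat" where
  "nrm g = (LEAST n. \<exists>w\<in>lists {..<m}. length w = n \<and> ev w = g)"

definition winv :: "nat list \<Rightarrow> nat list" where "winv w = rev (map iv w)"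

definition gdist :: "'a \<Rightarrow> 'a \<Rightarrow> real" where "gdist g h = real (nrm (inv g \<otimes> h))"

lemma ev_simps [simp]: "ev [] = \<one>" "ev (j # w) = v j \<otimes> ev w"
  by (simp_all add: ev_def)

lemma ev_closed [simp]: "ev w \<in> carrier G"
  by (induction w) auto

lemma ev_append: "ev (u @ w) = ev u \<otimes> ev w"
  by (induction u) (auto simp: m_assoc)

lemma ev_winv: "w \<in> lists {..<m} \<Longrightarrow> ev (winv w) = inv (ev w)"
  by (induction w) (auto simp: winv_def ev_append v_iv inv_mult_group)

lemma winv_lists: "w \<in> lists {..<m} \<Longrightarrow> winv w \<in> lists {..<m}"
  by (induction w) (auto simp: winv_def iv_less)

lemma length_winv [simp]: "length (winv w) = length w"
  by (simp add: winv_def)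

lemma nrm_le: "w \<in> lists {..<m} \<Longrightarrow> nrm (ev w) \<le> length w"
  unfolding nrm_def by (rule Least_le) auto

end

section \<open>Norm and metric of a generating set\<close>

locale generated_word_group = word_group +
  assumes gen: "g \<in> carrier G \<Longrightarrow> \<exists>w\<in>lists {..<m}. ev w = g"
begin

lemma nrm_ex:
  assumes "g \<in> carrier G"
  shows "\<exists>w\<in>lists {..<m}. length w = nrm g \<and> ev w = g"
proof -
  have "\<exists>n. \<exists>w\<in>lists {..<m}. length w = n \<and> ev w = g" using gen[OF assms] by blast
  from LeastI_ex[OF this] show ?thesis unfolding nrm_def .
qed

lemma nrm_one [simp]: "nrm \<one> = 0"
  using nrm_le[of "[]"] by simp

lemma nrm_mult: "g \<in> carrier G \<Longrightarrow> h \<in> carrier G \<Longrightarrow> nrm (g \<otimes> h) \<le> nrm g + nrm h"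
  using nrm_ex[of g] nrm_ex[of h] nrm_le by (metis append_in_lists_conv ev_append length_append)

lemma nrm_inv_le: "g \<in> carrier G \<Longrightarrow> nrm (inv g) \<le> nrm g"
  using nrm_ex[of g] nrm_le winv_lists ev_winv length_winv by metis

lemma nrm_inv: "g \<in> carrier G \<Longrightarrow> nrm (inv g) = nrm g"
  using nrm_inv_le[of g] nrm_inv_le[of "inv g"] by simp

lemma gdist_nonneg [simp]: "0 \<le> gdist g h" by (simp add: gdist_def)

lemma gdist_commute: "g \<in> carrier G \<Longrightarrow> h \<in> carrier G \<Longrightarrow> gdist g h = gdist h g"
  using nrm_inv[of "inv g \<otimes> h"] by (simp add: gdist_def inv_mult_group)

lemma gdist_triangle:
  assumes "g \<in> carrier G" "h \<in> carrier G" "k \<in> carrier G"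
  shows "gdist g k \<le> gdist g h + gdist h k"
proof -
  have "inv g \<otimes> k = (inv g \<otimes> h) \<otimes> (inv h \<otimes> k)"
    using assms by (simp add: m_assoc inv_solve_left' flip: m_assoc[of h])
  then show ?thesis using nrm_mult[of "inv g \<otimes> h" "inv h \<otimes> k"] assms by (simp add: gdist_def)
qed

end

section \<open>Paths and closed words under Gromov's four-point condition\<close>

locale hyperbolic_word_group = generated_word_group +
  fixes \<delta> :: real
  assumes delta_nonneg: "0 \<le> \<delta>"
    and hyp: "\<lbrakk>w \<in> carrier G; x \<in> carrier G; y \<in> carrier G; z \<in> carrier G\<rbrakk> \<Longrightarrow>
      min (gromov_product gdist w x y) (gromov_product gdist w y z) - \<delta> \<le> gromov_product gdist w x z"
begin

text \<open>Bisecting the chain loses one \<delta> per level of the bisection instead of one per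
  step, so the loss is logarithmic in the number of steps.\<close>

lemma gromov_chain:
  assumes p: "\<And>i. p i \<in> carrier G" and w: "w \<in> carrier G"
    and "a < b" "b - a \<le> 2 ^ \<tau>"
    and M: "\<And>i. a \<le> i \<Longrightarrow> i < b \<Longrightarrow> M \<le> gromov_product gdist w (p i) (p (Suc i))"
  shows "M - \<delta> * real \<tau> \<le> gromov_product gdist w (p a) (p b)"
  using assms(3-5)
proof (induction \<tau> arbitrary: a b)
  case 0
  then have "b = Suc a" by simp
  then show ?case using 0 by simp
next
  case (Suc \<tau>)
  show ?case
  proof (cases "b = Suc a")
    case True
    then show ?thesis using Suc.prems(3)[of a] delta_nonneg
      by (auto intro: order_trans[rotated])
  next
    case False
    define c where "c = a + (b - a) div 2"
    have c: "a < c" "c < b" "c - a \<le> 2 ^ \<tau>" "b - c \<le> 2 ^ \<tau>"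
      using Suc.prems False by (auto simp: c_def)
    have "M - \<delta> * real \<tau> \<le> gromov_product gdist w (p a) (p c)"
      "M - \<delta> * real \<tau> \<le> gromov_product gdist w (p c) (p b)"
      by (rule Suc.IH; use c Suc.prems in auto)+
    then show ?thesis using hyp[OF w p[of a] p[of c] p[of b]] by (simp add: algebra_simps)
  qed
qed

text \<open>A path stays logarithmically close to the midpoint of a geodesic between its ends;
  cutting it there halves the distance to be covered.\<close>

lemma split_path:
  assumes p: "\<And>i. p i \<in> carrier G" and l: "2 \<le> l" "l \<le> 2 ^ \<tau>"
    and step: "\<And>i. i < l \<Longrightarrow> gdist (p i) (p (Suc i)) \<le> c"
    and D: "gdist (p 0) (p l) \<le> L" and L: "4 * \<delta> * real \<tau> + 3 * c + 4 \<le> L"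
  shows "\<exists>k. 0 < k \<and> k < l \<and> gdist (p 0) (p k) \<le> L \<and> gdist (p k) (p l) \<le> L"
proof -
  have c0: "0 \<le> c" using order_trans[OF gdist_nonneg step[of 0]] l by simp
  have t0: "0 \<le> \<delta> * real \<tau>" using delta_nonneg by simp
  show ?thesis
  \<comment> \<open>If there is room for one more edge, the first edge is cut off. Otherwise the
    ends are far apart, and this distance later rules out a cut at 0.\<close>
  proof (cases "gdist (p 0) (p l) + c \<le> L")
    case True
    have "gdist (p 1) (p l) \<le> gdist (p 1) (p 0) + gdist (p 0) (p l)" by (rule gdist_triangle) (auto simp: p)
    then have "gdist (p 1) (p l) \<le> L" using True step[of 0] l gdist_commute[OF p p, of 0 1] by simp
    moreover have "gdist (p 0) (p 1) \<le> L" using step[of 0] l L c0 t0 by simp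
    ultimately show ?thesis using l by (intro exI[of _ 1]) auto
  next
    case False
    define D where "D = nrm (inv (p 0) \<otimes> p l)"
    have Dd: "gdist (p 0) (p l) = real D" by (simp add: gdist_def D_def)
    obtain u where u: "u \<in> lists {..<m}" "length u = D" "ev u = inv (p 0) \<otimes> p l"
      using nrm_ex[of "inv (p 0) \<otimes> p l"] p by (auto simp: D_def)
    \<comment> \<open>The midpoint, up to rounding, of the geodesic spelled by \<open>u\<close>; the
      Gromov product of the two ends at \<open>w\<close> is therefore at most 0.\<close>
    define w where "w = p 0 \<otimes> ev (take (D div 2) u)"
    have w: "w \<in> carrier G" using p by (simp add: w_def)
    have tu: "take n u \<in> lists {..<m}" "drop n u \<in> lists {..<m}" for n
      using u(1) by (auto dest: in_set_takeD in_set_dropD)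
    have d0: "gdist (p 0) w \<le> real (D div 2)"
      using nrm_le[OF tu(1)[of "D div 2"]] u(2) p
      by (simp add: gdist_def w_def flip: m_assoc)
    have "p l = p 0 \<otimes> ev u" using u(3) p by (simp flip: m_assoc)
    also have "\<dots> = w \<otimes> ev (drop (D div 2) u)"
      using ev_append[of "take (D div 2) u" "drop (D div 2) u"] p by (simp add: w_def m_assoc)
    finally have "inv w \<otimes> p l = ev (drop (D div 2) u)" using w by (simp flip: m_assoc)
    then have dl: "gdist w (p l) \<le> real (D - D div 2)"
      using nrm_le[OF tu(2)[of "D div 2"]] u(2) by (simp add: gdist_def)
    \<comment> \<open>If all edges had larger products at \<open>w\<close>, the chain estimate would
      leave at least 1/2 for the product of the ends. An edge with a small product has both its ends
      near \<open>w\<close>.\<close>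
    have "\<exists>i<l. gromov_product gdist w (p i) (p (Suc i)) < \<delta> * real \<tau> + 1 / 2"
    proof (rule ccontr)
      assume "\<not> ?thesis"
      then have "(\<delta> * real \<tau> + 1 / 2) - \<delta> * real \<tau> \<le> gromov_product gdist w (p 0) (p l)"
        using l by (intro gromov_chain[OF p w]) auto
      moreover have "gromov_product gdist w (p 0) (p l) \<le> 0"
        using d0 dl gdist_commute[OF w p, of l] Dd by (simp add: gromov_product_def)
      ultimately show False by simp
    qed
    then obtain i where i: "i < l" "gromov_product gdist w (p i) (p (Suc i)) < \<delta> * real \<tau> + 1 / 2" by blast
    let ?R = "2 * \<delta> * real \<tau> + 1 + c"
    have R: "gdist (p i) w < ?R"
    proof -
      have "gdist (p i) w + gdist (p (Suc i)) w - gdist (p i) (p (Suc i)) < 2 * (\<delta> * real \<tau>) + 1"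
        using i(2) by (simp add: gromov_product_def)
      then show ?thesis using step[OF i(1)] gdist_nonneg[of "p (Suc i)" w] by linarith
    qed
    have half: "real (D div 2) \<le> real D / 2" "real (D - D div 2) \<le> (real D + 1) / 2"
    proof -
      have "2 * (D - D div 2) \<le> D + 1" by presburger
      then have "real (2 * (D - D div 2)) \<le> real (D + 1)" by (rule of_nat_mono)
      then show "real (D - D div 2) \<le> (real D + 1) / 2" by simp
    qed linarith
    \<comment> \<open>A cut at 0 would put \<open>p 0\<close> within \<open>?R\<close> of the
      midpoint and give \<open>D\<close> < 2 \<open>?R\<close> + 1 = 4\<delta>\<tau> + 2c + 3,
      whereas \<open>D\<close> > \<open>L\<close> - c. The third c in the hypothesis on
      \<open>L\<close> is spent here.\<close>
    have i0: "i \<noteq> 0"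
    proof
      assume "i = 0"
      then have "gdist (p 0) (p l) < ?R + (real D + 1) / 2"
        using R dl half gdist_triangle[OF p w p, of 0 l] by (simp only:)
      then show False using False L Dd by (simp add: field_simps)
    qed
    have "gdist (p 0) (p i) \<le> real D / 2 + ?R"
      using gdist_triangle[OF p w p, of 0 i] gdist_commute[OF w p, of i] d0 half R by linarith
    moreover have "gdist (p i) (p l) \<le> ?R + (real D + 1) / 2"
      using gdist_triangle[OF p w p, of i l] dl half R by linarith
    moreover have "real D / 2 + ?R \<le> L" "?R + (real D + 1) / 2 \<le> L"
      using assms(5) Dd L c0 by (simp_all add: field_simps)
    ultimately show ?thesis using i0 i(1) by (intro exI[of _ i]) auto
  qed
qed

text \<open>Dehn's algorithm applies since a closed path is never a local geodesic.\<close>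

lemma non_geodesic_subword:
  assumes w: "w \<in> lists {..<m}" "w \<noteq> []" "ev w = \<one>" and h: "2 * \<delta> < real h"
  shows "\<exists>a u b. w = a @ u @ b \<and> length u \<le> 4 * h \<and> nrm (ev u) < length u"
proof (rule ccontr)
  assume contra: "\<not> ?thesis"
  have geo: "nrm (ev u) = length u" if "w = a @ u @ b" "length u \<le> 4 * h" for a u b
  proof -
    have "u \<in> lists {..<m}" using that(1) w(1) by auto
    then show ?thesis using nrm_le[of u] contra that by force
  qed
  have h0: "0 < h" using h delta_nonneg by simp
  define y where "y n = ev (take n w)" for n
  have y [simp]: "y n \<in> carrier G" for n by (simp add: y_def)
  have y0: "y 0 = \<one>" by (simp add: y_def)
  have dist: "gdist (y a) (y b) = real (b - a)" if "a \<le> b" "b \<le> length w" "b - a \<le> 4 * h" for a b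
  proof -
    let ?u = "take (b - a) (drop a w)"
    have tb: "take b w = take a w @ ?u" using that by (metis le_add_diff_inverse take_add)
    have "w = take a w @ ?u @ drop b w" using tb by (metis append.assoc append_take_drop_id)
    then have "nrm (ev ?u) = b - a" using geo[of "take a w" ?u "drop b w"] that by simp
    moreover have "inv (y a) \<otimes> y b = ev ?u"
      unfolding y_def tb ev_append by (simp flip: m_assoc)
    ultimately show ?thesis by (simp add: gdist_def)
  qed
  \<comment> \<open>Seen from \<open>y n\<close>, the origin and a point ahead lie in nearly
    opposite directions. In the step from n - h to n, the product of \<open>y (n - h)\<close> with
    the origin is at least h - \<delta> > \<delta>, and its product with the point ahead is 0, both
    lying on one geodesic piece of length at most 3h. So the minimum in the hyperbolicity inequality
    must be the remaining product, which is then at most \<delta>.\<close>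
  have prod: "gromov_product gdist (y n) (y 0) (y (n + k)) \<le> \<delta>"
    if "h \<le> n" "h \<le> k" "k \<le> 2 * h" "n + k \<le> length w" for n k
    using that
  proof (induction n arbitrary: k rule: less_induct)
    case (less n)
    show ?case
    proof (cases "n \<le> 2 * h")
      \<comment> \<open>The whole stretch from the origin has length at most 4h and is geodesic; the
        bound on the lengths of the subwords comes from here.\<close>
      case True
      then have "gromov_product gdist (y n) (y 0) (y (n + k)) = 0"
        using less.prems dist[of 0 n] dist[of n "n + k"] dist[of 0 "n + k"]
          gdist_commute[OF y y, of "n + k" n]
        by (simp add: gromov_product_def)
      then show ?thesis using delta_nonneg by simp
    next
      case False
      define n' where "n' = n - h"
      have n': "n = n' + h" "h \<le> n'" "n' < n" using False h0 by (auto simp: n'_def)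
      have 1: "gromov_product gdist (y n') (y 0) (y n) \<le> \<delta>"
        using less.IH[of n' h] n' less.prems by simp
      have d1: "gdist (y n') (y n) = real h" using dist[of n' n] n' less.prems by simp
      have 2: "gromov_product gdist (y n) (y n') (y (n + k)) = 0"
        using less.prems dist[of n "n + k"] dist[of n' "n + k"] n' d1
          gdist_commute[OF y y, of "n + k" n]
        by (simp add: gromov_product_def)
      have 3: "gromov_product gdist (y n) (y n') (y 0) = real h - gromov_product gdist (y n') (y 0) (y n)"
        using d1 gdist_commute[OF y y, of n' n] gdist_commute[OF y y, of 0 n]  gdist_commute[OF y y, of 0 n']
        by (simp add: gromov_product_def field_simps)
      show ?thesis using hyp[of "y n" "y n'" "y 0" "y (n + k)"] 1 2 3 h by simp
    qed
  qed
  show False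
  proof (cases "length w \<le> 4 * h")
    case True
    then show False using geo[of "[]" w "[]"] w by simp
  next
    case False
    \<comment> \<open>As the path closes up after h more letters, the product at \<open>y n\<close>
      is half of h plus the distance to the origin; being at most \<delta>, it contradicts the
      choice of h.\<close>
    define n where "n = length w - h"
    have n: "length w = n + h" "h \<le> n" using False by (auto simp: n_def)
    have "gromov_product gdist (y n) (y 0) (y (n + h)) \<le> \<delta>" using prod[of n h] n by simp
    moreover have "gdist (y n) (y (n + h)) = real h" using dist[of n "n + h"] n by simp
    moreover have "gdist (y 0) (y (n + h)) = 0" using w(3) n y0 by (simp add: y_def gdist_def)
    ultimately have "gdist (y 0) (y n) \<le> 2 * \<delta> - real h"
      using gdist_commute[OF y y, of "n + h" n] by (simp add: gromov_product_def field_simps)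
    then show False using h gdist_nonneg[of "y 0" "y n"] by linarith
  qed
qed

end

section \<open>Structured programs for Turing machines\<close>

text \<open>Tape symbols are coded by natural numbers, the blank by 0.\<close>

type_synonym ntape = "(int \<Rightarrow> nat) \<times> int"

text \<open>A basic command acts on one tape only. \<open>While i s c\<close> loops until tape
  \<open>i\<close> shows \<open>s\<close>; with the blank as \<open>s\<close> this empties a
  stack.\<close>

datatype prog =
    Write nat nat
  | Move nat move
  | Seq prog prog
  | Cond nat nat prog prog
  | While nat nat prog

definition scan :: "ntape list \<Rightarrow> nat list" where
  "scan ts = map (\<lambda>(t, h). t h) ts"

fun next_ctrl :: "nat list \<Rightarrow> prog list \<Rightarrow> prog list" where
  "next_ctrl ss [] = []"
| "next_ctrl ss (Write i s # k) = k"
| "next_ctrl ss (Move i m # k) = k"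
| "next_ctrl ss (Seq c1 c2 # k) = c1 # c2 # k"
| "next_ctrl ss (Cond i s c1 c2 # k) = (if ss ! i = s then c1 else c2) # k"
| "next_ctrl ss (While i s c # k) = (if ss ! i = s then k else c # While i s c # k)"

fun action :: "nat list \<Rightarrow> prog list \<Rightarrow> (nat \<times> move) list" where
  "action ss (Write i s # k) = (map (\<lambda>x. (x, Stay)) ss)[i := (s, Stay)]"
| "action ss (Move i m # k) = (map (\<lambda>x. (x, Stay)) ss)[i := (ss ! i, m)]"
| "action ss k = map (\<lambda>x. (x, Stay)) ss"

fun effect :: "prog list \<Rightarrow> ntape list \<Rightarrow> ntape list" where
  "effect (Write i s # k) ts = ts[i := ((fst (ts ! i))(snd (ts ! i) := s), snd (ts ! i))]"
| "effect (Move i m # k) ts = ts[i := (fst (ts ! i), snd (ts ! i) + offset m)]"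
| "effect k ts = ts"

fun pstep :: "prog list \<times> ntape list \<Rightarrow> prog list \<times> ntape list" where
  "pstep (k, ts) = (next_ctrl (scan ts) k, effect k ts)"

fun writes :: "prog \<Rightarrow> nat set" where
  "writes (Write i s) = {s}"
| "writes (Move i m) = {}"
| "writes (Seq c1 c2) = writes c1 \<union> writes c2"
| "writes (Cond i s c1 c2) = writes c1 \<union> writes c2"
| "writes (While i s c) = writes c"

text \<open>The control states of the machine for a program are the stacks of commands that are still
  to be executed; only finitely many of them are reachable.\<close>

fun residuals :: "prog \<Rightarrow> prog list \<Rightarrow> prog list set" where
  "residuals (Write i s) k = {Write i s # k, k}"
| "residuals (Move i m) k = {Move i m # k, k}"
| "residuals (Seq c1 c2) k = insert (Seq c1 c2 # k) (residuals c1 (c2 # k) \<union> residuals c2 k)"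
| "residuals (Cond i s c1 c2) k = insert (Cond i s c1 c2 # k) (residuals c1 k \<union> residuals c2 k)"
| "residuals (While i s c) k = {While i s c # k, k} \<union> residuals c (While i s c # k)"

lemma finite_residuals: "finite (residuals c k)"
  by (induction c arbitrary: k) auto

lemma residuals_start: "c # k \<in> residuals c k" and residuals_end: "k \<in> residuals c k"
  by (induction c arbitrary: k) auto

lemma next_ctrl_residuals:
  "x \<in> residuals c k \<Longrightarrow> x = k \<or> next_ctrl ss x \<in> residuals c k"
proof (induction c arbitrary: k)
  case (While i s c)
  from While.prems consider "x = While i s c # k" | "x = k" | "x \<in> residuals c (While i s c # k)" "x \<noteq> While i s c # k"
    by auto
  then show ?case
    using While.IH[of "While i s c # k"] residuals_start[of c "While i s c # k"] by cases auto
next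
  case (Seq c1 c2)
  then show ?case using residuals_start[of c1 "c2 # k"] residuals_start[of c2 k] by fastforce
next
  case (Cond i s c1 c2)
  then show ?case
    using residuals_start[of c1 k] residuals_start[of c2 k] by (auto split: if_splits)
qed auto

text \<open>Only symbols just scanned or named in the program are ever written, which gives the
  machine a finite alphabet.\<close>

lemma action_residuals:
  assumes "x \<in> residuals c k" "x \<noteq> k"
  shows "fst ` set (action ss x) \<subseteq> set ss \<union> writes c"
  using assms
proof (induction c arbitrary: k)
  case (Write i s)
  then show ?case
    by (cases "i < length ss") (auto dest!: set_update_subset_insert[THEN subsetD] simp: list_update_beyond)
next
  case (Move i m)
  then show ?case
    by (cases "i < length ss") (auto dest!: set_update_subset_insert[THEN subsetD] simp: list_update_beyond)
next
  case (Seq c1 c2)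
  from Seq.prems consider "x = Seq c1 c2 # k" | "x \<in> residuals c1 (c2 # k)" "x \<noteq> c2 # k" | "x \<in> residuals c2 k"
    using residuals_start[of c2 k] by auto
  then show ?case using Seq.IH(1)[of "c2 # k"] Seq.IH(2)[of k] Seq.prems(2) by cases auto
next
  case (Cond i s c1 c2)
  from Cond.prems consider "x = Cond i s c1 c2 # k" | "x \<in> residuals c1 k" | "x \<in> residuals c2 k"
    by auto
  then show ?case using Cond.IH[of k] Cond.prems(2) by cases auto
next
  case (While i s c)
  from While.prems consider "x = While i s c # k" | "x \<in> residuals c (While i s c # k)" "x \<noteq> While i s c # k"
    by auto
  then show ?case using While.IH[of "While i s c # k"] by cases auto
qed

definition ncontent :: "nat list \<Rightarrow> int \<Rightarrow> nat" where
  "ncontent w i = (if 0 \<le> i \<and> i < int (length w) then w ! nat i else 0)"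

definition emb :: "(nat \<Rightarrow> 'c tape_symbol) \<Rightarrow> ntape \<Rightarrow> 'c tape" where
  "emb sy = (\<lambda>(t, h). (\<lambda>i. sy (t i), h))"

lemma length_action [simp]: "length (action ss k) = length ss"
  by (cases "(ss, k)" rule: action.cases) auto

lemma length_effect [simp]: "length (effect k ts) = length ts"
  by (cases "(k, ts)" rule: effect.cases) auto

lemma act_emb_stay: "act (emb sy t) (sy (fst t (snd t)), Stay) = emb sy t"
  by (cases t) (auto simp: emb_def)

lemma nth_list_update': "j < length xs \<Longrightarrow> xs[i := x] ! j = (if i = j then x else xs ! j)"
  by (cases "i = j") auto

text \<open>A machine acts on all its tapes at once. On the tapes that a command leaves alone it
  rewrites the scanned symbol and stays.\<close>

lemma emb_effect:
  "map2 act (map (emb sy) ts) (map (\<lambda>(s, m). (sy s, m)) (action (scan ts) k))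
   = map (emb sy) (effect k ts)"
proof (rule nth_equalityI)
  fix j
  assume "j < length (map2 act (map (emb sy) ts) (map (\<lambda>(s, m). (sy s, m)) (action (scan ts) k)))"
  then have j: "j < length ts" by (simp add: scan_def)
  have s: "scan ts ! j = fst (ts ! j) (snd (ts ! j))"
    using j by (simp add: scan_def case_prod_beta)
  have *: "map2 act (map (emb sy) ts) (map (\<lambda>(s, m). (sy s, m)) (action (scan ts) k)) ! j
     = act (emb sy (ts ! j)) (case action (scan ts) k ! j of (s, m) \<Rightarrow> (sy s, m))"
    using j by (simp add: scan_def)
  have l: "length (scan ts) = length ts" by (simp add: scan_def)
  have "act (emb sy (ts ! j)) (case action (scan ts) k ! j of (s, m) \<Rightarrow> (sy s, m))
        = emb sy (effect k ts ! j)"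
    using j s l act_emb_stay[of sy "ts ! j"]
    by (cases "(k, ts)" rule: effect.cases)
       (auto simp: nth_list_update' emb_def case_prod_beta fun_eq_iff)
  then show "map2 act (map (emb sy) ts) (map (\<lambda>(s, m). (sy s, m)) (action (scan ts) k)) ! j
     = map (emb sy) (effect k ts) ! j" using * j by simp
qed (simp add: scan_def)

text \<open>Control stacks are numbered to serve as states, the empty one being the halting state.
  It is absorbing, so a run that ends early can be prolonged to exactly the prescribed polynomial
  number of steps.\<close>

theorem poly_time_computableI:
  fixes f :: "'c list \<Rightarrow> 'c list" and p :: "nat poly"
  assumes sy: "inj sy" "sy 0 = Blank"
    and n: "writes c \<subseteq> {..<n}" "0 < n" and K: "0 < K"
    and A: "Sym ` A \<subseteq> sy ` {..<n}"
    and run: "\<And>w. w \<in> lists A \<Longrightarrow> \<exists>cw t ts cv. map sy cw = map Sym w \<and> t \<le> poly p (length w) \<and>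
        (pstep ^^ t) ([c], (ncontent cw, 0) # replicate (K - 1) (ncontent [], 0)) = ([], ts) \<and>
        fst (last ts) = ncontent cv \<and> map sy cv = map Sym (f w)"
  shows "poly_time_computable A f"
proof -
  let ?R = "residuals c []"
  obtain code :: "prog list \<Rightarrow> nat" where code: "inj_on code ?R"
    using finite_imp_inj_to_nat_seg[OF finite_residuals[of c "[]"]] by blast
  define dec where "dec = inv_into ?R code"
  have dec: "dec (code k) = k" if "k \<in> ?R" for k
    unfolding dec_def using code that by simp
  define M where "M = \<lparr>num_tapes = K, alphabet = sy ` {..<n}, states = code ` ?R,
     start_state = code [c], halt_state = code [],
     delta = (\<lambda>q ss. (code (next_ctrl (map (inv_into UNIV sy) ss) (dec q)),
        map (\<lambda>(s, m). (sy s, m)) (action (map (inv_into UNIV sy) ss) (dec q))))\<rparr>"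
  have nextR: "next_ctrl ss k \<in> ?R" if "k \<in> ?R" for k ss
    using next_ctrl_residuals[OF that, of ss] residuals_end[of "[]" c] by auto
  have tm: "turing_machine_over A M"
    unfolding turing_machine_over_def
  proof (intro conjI ballI impI)
    fix q ss assume q: "q \<in> states M" and ss: "ss \<in> lists (alphabet M)" "length ss = num_tapes M"
    from q obtain k where k: "k \<in> ?R" "q = code k" by (auto simp: M_def)
    have sub: "set (map (inv_into UNIV sy) ss) \<subseteq> {..<n}" using ss sy(1) by (auto simp: M_def)
    have "fst ` set (action (map (inv_into UNIV sy) ss) k) \<subseteq> {..<n}"
    proof (cases "k = []")
      case True
      then show ?thesis using sub by auto
    next
      case False
      then show ?thesis using action_residuals[OF k(1) False, of "map (inv_into UNIV sy) ss"] sub n(1) by blast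
    qed
    then have "fst ` set (map (\<lambda>(s, m). (sy s, m)) (action (map (inv_into UNIV sy) ss) k)) \<subseteq> sy ` {..<n}"
      by force
    then show "case delta M q ss of (q', as) \<Rightarrow>
      q' \<in> states M \<and> length as = num_tapes M \<and> fst ` set as \<subseteq> alphabet M"
      using ss nextR[OF k(1)] k by (auto simp: M_def dec)
  qed (use K n A sy residuals_start[of c "[]"] residuals_end[of "[]" c] in
       \<open>auto simp: M_def finite_residuals intro!: image_eqI[of Blank sy 0]\<close>)
  have step1: "step M (code k, map (emb sy) ts) = map_prod code (map (emb sy)) (pstep (k, ts))"
    if k: "k \<in> ?R" for k ts
  proof (cases "k = []")
    case True
    then show ?thesis by (simp add: M_def)
  next
    case False
    then have "code k \<noteq> code []" using code k residuals_end[of "[]" c] by (auto dest: inj_onD)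
    moreover have "map (inv_into UNIV sy) (map (\<lambda>(t, h). t h) (map (emb sy) ts)) = scan ts"
      using sy(1) by (auto simp: scan_def emb_def)
    ultimately show ?thesis using k emb_effect[of sy ts k] by (simp add: M_def dec)
  qed
  have steps: "fst ((pstep ^^ t) (k, ts)) \<in> ?R \<and>
      (step M ^^ t) (code k, map (emb sy) ts) = map_prod code (map (emb sy)) ((pstep ^^ t) (k, ts))"
    if "k \<in> ?R" for k ts t
  proof (induction t)
    case (Suc t)
    obtain k' ts' where e: "(pstep ^^ t) (k, ts) = (k', ts')" by fastforce
    then show ?case using Suc step1[of k' ts'] nextR[of k'] by simp
  qed (use that in simp)
  have halt: "(step M ^^ t) (code [], ts) = (code [], ts)" for t ts
    by (induction t) (auto simp: M_def)
  have "outputs_within M w (poly p (length w)) (f w)" if w: "w \<in> lists A" for w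
  proof -
    obtain cw t ts cv where r: "map sy cw = map Sym w" "t \<le> poly p (length w)"
        "(pstep ^^ t) ([c], (ncontent cw, 0) # replicate (K - 1) (ncontent [], 0)) = ([], ts)"
        "fst (last ts) = ncontent cv" "map sy cv = map Sym (f w)"
      using run[OF w] by blast
    have content: "(\<lambda>i. sy (ncontent v i)) = tape_content u" if "map sy v = map Sym u" for u v
    proof
      fix i
      have "length v = length u" using that by (metis length_map)
      moreover have "sy (v ! j) = Sym (u ! j)" if "j < length u" for j
        using \<open>map sy v = map Sym u\<close> that calculation by (metis nth_map)
      ultimately show "sy (ncontent v i) = tape_content u i"
        using sy(2) by (auto simp: ncontent_def tape_content_def)
    qed
    let ?ts = "(ncontent cw, 0) # replicate (K - 1) (ncontent [], 0)"
    have init: "initial M w = (code [c], map (emb sy) ?ts)"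
      using content[OF r(1)] content[of "[]" "[]"] by (simp add: initial_def M_def emb_def)
    have len: "length (snd ((pstep ^^ t) (k, ts))) = length ts" for t k ts
    proof (induction t)
      case (Suc t)
      then show ?case by (cases "(pstep ^^ t) (k, ts)") auto
    qed simp
    have ne: "ts \<noteq> []" using len[of t "[c]" ?ts] r(3) by auto
    have "(step M ^^ t) (code [c], map (emb sy) ?ts) = (code [], map (emb sy) ts)"
      using steps[OF residuals_start[of c "[]"], of t ?ts] unfolding r(3) by simp
    then have "(step M ^^ (poly p (length w) - t + t)) (initial M w) = (code [], map (emb sy) ts)"
      unfolding funpow_add init o_apply by (simp only: halt)
    then have "(step M ^^ poly p (length w)) (initial M w) = (code [], map (emb sy) ts)"
      using r(2) by simp
    moreover have "fst (last (map (emb sy) ts)) = tape_content (f w)"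
      using ne r(4) content[OF r(5)] by (simp add: last_map emb_def case_prod_beta)
    ultimately show ?thesis by (simp add: outputs_within_def M_def)
  qed
  then show ?thesis unfolding poly_time_computable_def using tm by blast
qed

text \<open>The number of steps is chosen before the commands \<open>k\<close> that follow, so that
  runs can be composed in any context.\<close>

definition runs :: "prog \<Rightarrow> nat \<Rightarrow> ntape list \<Rightarrow> ntape list \<Rightarrow> bool" where
  "runs c T ts ts' \<longleftrightarrow> (\<exists>t\<le>T. \<forall>k. (pstep ^^ t) (c # k, ts) = (k, ts'))"

lemma runs_mono: "runs c T ts ts' \<Longrightarrow> T \<le> T' \<Longrightarrow> runs c T' ts ts'"
  by (auto simp: runs_def intro: order_trans)

lemma runs_Write: "runs (Write i s) 1 ts (ts[i := ((fst (ts ! i))(snd (ts ! i) := s), snd (ts ! i))])"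
  unfolding runs_def by (intro exI[of _ 1]) simp

lemma runs_Move: "runs (Move i m) 1 ts (ts[i := (fst (ts ! i), snd (ts ! i) + offset m)])"
  unfolding runs_def by (intro exI[of _ 1]) simp

lemma runs_Seq:
  assumes "runs c1 T1 ts ts1" "runs c2 T2 ts1 ts2"
  shows "runs (Seq c1 c2) (Suc (T1 + T2)) ts ts2"
proof -
  obtain t1 t2 where "t1 \<le> T1" "\<And>k. (pstep ^^ t1) (c1 # k, ts) = (k, ts1)"
    "t2 \<le> T2" "\<And>k. (pstep ^^ t2) (c2 # k, ts1) = (k, ts2)"
    using assms unfolding runs_def by blast
  then show ?thesis unfolding runs_def
    by (intro exI[of _ "Suc (t2 + t1)"])
       (auto simp add: funpow_Suc_right funpow_add simp del: funpow.simps)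
qed

lemma runs_Cond:
  assumes "runs (if scan ts ! i = s then c1 else c2) T ts ts'"
  shows "runs (Cond i s c1 c2) (Suc T) ts ts'"
proof -
  obtain t where "t \<le> T" "\<And>k. (pstep ^^ t) ((if scan ts ! i = s then c1 else c2) # k, ts) = (k, ts')"
    using assms unfolding runs_def by blast
  then show ?thesis unfolding runs_def
    by (intro exI[of _ "Suc t"]) (auto simp add: funpow_Suc_right simp del: funpow.simps)
qed

lemma runs_While_end: "scan ts ! i = s \<Longrightarrow> runs (While i s c) 1 ts ts"
  unfolding runs_def by (intro exI[of _ 1]) simp

lemma runs_While_step:
  assumes "scan ts ! i \<noteq> s" "runs c T1 ts ts1" "runs (While i s c) T2 ts1 ts2"
  shows "runs (While i s c) (Suc (T1 + T2)) ts ts2"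
proof -
  obtain t1 t2 where "t1 \<le> T1" "\<And>k. (pstep ^^ t1) (c # k, ts) = (k, ts1)"
    "t2 \<le> T2" "\<And>k. (pstep ^^ t2) (While i s c # k, ts1) = (k, ts2)"
    using assms unfolding runs_def by blast
  then show ?thesis unfolding runs_def using assms(1)
    by (intro exI[of _ "Suc (t2 + t1)"])
       (auto simp add: funpow_Suc_right funpow_add simp del: funpow.simps)
qed

section \<open>Tapes as stacks\<close>

text \<open>The top of the stack is the rightmost written cell, under the head. For the empty stack
  the head stands at -1 and scans a blank, whence \<open>topmost [] = 0\<close>.\<close>

definition tape_of :: "nat list \<Rightarrow> ntape" where
  "tape_of xs = (ncontent (rev xs), int (length xs) - 1)"

definition srun :: "prog \<Rightarrow> nat \<Rightarrow> nat list list \<Rightarrow> nat list list \<Rightarrow> bool" where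
  "srun c T st st' \<longleftrightarrow> runs c T (map tape_of st) (map tape_of st')"

definition push :: "nat \<Rightarrow> nat \<Rightarrow> prog" where
  "push i s = Seq (Move i move.Right) (Write i s)"

definition pop :: "nat \<Rightarrow> prog" where
  "pop i = Seq (Write i 0) (Move i move.Left)"

definition topmost :: "nat list \<Rightarrow> nat" where
  "topmost xs = (case xs of [] \<Rightarrow> 0 | x # _ \<Rightarrow> x)"

lemma topmost_simps [simp]: "topmost [] = 0" "topmost (x # xs) = x"
  by (simp_all add: topmost_def)

lemma scan_tape_of: "i < length st \<Longrightarrow> scan (map tape_of st) ! i = topmost (st ! i)"
  by (cases "st ! i") (auto simp: scan_def tape_of_def ncontent_def nth_append)

lemma ncontent_snoc: "(ncontent w)(int (length w) := s) = ncontent (w @ [s])"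
  by (auto simp: ncontent_def fun_eq_iff nth_append)

lemma ncontent_snoc_blank: "(ncontent (w @ [s]))(int (length w) := 0) = ncontent w"
  by (auto simp: ncontent_def fun_eq_iff nth_append)

lemma srun_push: "i < length st \<Longrightarrow> srun (push i s) 3 st (st[i := s # st ! i])"
  unfolding srun_def push_def
  using runs_Seq[OF runs_Move[of i move.Right "map tape_of st"] runs_Write[of i s]]
  by (simp add: tape_of_def map_update eval_nat_numeral flip: ncontent_snoc)

lemma srun_pop:
  assumes "i < length st" "st ! i = x # xs"
  shows "srun (pop i) 3 st (st[i := xs])"
proof -
  have "(ncontent (rev xs @ [x]))(int (length xs) := 0) = ncontent (rev xs)"
    using ncontent_snoc_blank[of "rev xs"] by simp
  then show ?thesis
    unfolding srun_def pop_def
    using runs_Seq[OF runs_Write[of i 0 "map tape_of st"] runs_Move[of i move.Left]] assms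
    by (simp add: tape_of_def map_update eval_nat_numeral)
qed

lemma srun_mono: "srun c T st st' \<Longrightarrow> T \<le> T' \<Longrightarrow> srun c T' st st'"
  by (auto simp: srun_def intro: runs_mono)

lemma srun_Seq:
  "srun c1 T1 st st1 \<Longrightarrow> srun c2 T2 st1 st2 \<Longrightarrow> srun (Seq c1 c2) (Suc (T1 + T2)) st st2"
  by (auto simp: srun_def intro: runs_Seq)

lemma srun_Cond:
  "i < length st \<Longrightarrow> srun (if topmost (st ! i) = s then c1 else c2) T st st' \<Longrightarrow>
   srun (Cond i s c1 c2) (Suc T) st st'"
  using scan_tape_of[of i st] by (auto simp: srun_def intro: runs_Cond)

lemma srun_While_end: "i < length st \<Longrightarrow> topmost (st ! i) = s \<Longrightarrow> srun (While i s c) 1 st st"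
  using scan_tape_of[of i st] runs_While_end[of "map tape_of st" i s c] by (simp add: srun_def)

lemma srun_While_step:
  "i < length st \<Longrightarrow> topmost (st ! i) \<noteq> s \<Longrightarrow> srun c T1 st st1 \<Longrightarrow> srun (While i s c) T2 st1 st2 \<Longrightarrow>
   srun (While i s c) (Suc (T1 + T2)) st st2"
  using scan_tape_of[of i st] by (auto simp: srun_def intro: runs_While_step)

lemma list_update_Cons_numeral [simp]:
  "(x # xs)[numeral v := y] = x # xs[pred_numeral v := y]"
  by (simp add: numeral_eq_Suc)

lemma srun_push_last: "i < length st \<Longrightarrow> 3 \<le> T \<Longrightarrow> st' = st[i := s # st ! i] \<Longrightarrow> srun (push i s) T st st'"
  using srun_push srun_mono by blast

lemma srun_pop_last:
  "i < length st \<Longrightarrow> st ! i \<noteq> [] \<Longrightarrow> 3 \<le> T \<Longrightarrow> st' = st[i := tl (st ! i)] \<Longrightarrow> srun (pop i) T st st'"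
  using srun_pop[of i st "hd (st ! i)" "tl (st ! i)"] srun_mono by (auto simp: neq_Nil_conv)

lemma srun_SeqI:
  "srun c1 T1 st st1 \<Longrightarrow> srun c2 T2 st1 st2 \<Longrightarrow> Suc (T1 + T2) \<le> T \<Longrightarrow> srun (Seq c1 c2) T st st2"
  using srun_Seq srun_mono by blast

text \<open>The budget \<open>T\<close> is given in the goal and each rule subtracts its share, so
  straight-line programs are verified by mere repetition of such rules.\<close>

lemma srun_push_Seq:
  "i < length st \<Longrightarrow> 4 \<le> T \<Longrightarrow> srun c (T - 4) (st[i := s # st ! i]) st' \<Longrightarrow>
   srun (Seq (push i s) c) T st st'"
  by (rule srun_SeqI[OF srun_push]) auto

lemma srun_pop_Seq:
  "i < length st \<Longrightarrow> st ! i \<noteq> [] \<Longrightarrow> 4 \<le> T \<Longrightarrow> srun c (T - 4) (st[i := tl (st ! i)]) st' \<Longrightarrow>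
   srun (Seq (pop i) c) T st st'"
  by (rule srun_SeqI[where ?T1.0 = 3, OF srun_pop_last]) auto

lemma srun_CondI:
  "i < length st \<Longrightarrow> 1 \<le> T \<Longrightarrow> srun (if topmost (st ! i) = s then c1 else c2) (T - 1) st st' \<Longrightarrow>
   srun (Cond i s c1 c2) T st st'"
  using srun_Cond[of i st s c1 c2 "T - 1"] by simp

lemma srun_While_endI:
  "i < length st \<Longrightarrow> topmost (st ! i) = s \<Longrightarrow> 1 \<le> T \<Longrightarrow> st' = st \<Longrightarrow> srun (While i s c) T st st'"
  using srun_While_end srun_mono by blast

lemma srun_WhileI:
  "i < length st \<Longrightarrow> topmost (st ! i) \<noteq> s \<Longrightarrow> srun c T1 st st1 \<Longrightarrow> srun (While i s c) T2 st1 st2 \<Longrightarrow>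
   Suc (T1 + T2) \<le> T \<Longrightarrow> srun (While i s c) T st st2"
  using srun_While_step srun_mono by blast

lemmas srun_basic =
  srun_push_Seq srun_pop_Seq srun_push_last srun_pop_last srun_CondI

section \<open>Trees on stacks\<close>

datatype tree = Leaf | Node tree tree

text \<open>Prefix notation is self-delimiting: the end of a tree on a stack can be found without a
  marker. The symbol 0 does not occur and is left to signal an empty stack.\<close>

fun str :: "tree \<Rightarrow> nat list" where
  "str Leaf = [1]"
| "str (Node l r) = 2 # str l @ str r"

definition tsize :: "tree \<Rightarrow> nat" where "tsize t = length (str t)"

lemma tsize_simps [simp]: "tsize Leaf = 1" "tsize (Node l r) = Suc (tsize l + tsize r)"
  by (simp_all add: tsize_def)

lemma str_set: "set (str t) \<subseteq> {1, 2}"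
  by (induction t) auto

lemma str_nonempty [simp]: "str t \<noteq> []"
  by (cases t) auto

definition move_body :: "nat \<Rightarrow> prog" where
  "move_body X = Cond 1 1 (Seq (pop 1) (Seq (push X 1) (pop 4)))
     (Seq (pop 1) (Seq (push X 2) (push 4 1)))"

lemma move_body_leaf:
  assumes "X = 2 \<or> X = 3"
  shows "srun (move_body X) 12 ([i, 1 # r, b, c, 1 # d, out][X := xs]) ([i, r, b, c, d, out][X := 1 # xs])"
proof -
  have "srun (move_body 2) 12 ([i, 1 # r, xs, c, 1 # d, out]) ([i, r, 1 # xs, c, d, out])"
    unfolding move_body_def by (rule srun_basic; simp)+
  moreover have "srun (move_body 3) 12 ([i, 1 # r, b, xs, 1 # d, out]) ([i, r, b, 1 # xs, d, out])"
    unfolding move_body_def by (rule srun_basic; simp)+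
  ultimately show ?thesis using assms by auto
qed

lemma move_body_node:
  assumes "X = 2 \<or> X = 3"
  shows "srun (move_body X) 12 ([i, 2 # r, b, c, d, out][X := xs]) ([i, r, b, c, 1 # d, out][X := 2 # xs])"
proof -
  have "srun (move_body 2) 12 ([i, 2 # r, xs, c, d, out]) ([i, r, 2 # xs, c, 1 # d, out])"
    unfolding move_body_def by (rule srun_basic; simp)+
  moreover have "srun (move_body 3) 12 ([i, 2 # r, b, xs, d, out]) ([i, r, b, 2 # xs, 1 # d, out])"
    unfolding move_body_def by (rule srun_basic; simp)+
  ultimately show ?thesis using assms by auto
qed

text \<open>Stack 4 counts, in unary, the trees that are still to be moved.\<close>

definition move_loop :: "nat \<Rightarrow> prog" where
  "move_loop X = While 4 0 (move_body X)"

text \<open>The run that remains once \<open>t\<close> has been moved is a hypothesis. In this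
  continuation form the induction treats the two subtrees of a node one after the other, whatever
  else is still pending on stack 4.\<close>

lemma move_loop:
  assumes X: "X = 2 \<or> X = 3"
    and "srun (move_loop X) T ([i, r, b, c, d, out][X := rev (str t) @ xs]) st'"
  shows "srun (move_loop X) (T + 13 * tsize t) ([i, str t @ r, b, c, 1 # d, out][X := xs]) st'"
  using assms(2)
proof (induction t arbitrary: T r d xs)
  case Leaf
  have "srun (move_loop X) T ([i, r, b, c, d, out][X := 1 # xs]) st'"
    using Leaf by simp
  from srun_WhileI[OF _ _ move_body_leaf[OF X] this[unfolded move_loop_def], of "T + 13 * tsize Leaf"] X
  show ?case unfolding move_loop_def by auto
next
  case (Node l r')
  have "srun (move_loop X) (T + 13 * tsize r' + 13 * tsize l)
     ([i, str l @ str r' @ r, b, c, 1 # 1 # d, out][X := 2 # xs]) st'"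
    using Node.prems by (intro Node.IH) simp
  from srun_WhileI[OF _ _ move_body_node[OF X] this[unfolded move_loop_def], of "T + 13 * tsize (Node l r')"] X
  show ?case unfolding move_loop_def by auto
qed

definition skip :: prog where "skip = Move 0 Stay"

lemma srun_skip: "0 < length st \<Longrightarrow> srun skip 1 st st"
  unfolding srun_def skip_def using runs_Move[of 0 Stay "map tape_of st"]
  by (cases st) auto

definition move_tree :: "nat \<Rightarrow> prog" where
  "move_tree X = Seq (push 4 1) (move_loop X)"

lemma move_loop_end: "srun (move_loop X) 1 [i, a, b, c, [], out] [i, a, b, c, [], out]"
  unfolding move_loop_def by (rule srun_While_end) auto

lemma move_tree_2:
  "srun (move_tree 2) (5 + 13 * tsize t) [i, str t @ r, b, c, [], out] [i, r, rev (str t) @ b, c, [], out]"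
  unfolding move_tree_def
  by (rule srun_push_Seq; simp)
     (use move_loop[of 2 1 i r b c "[]" out t b] move_loop_end in simp)

lemma move_tree_3:
  "srun (move_tree 3) (5 + 13 * tsize t) [i, str t @ r, b, c, [], out] [i, r, b, rev (str t) @ c, [], out]"
  unfolding move_tree_def
  by (rule srun_push_Seq; simp)
     (use move_loop[of 3 1 i r b c "[]" out t c] move_loop_end in simp)

definition move_all :: "nat \<Rightarrow> nat \<Rightarrow> prog" where
  "move_all X Y = While X 0 (Cond X 1 (Seq (pop X) (push Y 1)) (Seq (pop X) (push Y 2)))"

lemma move_all:
  assumes "X < length st" "Y < length st" "X \<noteq> Y" "st ! X = xs" "set xs \<subseteq> {1, 2}"
  shows "srun (move_all X Y) (1 + 10 * length xs) st (st[X := [], Y := rev xs @ st ! Y])"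
  using assms
proof (induction xs arbitrary: st)
  case Nil
  have "st[X := [], Y := rev [] @ st ! Y] = st"
    using list_update_id[of st X] Nil.prems(4) by simp
  then show ?case unfolding move_all_def using Nil.prems(1,4) by (intro srun_While_endI) simp_all
next
  case (Cons x xs)
  then have x: "x = 1 \<or> x = 2" by simp
  let ?st = "st[X := xs, Y := x # st ! Y]"
  have "srun (Cond X 1 (Seq (pop X) (push Y 1)) (Seq (pop X) (push Y 2))) 9 st ?st"
  proof -
    have "srun (pop X) 3 st (st[X := xs])" by (rule srun_pop[OF Cons.prems(1,4)])
    moreover have "srun (push Y x) 3 (st[X := xs]) ?st"
      using srun_push[of Y "st[X := xs]" x] Cons.prems(2,3) by simp
    ultimately have "srun (Seq (pop X) (push Y x)) 8 st ?st" by (rule srun_SeqI) simp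
    then show ?thesis using x Cons.prems(1,4) by (intro srun_CondI) auto
  qed
  moreover have "srun (move_all X Y) (1 + 10 * length xs) ?st (?st[X := [], Y := rev xs @ ?st ! Y])"
    by (rule Cons.IH) (use Cons.prems in simp_all)
  moreover have "?st[X := [], Y := rev xs @ ?st ! Y] = st[X := [], Y := rev (x # xs) @ st ! Y]"
    using Cons.prems(1-3) by (simp add: list_update_swap)
  ultimately have "srun (While X 0 (Cond X 1 (Seq (pop X) (push Y 1)) (Seq (pop X) (push Y 2))))
      (Suc (9 + (1 + 10 * length xs))) st (st[X := [], Y := rev (x # xs) @ st ! Y])"
    using Cons.prems(1,4) x unfolding move_all_def by (intro srun_While_step) auto
  then show ?case unfolding move_all_def by simp
qed

definition copy_all :: prog where
  "copy_all = While 2 0 (Cond 2 1 (Seq (pop 2) (Seq (push 1 1) (push 3 1)))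
     (Seq (pop 2) (Seq (push 1 2) (push 3 2))))"

lemma copy_all:
  "set xs \<subseteq> {1, 2} \<Longrightarrow>
   srun copy_all (1 + 14 * length xs) [i, a, xs, c, d, out] [i, rev xs @ a, [], rev xs @ c, d, out]"
proof (induction xs arbitrary: a c)
  case Nil
  show ?case unfolding copy_all_def by (rule srun_While_endI) simp_all
next
  case (Cons x xs)
  then have x: "x = 1 \<or> x = 2" by simp
  have "srun (Cond 2 1 (Seq (pop 2) (Seq (push 1 1) (push 3 1)))
     (Seq (pop 2) (Seq (push 1 2) (push 3 2)))) 13
    [i, a, x # xs, c, d, out] [i, x # a, xs, x # c, d, out]"
    using x by (elim disjE; hypsubst) (rule srun_basic; simp)+
  from srun_WhileI[OF _ _ this Cons.IH[of "x # a" "x # c", unfolded copy_all_def]] Cons.prems x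
  show ?case unfolding copy_all_def by auto
qed

definition clear_2 :: prog where "clear_2 = While 2 0 (pop 2)"

lemma clear_2:
  "0 \<notin> set xs \<Longrightarrow>
   srun clear_2 (1 + 4 * length xs) [i, a, xs, c, d, out] [i, a, [], c, d, out]"
proof (induction xs)
  case Nil
  show ?case unfolding clear_2_def by (rule srun_While_endI) simp_all
next
  case (Cons x xs)
  have "srun (pop 2) 3 [i, a, x # xs, c, d, out] [i, a, xs, c, d, out]"
    by (rule srun_basic; simp)+
  from srun_WhileI[OF _ _ this Cons.IH[unfolded clear_2_def]] Cons.prems
  show ?case unfolding clear_2_def by simp
qed

definition drop_tree :: prog where "drop_tree = Seq (move_tree 2) clear_2"

lemma drop_tree:
  "srun drop_tree (7 + 17 * tsize t) [i, str t @ r, [], c, [], out] [i, r, [], c, [], out]"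
proof -
  have "srun clear_2 (1 + 4 * tsize t) [i, r, rev (str t), c, [], out] [i, r, [], c, [], out]"
    using str_set[of t] clear_2[of "rev (str t)" i r c "[]" out]
    by (simp add: tsize_def subset_iff) (metis One_nat_def zero_neq_numeral zero_neq_one)
  with move_tree_2[of t i r "[]" c out, simplified]
  show ?thesis unfolding drop_tree_def by (rule srun_SeqI) simp
qed

text \<open>Bringing back the tree that was removed first leaves the other one on top.\<close>

definition swap_trees :: prog where
  "swap_trees = Seq (move_tree 2) (Seq (move_tree 3) (Seq (move_all 2 1) (move_all 3 1)))"

lemma swap_trees:
  "srun swap_trees (20 + 23 * (tsize t + tsize u)) [i, str t @ str u @ r, [], [], [], out]
     [i, str u @ str t @ r, [], [], [], out]"
proof -
  have "srun (move_all 2 1) (1 + 10 * tsize t) [i, r, rev (str t), rev (str u), [], out]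
     [i, str t @ r, [], rev (str u), [], out]"
    using move_all[of 2 "[i, r, rev (str t), rev (str u), [], out]" 1 "rev (str t)"] str_set[of t] by (simp add: tsize_def)
  moreover have "srun (move_all 3 1) (1 + 10 * tsize u) [i, str t @ r, [], rev (str u), [], out]
     [i, str u @ str t @ r, [], [], [], out]"
    using move_all[of 3 "[i, str t @ r, [], rev (str u), [], out]" 1 "rev (str u)"] str_set[of u] by (simp add: tsize_def)
  ultimately have "srun (Seq (move_all 2 1) (move_all 3 1)) (3 + 10 * (tsize t + tsize u))
     [i, r, rev (str t), rev (str u), [], out] [i, str u @ str t @ r, [], [], [], out]"
    by (rule srun_SeqI) simp
  with move_tree_3[of u i r "rev (str t)" "[]" out, simplified]
  have "srun (Seq (move_tree 3) (Seq (move_all 2 1) (move_all 3 1))) (9 + 10 * tsize t + 23 * tsize u)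
     [i, str u @ r, rev (str t), [], [], out] [i, str u @ str t @ r, [], [], [], out]"
    by (rule srun_SeqI) simp
  with move_tree_2[of t i "str u @ r" "[]" "[]" out, simplified]
  show ?thesis unfolding swap_trees_def by (rule srun_SeqI) simp
qed

text \<open>The copy on stack 3 already reads from the top in the right order, so pushing it back
  directly would reverse it; hence the detour over stack 2.\<close>

definition dup_tree :: prog where
  "dup_tree = Seq (move_tree 2) (Seq copy_all (Seq (move_all 3 2) (move_all 2 1)))"

lemma dup_tree:
  "srun dup_tree (20 + 47 * tsize t) [i, str t @ r, [], [], [], out]
     [i, str t @ str t @ r, [], [], [], out]"
proof -
  have copy: "srun copy_all (1 + 14 * tsize t) [i, r, rev (str t), [], [], out] [i, str t @ r, [], str t, [], out]"
    using copy_all[of "rev (str t)" i r "[]" "[]" out] str_set[of t] by (simp add: tsize_def)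
  have "srun (move_all 3 2) (1 + 10 * tsize t) [i, str t @ r, [], str t, [], out]
     [i, str t @ r, rev (str t), [], [], out]"
    using move_all[of 3 "[i, str t @ r, [], str t, [], out]" 2 "str t"] str_set[of t] by (simp add: tsize_def)
  moreover have "srun (move_all 2 1) (1 + 10 * tsize t) [i, str t @ r, rev (str t), [], [], out]
     [i, str t @ str t @ r, [], [], [], out]"
    using move_all[of 2 "[i, str t @ r, rev (str t), [], [], out]" 1 "rev (str t)"] str_set[of t] by (simp add: tsize_def)
  ultimately have "srun (Seq (move_all 3 2) (move_all 2 1)) (3 + 20 * tsize t)
     [i, str t @ r, [], str t, [], out] [i, str t @ str t @ r, [], [], [], out]"
    by (rule srun_SeqI) simp
  with copy have "srun (Seq copy_all (Seq (move_all 3 2) (move_all 2 1))) (5 + 34 * tsize t)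
     [i, r, rev (str t), [], [], out] [i, str t @ str t @ r, [], [], [], out]"
    by (rule srun_SeqI) simp
  with move_tree_2[of t i r "[]" "[]" out, simplified]
  show ?thesis unfolding dup_tree_def by (rule srun_SeqI) simp
qed

text \<open>The base is at least 2 even for n = 0, so that constants and sums can be absorbed into
  the exponent.\<close>

definition poly_bounded :: "(nat \<Rightarrow> nat) \<Rightarrow> bool" where
  "poly_bounded f \<longleftrightarrow> (\<exists>d. \<forall>n. f n \<le> (n + 2) ^ d)"

lemma poly_bounded_mono: "poly_bounded g \<Longrightarrow> (\<And>n. f n \<le> g n) \<Longrightarrow> poly_bounded f"
  unfolding poly_bounded_def by (meson order_trans)

lemma poly_bounded_const: "poly_bounded (\<lambda>_. c)"
proof -
  have "c \<le> (n + 2) ^ c" for n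
  proof -
    have "c \<le> 2 ^ c" by (simp add: less_imp_le)
    also have "\<dots> \<le> (n + 2) ^ c" by (intro power_mono) auto
    finally show ?thesis .
  qed
  then show ?thesis unfolding poly_bounded_def by blast
qed

lemma poly_bounded_id: "poly_bounded (\<lambda>n. n)"
  unfolding poly_bounded_def by (intro exI[of _ 1]) simp

lemma poly_bounded_mult:
  assumes "poly_bounded f" "poly_bounded g" shows "poly_bounded (\<lambda>n. f n * g n)"
proof -
  obtain d e where "\<And>n. f n \<le> (n + 2) ^ d" "\<And>n. g n \<le> (n + 2) ^ e"
    using assms unfolding poly_bounded_def by blast
  then have "f n * g n \<le> (n + 2) ^ (d + e)" for n by (simp add: power_add mult_mono)
  then show ?thesis unfolding poly_bounded_def by blast
qed

lemma poly_bounded_add: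
  assumes "poly_bounded f" "poly_bounded g" shows "poly_bounded (\<lambda>n. f n + g n)"
proof -
  obtain d e where de: "\<And>n. f n \<le> (n + 2) ^ d" "\<And>n. g n \<le> (n + 2) ^ e"
    using assms unfolding poly_bounded_def by blast
  have "f n + g n \<le> (n + 2) ^ Suc (d + e)" for n
  proof -
    have "(n + 2) ^ d \<le> (n + 2) ^ (d + e)" "(n + 2) ^ e \<le> (n + 2) ^ (d + e)"
      by (intro power_increasing; simp)+
    then have "f n + g n \<le> 2 * (n + 2) ^ (d + e)" using de(1)[of n] de(2)[of n] by linarith
    also have "\<dots> \<le> (n + 2) * (n + 2) ^ (d + e)" by (intro mult_right_mono) auto
    finally show ?thesis by simp
  qed
  then show ?thesis unfolding poly_bounded_def by blast
qed

lemma poly_bounded_power: "poly_bounded f \<Longrightarrow> poly_bounded (\<lambda>n. f n ^ k)"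
  by (induction k) (auto intro: poly_bounded_const poly_bounded_mult)

lemmas poly_bounded_intros = poly_bounded_const poly_bounded_id poly_bounded_add
  poly_bounded_mult poly_bounded_power

section \<open>Functions computable in polynomial time on encoded data\<close>

class enc = fixes enc :: "'a \<Rightarrow> tree"

definition esize :: "'a::enc \<Rightarrow> nat" where "esize x = tsize (enc x)"

instantiation unit :: enc begin
definition "enc_unit = (\<lambda>_::unit. Leaf)"
instance ..
end

instantiation prod :: (enc, enc) enc begin
definition "enc_prod p = Node (enc (fst p)) (enc (snd p))"
instance ..
end

text \<open>A nonempty list has the same tree as the pair of its head and its tail, so passing
  between the two forms costs nothing.\<close>

instantiation list :: (enc) enc begin
fun enc_list :: "'a list \<Rightarrow> tree" where
  "enc_list [] = Leaf"
| "enc_list (x # xs) = Node (enc x) (enc_list xs)"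
instance ..
end

text \<open>Unary notation suffices since all numbers that occur are polynomially bounded in the
  length of the input.\<close>

instantiation nat :: enc begin
definition "enc_nat n = enc (replicate n ())"
instance ..
end

instantiation bool :: enc begin
definition "enc_bool b = enc (if b then [()] else [])"
instance ..
end

lemma esize_simps [simp]:
  "esize () = 1" "esize (x, y) = Suc (esize x + esize y)"
  "esize [] = 1" "esize (z # zs) = Suc (esize z + esize zs)"
  "esize (0 :: nat) = 1" "esize (Suc n) = 2 + esize n"
  "esize True = 3" "esize False = 1"
  by (simp_all add: esize_def enc_unit_def enc_prod_def enc_nat_def enc_bool_def)

text \<open>Stack 0 holds the input, stack 5 the output; the computation takes place on the top of
  stack 1, with the stacks 2 to 4 as auxiliary ones.\<close>

definition state :: "nat list \<Rightarrow> tree \<Rightarrow> nat list \<Rightarrow> nat list \<Rightarrow> nat list list" where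
  "state i t r out = [i, str t @ r, [], [], [], out]"

text \<open>The bound on the size of the result accompanies the time bound because composition needs
  it. Quantifying over \<open>i\<close>, \<open>r\<close> and \<open>out\<close> is a frame
  condition: whatever lies below the argument is left untouched.\<close>

definition computes :: "prog \<Rightarrow> nat \<Rightarrow> ('a::enc \<Rightarrow> 'b::enc) \<Rightarrow> bool" where
  "computes c d f \<longleftrightarrow> writes c \<subseteq> {..2} \<and> (\<forall>x. esize (f x) \<le> (esize x + 2) ^ d \<and>
     (\<forall>i r out. srun c ((esize x + 2) ^ d) (state i (enc x) r out) (state i (enc (f x)) r out)))"

definition polyf :: "('a::enc \<Rightarrow> 'b::enc) \<Rightarrow> bool" where
  "polyf f \<longleftrightarrow> (\<exists>c d. computes c d f)"

lemma polyfI: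
  assumes "writes c \<subseteq> {..2}" "poly_bounded T" "poly_bounded S"
    "\<And>x. esize (f x) \<le> S (esize x)"
    "\<And>x i r out. srun c (T (esize x)) (state i (enc x) r out) (state i (enc (f x)) r out)"
  shows "polyf f"
proof -
  have "poly_bounded (\<lambda>n. S n + T n)" by (intro poly_bounded_intros assms)
  then obtain d where d: "\<And>n. S n + T n \<le> (n + 2) ^ d" unfolding poly_bounded_def by blast
  then have "S n \<le> (n + 2) ^ d" "T n \<le> (n + 2) ^ d" for n using add_leE by blast+
  then have "computes c d f" unfolding computes_def
    using assms(1,4,5) by (meson order_trans srun_mono)
  then show ?thesis unfolding polyf_def by blast
qed

lemma polyf_size: "polyf f \<Longrightarrow> \<exists>d. \<forall>x. esize (f x) \<le> (esize x + 2) ^ d"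
  unfolding polyf_def computes_def by blast

lemma writes_basic [simp]:
  "writes (push i s) = {s}" "writes (pop i) = {0}" "writes skip = {}"
  "writes (move_tree X) = {0, 1, 2}" "writes swap_trees = {0, 1, 2}"
  "writes drop_tree = {0, 1, 2}" "writes dup_tree = {0, 1, 2}"
  by (auto simp: push_def pop_def skip_def move_tree_def move_loop_def move_body_def move_all_def
      swap_trees_def drop_tree_def dup_tree_def clear_2_def copy_all_def)

lemma computes_run:
  "computes c d f \<Longrightarrow> esize x \<le> n \<Longrightarrow> (n + 2) ^ d \<le> T \<Longrightarrow>
   srun c T (state i (enc x) r out) (state i (enc (f x)) r out)"
proof -
  assume *: "computes c d f" "esize x \<le> n" "(n + 2) ^ d \<le> T"
  have "(esize x + 2) ^ d \<le> (n + 2) ^ d" by (intro power_mono) (use * in auto)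
  with * show ?thesis unfolding computes_def by (meson order_trans srun_mono)
qed

text \<open>The program does nothing; this covers conversions between types with coinciding
  encodings, such as numbers and lists of units.\<close>

lemma polyf_retype:
  assumes "\<And>x. enc (f x) = enc x"
  shows "polyf f"
  by (rule polyfI[where c = skip and T = "\<lambda>_. 1" and S = "\<lambda>n. n"])
     (auto simp: esize_def assms srun_skip[simplified] state_def intro: poly_bounded_intros)

lemma polyf_id: "polyf (\<lambda>x. x)"
  by (rule polyf_retype) simp

lemma polyf_comp:
  assumes "polyf f" "polyf g"
  shows "polyf (\<lambda>x. f (g x))"
proof -
  obtain c d c' d' where f: "computes c d f" and g: "computes c' d' g"
    using assms unfolding polyf_def by blast
  have g': "esize (g x) \<le> (esize x + 2) ^ d'" for x using g by (simp add: computes_def)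
  show ?thesis
  proof (rule polyfI)
    show "writes (Seq c' c) \<subseteq> {..2}" using f g by (auto simp: computes_def)
    show "poly_bounded (\<lambda>n. 1 + ((n + 2) ^ d' + ((n + 2) ^ d' + 2) ^ d))"
      "poly_bounded (\<lambda>n. ((n + 2) ^ d' + 2) ^ d)"
      by (intro poly_bounded_intros)+
    fix x i r out
    have "esize (f (g x)) \<le> (esize (g x) + 2) ^ d" using f by (simp add: computes_def)
    also have "\<dots> \<le> ((esize x + 2) ^ d' + 2) ^ d" by (intro power_mono) (use g' in auto)
    finally show "esize (f (g x)) \<le> ((esize x + 2) ^ d' + 2) ^ d" .
    show "srun (Seq c' c) (1 + ((esize x + 2) ^ d' + ((esize x + 2) ^ d' + 2) ^ d))
      (state i (enc x) r out) (state i (enc (f (g x))) r out)"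
      by (rule srun_SeqI[OF computes_run[OF g order_refl order_refl]
            computes_run[OF f g' order_refl]]) simp
  qed
qed

lemma srun_dup: "srun dup_tree (20 + 47 * tsize t) (state i t r out) (state i t (str t @ r) out)"
  unfolding state_def by (rule dup_tree)

lemma srun_drop: "srun drop_tree (7 + 17 * tsize t) (state i t (str u @ r) out) (state i u r out)"
  unfolding state_def by (rule drop_tree)

lemma srun_swap: "srun swap_trees (20 + 23 * (tsize t + tsize u)) (state i t (str u @ r) out)
   (state i u (str t @ r) out)"
  unfolding state_def by (rule swap_trees)

lemma srun_cons: "srun (push 1 2) 3 (state i t (str u @ r) out) (state i (Node t u) r out)"
  unfolding state_def by (rule srun_push_last; simp)

lemma srun_uncons: "srun (pop 1) 3 (state i (Node t u) r out) (state i t (str u @ r) out)"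
  unfolding state_def by (rule srun_pop_last; simp)

text \<open>The second component is computed before the first, so that the first ends up on top,
  where prefix notation wants it.\<close>

lemma polyf_pair:
  assumes "polyf f" "polyf g"
  shows "polyf (\<lambda>x. (f x, g x))"
proof -
  obtain c d c' d' where f: "computes c d f" and g: "computes c' d' g"
    using assms unfolding polyf_def by blast
  have f': "esize (f x) \<le> (esize x + 2) ^ d" for x using f by (simp add: computes_def)
  have g': "esize (g x) \<le> (esize x + 2) ^ d'" for x using g by (simp add: computes_def)
  let ?T = "\<lambda>n. (20 + 47 * n) + ((n + 2) ^ d' + (20 + 23 * ((n + 2) ^ d' + n) + ((n + 2) ^ d + 3))) + 10"
  show ?thesis
  proof (rule polyfI)
    show "writes (Seq dup_tree (Seq c' (Seq swap_trees (Seq c (push 1 2))))) \<subseteq> {..2}"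
      using f g by (auto simp: computes_def)
    show "poly_bounded ?T" by (intro poly_bounded_intros)
    show "poly_bounded (\<lambda>n. 1 + ((n + 2) ^ d + (n + 2) ^ d'))" by (intro poly_bounded_intros)
    fix x i r out
    show "esize (f x, g x) \<le> 1 + ((esize x + 2) ^ d + (esize x + 2) ^ d')"
      using f'[of x] g'[of x] by simp
    have t: "20 + 23 * (tsize (enc (g x)) + tsize (enc x)) \<le> 20 + 23 * ((esize x + 2) ^ d' + esize x)"
      using g'[of x] by (simp add: esize_def)
    note 1 = srun_dup[of "enc x" i r out]
    note 2 = computes_run[OF g order_refl order_refl, of x i "str (enc x) @ r" out]
    note 3 = srun_mono[OF srun_swap[of "enc (g x)" "enc x" i r out] t]
    note 4 = computes_run[OF f order_refl order_refl, of x i "str (enc (g x)) @ r" out]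
    note 5 = srun_cons[of i "enc (f x)" "enc (g x)" r out]
    show "srun (Seq dup_tree (Seq c' (Seq swap_trees (Seq c (push 1 2))))) (?T (esize x))
      (state i (enc x) r out) (state i (enc (f x, g x)) r out)"
      unfolding enc_prod_def fst_conv snd_conv
      using srun_Seq[OF 1 srun_Seq[OF 2 srun_Seq[OF 3 srun_Seq[OF 4 5]]]]
      by (rule srun_mono) (simp add: esize_def)
  qed
qed

lemma polyf_fst': "polyf (fst :: 'a::enc \<times> 'b::enc \<Rightarrow> 'a)"
proof (rule polyfI)
  let ?c = "Seq (pop 1) (Seq swap_trees drop_tree)"
  show "writes ?c \<subseteq> {..2}" by simp
  show "poly_bounded (\<lambda>n. 50 + 50 * n)" "poly_bounded (\<lambda>n. n)" by (intro poly_bounded_intros)+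
  fix x :: "'a \<times> 'b" and i r out
  obtain a b where x: "x = (a, b)" by fastforce
  show "esize (fst x) \<le> esize x" by (simp add: x)
  show "srun ?c (50 + 50 * esize x) (state i (enc x) r out) (state i (enc (fst x)) r out)"
    using srun_Seq[OF srun_uncons[of i "enc a" "enc b" r out]
        srun_Seq[OF srun_swap srun_drop[of "enc b" i "enc a" r out]]]
    unfolding x enc_prod_def fst_conv snd_conv by (rule srun_mono) (simp add: esize_def enc_prod_def)
qed

lemma polyf_snd': "polyf (snd :: 'a::enc \<times> 'b::enc \<Rightarrow> 'b)"
proof (rule polyfI)
  let ?c = "Seq (pop 1) drop_tree"
  show "writes ?c \<subseteq> {..2}" by simp
  show "poly_bounded (\<lambda>n. 50 + 50 * n)" "poly_bounded (\<lambda>n. n)" by (intro poly_bounded_intros)+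
  fix x :: "'a \<times> 'b" and i r out
  obtain a b where x: "x = (a, b)" by fastforce
  show "esize (snd x) \<le> esize x" by (simp add: x)
  show "srun ?c (50 + 50 * esize x) (state i (enc x) r out) (state i (enc (snd x)) r out)"
    using srun_Seq[OF srun_uncons[of i "enc a" "enc b" r out] srun_drop]
    unfolding x enc_prod_def fst_conv snd_conv by (rule srun_mono) (simp add: esize_def enc_prod_def)
qed

lemmas polyf_fst = polyf_comp[OF polyf_fst']
lemmas polyf_snd = polyf_comp[OF polyf_snd']

fun push_list :: "nat list \<Rightarrow> prog" where
  "push_list [] = skip"
| "push_list (s # ss) = Seq (push_list ss) (push 1 s)"

lemma push_list:
  "srun (push_list ss) (1 + 4 * length ss) [i, a, b, c, d, out] [i, ss @ a, b, c, d, out]"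
proof (induction ss)
  case Nil
  then show ?case using srun_skip[of "[i, a, b, c, d, out]"] by simp
next
  case (Cons s ss)
  have "srun (push 1 s) 3 [i, ss @ a, b, c, d, out] [i, (s # ss) @ a, b, c, d, out]"
    by (rule srun_push_last; simp)
  from srun_SeqI[OF Cons this] show ?case by simp
qed

lemma writes_push_list [simp]: "writes (push_list ss) = set ss"
  by (induction ss) auto

lemma polyf_const: "polyf (\<lambda>x::'a::enc. c :: 'b::enc)"
proof (rule polyfI)
  let ?c = "Seq drop_tree (push_list (str (enc c)))"
  show "writes ?c \<subseteq> {..2}" using str_set[of "enc c"] by auto
  show "poly_bounded (\<lambda>n. 50 + 50 * n + 4 * esize c)" "poly_bounded (\<lambda>n. esize c)"
    by (intro poly_bounded_intros)+
  fix x :: 'a and i r out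
  have "srun drop_tree (7 + 17 * esize x) (state i (enc x) r out) [i, r, [], [], [], out]"
    using drop_tree by (simp add: state_def esize_def)
  from srun_SeqI[OF this push_list[of "str (enc c)"]]
  show "srun ?c (50 + 50 * esize x + 4 * esize c) (state i (enc x) r out) (state i (enc c) r out)"
    by (simp add: state_def esize_def tsize_def)
qed simp

lemma topmost_state [simp]: "topmost (state i t r out ! Suc 0) = (case t of Leaf \<Rightarrow> 1 | _ \<Rightarrow> 2)"
  "length (state i t r out) = 6"
  by (auto simp: state_def split: tree.splits)

lemma srun_pop_Leaf: "srun (pop 1) 3 (state i Leaf (str u @ r) out) (state i u r out)"
  unfolding state_def by (rule srun_pop_last; simp)

text \<open>The list is computed on a copy of the environment and its top symbol decides the case.
  If it is nonempty, a swap and one pushed node symbol produce the tree of the triple of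
  environment, head and tail.\<close>

lemma polyf_case_list:
  assumes "polyf xs" "polyf f" "polyf (\<lambda>p. g (fst p) (fst (snd p)) (snd (snd p)))"
  shows "polyf (\<lambda>e. case xs e of [] \<Rightarrow> f e | y # ys \<Rightarrow> g e y ys)"
proof -
  obtain cx dx cf df cg dg where xs: "computes cx dx xs" and f: "computes cf df f" and
    g: "computes cg dg (\<lambda>p. g (fst p) (fst (snd p)) (snd (snd p)))"
    using assms unfolding polyf_def by blast
  have xs': "esize (xs e) \<le> (esize e + 2) ^ dx" for e using xs by (simp add: computes_def)
  let ?M = "\<lambda>n. n + (n + 2) ^ dx + 2"
  let ?cnil = "Seq (pop 1) cf"
  let ?ccons = "Seq swap_trees (Seq (push 1 2) cg)"
  let ?c = "Seq dup_tree (Seq cx (Cond 1 1 ?cnil ?ccons))"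
  let ?T = "\<lambda>n. 100 + 100 * ?M n + (n + 2) ^ dx + (n + 2) ^ df + (?M n + 2) ^ dg"
  let ?S = "\<lambda>n. (n + 2) ^ df + (?M n + 2) ^ dg"
  show ?thesis
  proof (rule polyfI)
    show "writes ?c \<subseteq> {..2}" using xs f g by (auto simp: computes_def)
    show "poly_bounded ?T" "poly_bounded ?S" by (intro poly_bounded_intros)+
    fix x i r out
    let ?R = "case xs x of [] \<Rightarrow> f x | y # ys \<Rightarrow> g x y ys"
    have f': "esize (f x) \<le> (esize x + 2) ^ df" using f by (simp add: computes_def)
    have g': "esize (g x y ys) \<le> (?M (esize x) + 2) ^ dg" if "xs x = y # ys" for y ys
    proof -
      have "esize (x, y, ys) \<le> ?M (esize x)" using xs'[of x] that by simp
      moreover have "esize (g x y ys) \<le> (esize (x, y, ys) + 2) ^ dg"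
        using g unfolding computes_def by (metis fst_conv snd_conv)
      ultimately show ?thesis by (meson order_trans power_mono add_right_mono zero_le)
    qed
    show "esize ?R \<le> ?S (esize x)" using f' g' by (auto split: list.splits intro: trans_le_add1 trans_le_add2)
    have "srun (Cond 1 1 ?cnil ?ccons) (30 + 23 * ?M (esize x) + (esize x + 2) ^ df + (?M (esize x) + 2) ^ dg)
      (state i (enc (xs x)) (str (enc x) @ r) out) (state i (enc ?R) r out)"
    proof (cases "xs x")
      case Nil
      have "srun ?cnil (1 + (3 + (esize x + 2) ^ df)) (state i Leaf (str (enc x) @ r) out) (state i (enc ?R) r out)"
        using srun_Seq[OF srun_pop_Leaf computes_run[OF f order_refl order_refl]] Nil by simp
      then show ?thesis using Nil by (intro srun_CondI) (auto intro: srun_mono)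
    next
      case (Cons y ys)
      have s: "esize (x, (y, ys)) \<le> ?M (esize x)" using xs'[of x] Cons by simp
      have "20 + 23 * (tsize (enc (y # ys)) + tsize (enc x)) \<le> 20 + 23 * ?M (esize x)"
        using s by (simp add: esize_def enc_prod_def)
      note 1 = srun_mono[OF srun_swap this, of i r out]
      have "state i (Node (enc x) (enc (y # ys))) r out = state i (enc (x, (y, ys))) r out"
        by (simp add: enc_prod_def)
      then have 2: "srun (push 1 2) 3 (state i (enc x) (str (enc (y # ys)) @ r) out) (state i (enc (x, (y, ys))) r out)"
        using srun_cons by metis
      note 3 = computes_run[OF g s order_refl, of i r out, simplified]
      show ?thesis using Cons srun_SeqI[OF 1 srun_SeqI[OF 2 3 order_refl] order_refl]
        by (intro srun_CondI) (auto intro: srun_mono)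
    qed
    from srun_SeqI[OF computes_run[OF xs order_refl order_refl] this order_refl]
    have "srun (Seq cx (Cond 1 1 ?cnil ?ccons)) (31 + (esize x + 2) ^ dx + 23 * ?M (esize x) + (esize x + 2) ^ df + (?M (esize x) + 2) ^ dg)
      (state i (enc x) (str (enc x) @ r) out) (state i (enc ?R) r out)"
      by (rule srun_mono) simp
    from srun_SeqI[OF srun_dup this order_refl]
    show "srun ?c (?T (esize x)) (state i (enc x) r out) (state i (enc ?R) r out)"
      by (rule srun_mono) (simp add: esize_def)
  qed
qed

lemma polyf_replicate_unit: "polyf (\<lambda>n. replicate n ())"
  by (rule polyf_retype) (simp add: enc_nat_def)

lemma replicate_length_unit: "replicate (length xs) () = xs"
  by (induction xs) auto

lemma polyf_length_unit: "polyf (length :: unit list \<Rightarrow> nat)"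
  by (rule polyf_retype) (simp add: enc_nat_def replicate_length_unit)

lemma polyf_case_nat:
  assumes "polyf n" "polyf f" "polyf (\<lambda>p. g (fst p) (snd p))"
  shows "polyf (\<lambda>e. case n e of 0 \<Rightarrow> f e | Suc k \<Rightarrow> g e k)"
proof -
  have "polyf (\<lambda>e. case replicate (n e) () of [] \<Rightarrow> f e | y # ys \<Rightarrow> g e (length ys))"
    by (intro polyf_case_list polyf_comp[OF polyf_replicate_unit] assms
        polyf_comp[OF assms(3), of "\<lambda>p. (fst p, length (snd (snd p)))", simplified]
        polyf_pair polyf_comp[OF polyf_length_unit] polyf_fst polyf_snd polyf_id)
  moreover have "(case replicate m () of [] \<Rightarrow> f e | y # ys \<Rightarrow> g e (length ys))
      = (case m of 0 \<Rightarrow> f e | Suc k \<Rightarrow> g e k)" for m e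
    by (cases m) auto
  ultimately show ?thesis by simp
qed

lemma polyf_if:
  assumes "polyf b" "polyf f" "polyf g"
  shows "polyf (\<lambda>e. if b e then f e else g e)"
proof -
  have "polyf (\<lambda>e. if b e then [()] else [])"
    by (rule polyf_comp[OF _ assms(1)], rule polyf_retype) (simp add: enc_bool_def)
  then have "polyf (\<lambda>e. case (if b e then [()] else []) of [] \<Rightarrow> g e | _ # _ \<Rightarrow> f e)"
    by (intro polyf_case_list assms polyf_comp[OF assms(2)] polyf_fst polyf_id)
  moreover have "(case (if b e then [()] else []) of [] \<Rightarrow> g e | _ # _ \<Rightarrow> f e) = (if b e then f e else g e)" for e
    by simp
  ultimately show ?thesis by simp
qed

lemma polyf_Cons:
  assumes "polyf f" "polyf g" shows "polyf (\<lambda>e. f e # g e)"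
proof -
  have "polyf (\<lambda>p::'b \<times> 'b list. fst p # snd p)"
    by (rule polyf_retype) (simp add: enc_prod_def)
  from polyf_comp[OF this polyf_pair[OF assms]] show ?thesis by simp
qed

lemma polyf_Suc:
  assumes "polyf f" shows "polyf (\<lambda>e. Suc (f e))"
proof -
  have "polyf (\<lambda>e. length (() # replicate (f e) ()))"
    by (intro polyf_comp[OF polyf_length_unit] polyf_Cons polyf_const
        polyf_comp[OF polyf_replicate_unit] assms)
  then show ?thesis by simp
qed

text \<open>A step that doubles its argument is polynomial, but iterating it is exponential. Hence
  the bound \<open>B\<close> on the accumulator after every prefix of the list.\<close>

lemma polyf_fold:
  assumes f: "polyf (\<lambda>p. f (fst p) (fst (snd p)) (snd (snd p)))" and xs: "polyf xs" and init: "polyf init"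
    and B: "poly_bounded B"
      "\<And>e ys zs. xs e = ys @ zs \<Longrightarrow> esize (fold (f e) ys (init e)) \<le> B (esize e)"
  shows "polyf (\<lambda>e. fold (f e) (xs e) (init e))"
proof -
  define start where "start = (\<lambda>e. (xs e, (e, init e)))"
  define body where "body = (\<lambda>p. case fst p of [] \<Rightarrow> p | y # ys \<Rightarrow>
    (ys, (fst (snd p), f (fst (snd p)) y (snd (snd p)))))"
  have "polyf start" unfolding start_def by (intro polyf_pair xs init polyf_id)
  then obtain cs ds where start: "computes cs ds start" unfolding polyf_def by blast
  have "polyf body" unfolding body_def
    by (intro polyf_case_list polyf_pair polyf_fst polyf_snd polyf_id
        polyf_comp[OF f, of "\<lambda>p. (fst (snd (fst p)), (fst (snd p), snd (snd (fst p))))", simplified])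
  then obtain cb db where body: "computes cb db body" unfolding polyf_def by blast
  obtain dx where dx: "\<And>e. esize (xs e) \<le> (esize e + 2) ^ dx" using polyf_size[OF xs] by blast
  let ?M = "\<lambda>n. 2 + ((n + 2) ^ dx + (n + B n))"
  let ?iter = "\<lambda>n. 10 + (?M n + 2) ^ db"
  \<comment> \<open>Between rounds the remaining list lies as a separate tree on top of the pair of
    environment and accumulator, so that the top symbol 1 signals its end. Pushing and popping a
    node symbol converts to and from the argument of \<open>body\<close>.\<close>
  let ?loop = "While 1 1 (Seq (push 1 2) (Seq cb (pop 1)))"
  have loop: "srun ?loop (1 + length ys * ?iter (esize e)) (state i (enc ys) (str (enc (e, s)) @ r) out)
     (state i Leaf (str (enc (e, fold (f e) ys s)) @ r) out)"
    if "esize ys \<le> (esize e + 2) ^ dx" "\<And>us zs. ys = us @ zs \<Longrightarrow> esize (fold (f e) us s) \<le> B (esize e)"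
    for ys e s i r out
    using that
  proof (induction ys arbitrary: s)
    case Nil
    show ?case by (rule srun_While_endI) auto
  next
    case (Cons y ys)
    have "esize s \<le> B (esize e)" using Cons.prems(2)[of "[]"] by simp
    then have M: "esize (y # ys, (e, s)) \<le> ?M (esize e)" using Cons.prems(1) by simp
    have b: "body (y # ys, (e, s)) = (ys, (e, f e y s))" by (simp add: body_def)
    have e1: "state i (Node (enc (y # ys)) (enc (e, s))) r out = state i (enc (y # ys, (e, s))) r out"
      "state i (Node (enc ys) (enc (e, f e y s))) r out = state i (enc (body (y # ys, (e, s)))) r out"
      by (simp_all add: b enc_prod_def)
    have 1: "srun (push 1 2) 3 (state i (enc (y # ys)) (str (enc (e, s)) @ r) out) (state i (enc (y # ys, (e, s))) r out)"
      using srun_cons e1(1) by metis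
    have 3: "srun (pop 1) 3 (state i (enc (body (y # ys, (e, s)))) r out) (state i (enc ys) (str (enc (e, f e y s)) @ r) out)"
      using srun_uncons e1(2) by metis
    note 4 = srun_SeqI[OF 1 srun_SeqI[OF computes_run[OF body M order_refl] 3 order_refl] order_refl]
    have 5: "srun ?loop (1 + length ys * ?iter (esize e)) (state i (enc ys) (str (enc (e, f e y s)) @ r) out)
     (state i Leaf (str (enc (e, fold (f e) ys (f e y s))) @ r) out)"
    proof (rule Cons.IH)
      show "esize ys \<le> (esize e + 2) ^ dx" using Cons.prems(1) by simp
      show "esize (fold (f e) us (f e y s)) \<le> B (esize e)" if "ys = us @ zs" for us zs
        using Cons.prems(2)[of "y # us" zs] that by simp
    qed
    show ?case unfolding fold_simps by (rule srun_WhileI[OF _ _ 4 5]) auto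
  qed
  have ll: "length ys \<le> esize ys" for ys :: "'b list" by (induction ys) auto
  have "polyf (\<lambda>e. (e, fold (f e) (xs e) (init e)))"
  proof (rule polyfI)
    let ?c = "Seq cs (Seq (pop 1) (Seq ?loop (pop 1)))"
    let ?T = "\<lambda>n. (n + 2) ^ ds + 20 + (n + 2) ^ dx * ?iter n"
    show "writes ?c \<subseteq> {..2}" using start body by (auto simp: computes_def)
    show "poly_bounded ?T" "poly_bounded (\<lambda>n. 1 + (n + B n))" by (intro poly_bounded_intros B)+
    fix e i r out
    show "esize (e, fold (f e) (xs e) (init e)) \<le> 1 + (esize e + B (esize e))"
      using B(2)[of e "xs e" "[]"] by simp
    have "srun (pop 1) 3 (state i (enc (start e)) r out) (state i (enc (xs e)) (str (enc (e, init e)) @ r) out)"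
      using srun_uncons unfolding start_def enc_prod_def[of "(xs e, (e, init e))"] by simp
    note 1 = srun_SeqI[OF computes_run[OF start order_refl order_refl] srun_SeqI[OF this srun_SeqI[OF
       loop[OF dx B(2)] srun_pop_Leaf[of i "enc (e, fold (f e) (xs e) (init e))" r out] order_refl] order_refl] order_refl]
    have le: "length (xs e) * ?iter (esize e) \<le> (esize e + 2) ^ dx * ?iter (esize e)"
      by (intro mult_right_mono order_trans[OF ll dx]) auto
    show "srun ?c (?T (esize e)) (state i (enc e) r out) (state i (enc (e, fold (f e) (xs e) (init e))) r out)"
      by (rule srun_mono[OF 1], assumption) (use le in linarith)
  qed
  from polyf_snd[OF this] show ?thesis by simp
qed

section \<open>Size estimates and the usual operations on lists and numbers\<close>

lemma poly_bounded_Suc: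
  assumes "poly_bounded f"
  shows "poly_bounded (\<lambda>n. Suc (f n))"
  using poly_bounded_add[OF poly_bounded_const assms, of 1] by simp

lemma esize_pos [simp]: "0 < esize x"
  using str_nonempty[of "enc x"] by (simp add: esize_def tsize_def)

lemma esize_append: "esize (xs @ ys) + 1 = esize xs + esize ys"
  by (induction xs) auto

lemma esize_mem: "x \<in> set xs \<Longrightarrow> esize x \<le> esize xs"
  by (induction xs) auto

lemma length_le_esize: "length xs \<le> esize xs"
  by (induction xs) auto

lemma esize_list_le:
  assumes "\<And>x. x \<in> set xs \<Longrightarrow> esize x \<le> k"
  shows "esize xs \<le> length xs * (k + 1) + 1"
  using assms by (induction xs) (fastforce simp: algebra_simps)+

lemma esize_nat: "esize (n :: nat) = 2 * n + 1"
  by (induction n) auto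

text \<open>If every step adds an amount that depends on the environment only, the total growth is
  at most this amount times the length of the list. Most folds below are of this kind.\<close>

lemma polyf_fold_additive:
  assumes f: "polyf (\<lambda>p. f (fst p) (fst (snd p)) (snd (snd p)))" and xs: "polyf xs" and init: "polyf init"
    and q: "poly_bounded q" "\<And>e y s. y \<in> set (xs e) \<Longrightarrow> esize (f e y s) \<le> esize s + q (esize e)"
  shows "polyf (\<lambda>e. fold (f e) (xs e) (init e))"
proof -
  obtain dx where dx: "\<And>e. esize (xs e) \<le> (esize e + 2) ^ dx" using polyf_size[OF xs] by blast
  obtain di where di: "\<And>e. esize (init e) \<le> (esize e + 2) ^ di" using polyf_size[OF init] by blast
  show ?thesis
  proof (rule polyf_fold[OF f xs init])
    show "poly_bounded (\<lambda>n. (n + 2) ^ di + (n + 2) ^ dx * q n)" by (intro poly_bounded_intros q)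
    fix e ys zs assume e: "xs e = ys @ zs"
    have "esize (fold (f e) ys s) \<le> esize s + length ys * q (esize e)" if "set ys \<subseteq> set (xs e)" for s
      using that
    proof (induction ys arbitrary: s)
      case (Cons y ys)
      have "esize (fold (f e) ys (f e y s)) \<le> esize (f e y s) + length ys * q (esize e)"
        by (rule Cons.IH) (use Cons.prems in simp)
      moreover have "esize (f e y s) \<le> esize s + q (esize e)" by (rule q(2)) (use Cons.prems in simp)
      ultimately show ?case by simp
    qed simp
    from this[of "init e"]
    have "esize (fold (f e) ys (init e)) \<le> esize (init e) + length ys * q (esize e)" using e by simp
    moreover have "length ys * q (esize e) \<le> (esize e + 2) ^ dx * q (esize e)"
    proof (rule mult_right_mono)
      show "length ys \<le> (esize e + 2) ^ dx"
        using order_trans[OF length_le_esize[of "xs e"] dx[of e]] e by simp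
    qed simp
    ultimately show "esize (fold (f e) ys (init e)) \<le> (esize e + 2) ^ di + (esize e + 2) ^ dx * q (esize e)"
      using di[of e] by linarith
  qed
qed

lemmas polyf_basic = polyf_pair polyf_fst polyf_snd polyf_Cons polyf_id polyf_const

lemma polyf_rev:
  assumes "polyf xs" shows "polyf (\<lambda>e. rev (xs e))"
proof -
  obtain d where "\<And>e. esize (xs e) \<le> (esize e + 2) ^ d" using polyf_size[OF assms] by blast
  then have d: "y \<in> set (xs e) \<Longrightarrow> esize y \<le> (esize e + 2) ^ d" for y e
    using esize_mem order_trans by blast
  have "polyf (\<lambda>e. fold (\<lambda>y s. y # s) (xs e) [])"
    by (rule polyf_fold_additive[where q = "\<lambda>n. 1 + (n + 2) ^ d"])
       (auto intro!: polyf_basic assms poly_bounded_intros poly_bounded_Suc dest: d)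
  moreover have "fold (\<lambda>y s. y # s) xs [] = rev xs" for xs :: "'b list" by (simp add: rev_conv_fold)
  ultimately show ?thesis by simp
qed

lemma polyf_append:
  assumes "polyf xs" "polyf ys" shows "polyf (\<lambda>e. xs e @ ys e)"
proof -
  obtain d where "\<And>e. esize (xs e) \<le> (esize e + 2) ^ d" using polyf_size[OF assms(1)] by blast
  then have d: "y \<in> set (xs e) \<Longrightarrow> esize y \<le> (esize e + 2) ^ d" for y e
    using esize_mem order_trans by blast
  have "polyf (\<lambda>e. fold (\<lambda>y s. y # s) (rev (xs e)) (ys e))"
    by (rule polyf_fold_additive[where q = "\<lambda>n. 1 + (n + 2) ^ d"])
       (auto intro!: polyf_basic polyf_rev assms poly_bounded_intros poly_bounded_Suc dest: d)
  moreover have "fold (\<lambda>y s. y # s) (rev xs) ys = xs @ ys" for xs ys :: "'b list"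
    by (induction xs arbitrary: ys) auto
  ultimately show ?thesis by simp
qed

lemma polyf_concat:
  assumes "polyf xs" shows "polyf (\<lambda>e. concat (xs e))"
proof -
  obtain d where "\<And>e. esize (xs e) \<le> (esize e + 2) ^ d" using polyf_size[OF assms] by blast
  then have d: "y \<in> set (xs e) \<Longrightarrow> esize y \<le> (esize e + 2) ^ d" for y e
    using esize_mem order_trans by blast
  have "polyf (\<lambda>e. fold (\<lambda>y s. s @ y) (xs e) [])"
  proof (rule polyf_fold_additive[where q = "\<lambda>n. (n + 2) ^ d"])
    fix e y and s :: "'b list" assume "y \<in> set (xs e)"
    then show "esize (s @ y) \<le> esize s + (esize e + 2) ^ d" using d[of y e] esize_append[of s y] by simp
  qed (intro polyf_basic polyf_append assms poly_bounded_intros)+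
  moreover have "fold (\<lambda>y s. s @ y) xs s = s @ concat xs" for xs and s :: "'b list"
    by (induction xs arbitrary: s) auto
  ultimately show ?thesis by simp
qed

text \<open>Supplies the increment for \<open>polyf_fold_additive\<close>: what one list element
  contributes is bounded in terms of the environment alone.\<close>

lemma polyf_elem_size:
  fixes h :: "'e::enc \<Rightarrow> 'a::enc \<Rightarrow> 'b::enc"
  assumes "polyf (\<lambda>p. h (fst p) (snd p))" "polyf xs"
  shows "\<exists>q. poly_bounded q \<and> (\<forall>e y. y \<in> set (xs e) \<longrightarrow> esize (h e y) \<le> q (esize e) \<and> esize y \<le> q (esize e))"
proof -
  obtain d where d: "\<And>e. esize (xs e) \<le> (esize e + 2) ^ d" using polyf_size[OF assms(2)] by blast
  obtain d' where d': "\<And>p. esize (h (fst p) (snd p)) \<le> (esize p + 2) ^ d'" using polyf_size[OF assms(1)] by blast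
  let ?q = "\<lambda>n. (n + 2) ^ d + ((1 + (n + (n + 2) ^ d)) + 2) ^ d'"
  have "poly_bounded ?q" by (intro poly_bounded_intros)
  moreover have "esize (h e y) \<le> ?q (esize e) \<and> esize y \<le> ?q (esize e)" if "y \<in> set (xs e)" for e y
  proof -
    have y: "esize y \<le> (esize e + 2) ^ d" using esize_mem[OF that] d[of e] by linarith
    have "esize (h e y) \<le> (esize (e, y) + 2) ^ d'" using d'[of "(e, y)"] by simp
    also have "\<dots> \<le> ((1 + (esize e + (esize e + 2) ^ d)) + 2) ^ d'"
      by (intro power_mono) (use y in auto)
    finally show ?thesis using y by simp
  qed
  ultimately show ?thesis by (intro exI[of _ ?q]) blast
qed

lemma polyf_comp2:
  assumes "polyf (\<lambda>p. h (fst p) (snd p))" "polyf f" "polyf g"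
  shows "polyf (\<lambda>e. h (f e) (g e))"
  using polyf_comp[OF assms(1) polyf_pair[OF assms(2,3)]] by simp

lemma polyf_map:
  assumes h: "polyf (\<lambda>p. h (fst p) (snd p))" and xs: "polyf xs"
  shows "polyf (\<lambda>e. map (h e) (xs e))"
proof -
  obtain q where q: "poly_bounded q" "\<And>e y. y \<in> set (xs e) \<Longrightarrow> esize (h e y) \<le> q (esize e)"
    using polyf_elem_size[OF assms] by blast
  have "polyf (\<lambda>e. fold (\<lambda>y s. h e y # s) (xs e) [])"
    by (rule polyf_fold_additive[where q = "\<lambda>n. 1 + q n"])
       (auto intro!: polyf_basic polyf_comp2[OF h] xs q poly_bounded_Suc)
  moreover have "rev (fold (\<lambda>y s. g y # s) xs s) = rev s @ map g xs" for xs s and g :: "'b \<Rightarrow> 'c"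
    by (induction xs arbitrary: s) auto
  ultimately show ?thesis using polyf_rev[of "\<lambda>e. fold (\<lambda>y s. h e y # s) (xs e) []"] by simp
qed

lemma polyf_filter:
  assumes h: "polyf (\<lambda>p. P (fst p) (snd p))" and xs: "polyf xs"
  shows "polyf (\<lambda>e. filter (P e) (xs e))"
proof -
  have "polyf (\<lambda>e. concat (map (\<lambda>y. if P e y then [y] else []) (xs e)))"
    by (intro polyf_concat polyf_map polyf_if assms polyf_basic)
  moreover have "concat (map (\<lambda>y. if Q y then [y] else []) ys) = filter Q ys" for Q and ys :: "'b list"
    by (induction ys) auto
  ultimately show ?thesis by simp
qed

lemma polyf_not: "polyf b \<Longrightarrow> polyf (\<lambda>e. \<not> b e)"
  using polyf_if[of b "\<lambda>_. False" "\<lambda>_. True", OF _ polyf_const polyf_const]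
  by (simp add: if_bool_eq_disj)

lemma polyf_conj: "polyf b \<Longrightarrow> polyf c \<Longrightarrow> polyf (\<lambda>e. b e \<and> c e)"
  using polyf_if[of b c "\<lambda>_. False", OF _ _ polyf_const] by (simp add: if_bool_eq_disj)

lemma polyf_null: "polyf xs \<Longrightarrow> polyf (\<lambda>e. xs e = [])"
proof -
  assume "polyf xs"
  then have "polyf (\<lambda>e. case xs e of [] \<Rightarrow> True | _ # _ \<Rightarrow> False)"
    by (intro polyf_case_list polyf_basic)
  moreover have "(case ys of [] \<Rightarrow> True | _ # _ \<Rightarrow> False) = (ys = [])" for ys :: "'b list"
    by (cases ys) auto
  ultimately show ?thesis by simp
qed

lemma polyf_list_ex:
  assumes "polyf (\<lambda>p. P (fst p) (snd p))" "polyf xs"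
  shows "polyf (\<lambda>e. \<exists>y\<in>set (xs e). P e y)"
proof -
  have "polyf (\<lambda>e. \<not> filter (P e) (xs e) = [])" by (intro polyf_not polyf_null polyf_filter assms)
  moreover have "(\<not> filter Q ys = []) = (\<exists>y\<in>set ys. Q y)" for Q and ys :: "'b list"
    by (auto simp: filter_empty_conv)
  ultimately show ?thesis by simp
qed

lemma polyf_length:
  assumes "polyf xs" shows "polyf (\<lambda>e. length (xs e))"
proof -
  have "polyf (\<lambda>e. length (map (\<lambda>_. ()) (xs e)))"
    by (intro polyf_comp[OF polyf_length_unit] polyf_map polyf_const assms)
  then show ?thesis by simp
qed

lemma polyf_add:
  assumes "polyf m" "polyf n" shows "polyf (\<lambda>e. m e + n e :: nat)"
proof -
  have "polyf (\<lambda>e. length (replicate (m e) () @ replicate (n e) ()))"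
    by (intro polyf_length polyf_append polyf_comp[OF polyf_replicate_unit] assms)
  then show ?thesis by simp
qed

lemma polyf_diff:
  assumes "polyf m" "polyf n" shows "polyf (\<lambda>e. m e - n e :: nat)"
proof -
  have "polyf (\<lambda>e. fold (\<lambda>_ s. case s of 0 \<Rightarrow> 0 | Suc k \<Rightarrow> k) (replicate (n e) ()) (m e))"
    by (rule polyf_fold_additive[where q = "\<lambda>_. 0"])
       (auto intro!: polyf_case_nat polyf_basic polyf_comp[OF polyf_replicate_unit] assms
         poly_bounded_intros split: nat.split)
  moreover have "fold (\<lambda>_ s. case s of 0 \<Rightarrow> 0 | Suc k \<Rightarrow> k) (replicate n ()) m = m - n" for m n
    by (induction n arbitrary: m) (auto split: nat.splits)
  ultimately show ?thesis by simp
qed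

lemma polyf_is_zero: "polyf n \<Longrightarrow> polyf (\<lambda>e. n e = (0::nat))"
  using polyf_null[OF polyf_comp[OF polyf_replicate_unit, of n]] by simp

lemma polyf_le: "polyf m \<Longrightarrow> polyf n \<Longrightarrow> polyf (\<lambda>e. m e \<le> (n e :: nat))"
  using polyf_is_zero[OF polyf_diff, of m n] by simp

lemma polyf_eq: "polyf m \<Longrightarrow> polyf n \<Longrightarrow> polyf (\<lambda>e. m e = (n e :: nat))"
  using polyf_conj[OF polyf_le[of m n] polyf_le[of n m]] by (simp add: eq_iff)

lemma polyf_eq_list:
  assumes "polyf xs" "polyf ys" shows "polyf (\<lambda>e. xs e = (ys e :: nat list))"
proof -
  \<comment> \<open>The flag tells whether all comparisons so far succeeded, the list is what
    remains to be matched. The value \<open>(False, [])\<close> is absorbing.\<close>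
  define f where "f = (\<lambda>(x::nat) (s :: bool \<times> nat list). case snd s of [] \<Rightarrow> (False, [])
    | y # ys \<Rightarrow> (if x = y then (fst s, ys) else (False, [])))"
  have "polyf (\<lambda>e. fold f (xs e) (True, ys e))"
  proof (rule polyf_fold_additive[where q = "\<lambda>_. 3"])
    show "polyf (\<lambda>p::_ \<times> nat \<times> bool \<times> nat list. f (fst (snd p)) (snd (snd p)))"
      unfolding f_def by (intro polyf_case_list polyf_if polyf_eq polyf_basic)
    fix e x and s :: "bool \<times> nat list"
    obtain b ys where s: "s = (b, ys)" by fastforce
    show "esize (f x s) \<le> esize s + 3"
      by (cases b; cases ys) (auto simp: f_def s)
  qed (intro polyf_basic assms poly_bounded_intros)+
  then have "polyf (\<lambda>e. fst (fold f (xs e) (True, ys e)) \<and> snd (fold f (xs e) (True, ys e)) = [])"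
    by (intro polyf_conj polyf_null polyf_fst polyf_snd)
  moreover have "(fst (fold f xs (b, ys)) \<and> snd (fold f xs (b, ys)) = []) = (b \<and> xs = ys)" for xs ys b
  proof (induction xs arbitrary: b ys)
    case (Cons x xs)
    have F: "fold f xs (False, []) = (False, [])" by (induction xs) (auto simp: f_def)
    show ?case using Cons.IH by (cases ys) (auto simp: f_def F)
  qed auto
  ultimately show ?thesis by simp
qed

lemmas polyf_intros = polyf_basic polyf_case_list polyf_case_nat polyf_if polyf_Suc polyf_rev polyf_append
  polyf_concat polyf_map polyf_filter polyf_not polyf_conj polyf_null polyf_list_ex polyf_length
  polyf_add polyf_diff polyf_le polyf_eq polyf_eq_list

section \<open>Input and output\<close>

text \<open>Turns the initial tapes into stacks: the head of the input moves onto its last symbol,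
  the other heads to position -1.\<close>

definition rewind :: prog where
  "rewind = Seq (While 0 0 (Move 0 move.Right)) (Seq (Move 0 move.Left) (Seq (Move 1 move.Left)
     (Seq (Move 2 move.Left) (Seq (Move 3 move.Left) (Seq (Move 4 move.Left) (Move 5 move.Left))))))"

lemma runs_scan_right:
  assumes "0 \<notin> set w" "j \<le> length w"
  shows "runs (While 0 0 (Move 0 move.Right)) (1 + 2 * (length w - j))
    ((ncontent w, int j) # ts) ((ncontent w, int (length w)) # ts)"
  using assms(2)
proof (induction "length w - j" arbitrary: j)
  case 0
  then have "j = length w" by simp
  then show ?case
    using runs_mono[OF runs_While_end[of "(ncontent w, int j) # ts" 0 0 "Move 0 move.Right"]]
    by (simp add: scan_def ncontent_def[of w "int (length w)"])
next
  case (Suc k)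
  then have j: "j < length w" by simp
  have ne: "scan ((ncontent w, int j) # ts) ! 0 \<noteq> 0"
    using assms(1) j nth_mem[OF j] by (cases "w ! j = 0") (auto simp: scan_def ncontent_def)
  have 1: "runs (Move 0 move.Right) 1 ((ncontent w, int j) # ts) ((ncontent w, int (Suc j)) # ts)"
    using runs_Move[of 0 move.Right "(ncontent w, int j) # ts"] by (simp add: add.commute)
  show ?case
    by (rule runs_mono[OF runs_While_step[OF ne 1 Suc.hyps(1)[of "Suc j"]]]) (use Suc j in auto)
qed

lemma rewind:
  assumes "0 \<notin> set w"
  shows "runs rewind (20 + 2 * length w) ((ncontent w, 0) # replicate 5 (ncontent [], 0))
     (map tape_of [rev w, [], [], [], [], []])"
proof -
  have M: "runs (Move i m) 1 ts ts'" if "ts' = ts[i := (fst (ts ! i), snd (ts ! i) + offset m)]" for i m ts ts'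
    using runs_Move that by simp
  let ?e = "(ncontent [], 0)" and ?f = "(ncontent [], -1)"
  let ?w = "(ncontent w, int (length w) - 1)"
  have 0: "runs (While 0 0 (Move 0 move.Right)) (1 + 2 * length w) [(ncontent w, 0), ?e, ?e, ?e, ?e, ?e]
      [(ncontent w, int (length w)), ?e, ?e, ?e, ?e, ?e]"
    using runs_scan_right[OF assms, of 0] by simp
  have 1: "runs (Move 0 move.Left) 1 [(ncontent w, int (length w)), ?e, ?e, ?e, ?e, ?e] [?w, ?e, ?e, ?e, ?e, ?e]"
    by (rule M) simp
  have 2: "runs (Move 1 move.Left) 1 [?w, ?e, ?e, ?e, ?e, ?e] [?w, ?f, ?e, ?e, ?e, ?e]"
    by (rule M) simp
  have 3: "runs (Move 2 move.Left) 1 [?w, ?f, ?e, ?e, ?e, ?e] [?w, ?f, ?f, ?e, ?e, ?e]"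
    by (rule M) simp
  have 4: "runs (Move 3 move.Left) 1 [?w, ?f, ?f, ?e, ?e, ?e] [?w, ?f, ?f, ?f, ?e, ?e]"
    by (rule M) simp
  have 5: "runs (Move 4 move.Left) 1 [?w, ?f, ?f, ?f, ?e, ?e] [?w, ?f, ?f, ?f, ?f, ?e]"
    by (rule M) simp
  have 6: "runs (Move 5 move.Left) 1 [?w, ?f, ?f, ?f, ?f, ?e] [?w, ?f, ?f, ?f, ?f, ?f]"
    by (rule M) simp
  have "runs rewind (20 + 2 * length w) [(ncontent w, 0), ?e, ?e, ?e, ?e, ?e] [?w, ?f, ?f, ?f, ?f, ?f]"
    unfolding rewind_def
    by (rule runs_mono[OF runs_Seq[OF 0 runs_Seq[OF 1 runs_Seq[OF 2 runs_Seq[OF 3 runs_Seq[OF 4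
      runs_Seq[OF 5 6]]]]]]]) simp
  then show ?thesis by (simp add: tape_of_def numeral_eq_Suc)
qed

text \<open>The symbols 0, 1 and 2 are the blank and the two tree symbols, so the input and output
  symbol number \<open>j\<close> becomes \<open>3 + j\<close>.\<close>

fun read_symbol :: "nat \<Rightarrow> prog" where
  "read_symbol 0 = skip"
| "read_symbol (Suc j) = Cond 0 (3 + j) (Seq (push_list (2 # str (enc j))) (pop 0)) (read_symbol j)"

lemma length_str_nat: "length (str (enc (j :: nat))) = 2 * j + 1"
  using esize_nat[of j] by (simp add: esize_def tsize_def)

lemma read_symbol:
  "j < m \<Longrightarrow> srun (read_symbol m) (20 + 20 * m) [(3 + j) # ins, a, b, c, d, out]
     [ins, 2 # str (enc j) @ a, b, c, d, out]"
proof (induction m)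
  case (Suc m)
  show ?case
  proof (cases "j = m")
    case True
    have "srun (pop 0) 3 [(3 + j) # ins, 2 # str (enc j) @ a, b, c, d, out]
      [ins, 2 # str (enc j) @ a, b, c, d, out]"
      by (rule srun_pop_last) simp_all
    with push_list[of "2 # str (enc j)" "(3 + j) # ins" a b c d out, simplified append.simps]
    have "srun (Seq (push_list (2 # str (enc j))) (pop 0)) (20 + 10 * m)
      [(3 + j) # ins, a, b, c, d, out] [ins, 2 # str (enc j) @ a, b, c, d, out]"
      by (rule srun_SeqI) (simp add: length_str_nat True)
    then show ?thesis unfolding read_symbol.simps True
      by (intro srun_CondI) (auto intro: srun_mono)
  next
    case False
    with Suc show ?thesis unfolding read_symbol.simps
      by (intro srun_CondI) (auto intro: srun_mono)
  qed
qed simp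

text \<open>The symbol pushed at the start is the empty list. The input stack delivers its last
  symbol first, so prepending each symbol to the list restores the original order.\<close>

definition read_input :: "nat \<Rightarrow> prog" where
  "read_input m = Seq (push 1 1) (While 0 0 (read_symbol m))"

lemma read_input_loop:
  "set js \<subseteq> {..<m} \<Longrightarrow> srun (While 0 0 (read_symbol m)) (1 + length js * (21 + 20 * m))
     [map ((+) 3) js, str (enc l), b, c, d, out] [[], str (enc (rev js @ l)), b, c, d, out]"
proof (induction js arbitrary: l)
  case Nil
  show ?case by (rule srun_While_endI) simp_all
next
  case (Cons j js)
  have 1: "srun (read_symbol m) (20 + 20 * m) [(3 + j) # map ((+) 3) js, str (enc l), b, c, d, out]
     [map ((+) 3) js, str (enc (j # l)), b, c, d, out]"
    using read_symbol[of j m "map ((+) 3) js" "str (enc l)"] Cons.prems by simp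
  have "srun (While 0 0 (read_symbol m)) (1 + length js * (21 + 20 * m))
     [map ((+) 3) js, str (enc (j # l)), b, c, d, out] [[], str (enc (rev js @ j # l)), b, c, d, out]"
    using Cons.IH[of "j # l"] Cons.prems by simp
  from srun_WhileI[OF _ _ 1 this, of "1 + length (j # js) * (21 + 20 * m)"] show ?case by simp
qed

lemma read_input:
  assumes "set js \<subseteq> {..<m}"
  shows "srun (read_input m) (5 + length js * (21 + 20 * m))
     [rev (map ((+) 3) js), [], [], [], [], []] (state [] (enc js) [] [])"
proof -
  have "srun (push 1 1) 3 [rev (map ((+) 3) js), [], [], [], [], []]
     [map ((+) 3) (rev js), str (enc ([] :: nat list)), [], [], [], []]"
    by (rule srun_push_last) (simp_all add: rev_map)
  from srun_SeqI[OF this read_input_loop[of "rev js" m "[]"]] assms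
  show ?thesis unfolding read_input_def state_def by simp
qed

text \<open>The unary number is counted in the program text: \<open>j\<close> is the part already
  consumed, and \<open>n\<close> limits how deep the case distinction is unrolled.\<close>

fun write_symbol :: "nat \<Rightarrow> nat \<Rightarrow> prog" where
  "write_symbol 0 j = skip"
| "write_symbol (Suc n) j = Cond 1 1 (Seq (pop 1) (push 5 (3 + j)))
     (Seq (pop 1) (Seq (pop 1) (write_symbol n (Suc j))))"

lemma enc_nat_simps [simp]: "enc (0 :: nat) = Leaf" "enc (Suc n) = Node Leaf (enc n)"
  by (simp_all add: enc_nat_def enc_unit_def)

lemma write_symbol:
  "k < n \<Longrightarrow> srun (write_symbol n j) (10 * n) [i, str (enc k) @ r, b, c, d, out]
     [i, r, b, c, d, (3 + (j + k)) # out]"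
proof (induction n arbitrary: j k)
  case (Suc n)
  show ?case
  proof (cases k)
    case 0
    have "srun (write_symbol (Suc n) j) (10 * 1) [i, 1 # r, b, c, d, out] [i, r, b, c, d, (3 + j) # out]"
      unfolding write_symbol.simps by (rule srun_basic; simp)+
    then show ?thesis unfolding 0 by (auto intro: srun_mono)
  next
    case (Suc k')
    have "srun (write_symbol n (Suc j)) (10 * n) [i, str (enc k') @ r, b, c, d, out]
     [i, r, b, c, d, (3 + (Suc j + k')) # out]"
      by (rule Suc.IH) (use Suc.prems Suc in simp)
    then show ?thesis unfolding write_symbol.simps
      using Suc by (intro srun_CondI) (auto intro!: srun_pop_Seq intro: srun_mono)
  qed
qed simp

definition write_output :: "nat \<Rightarrow> prog" where
  "write_output m = While 1 1 (Seq (pop 1) (write_symbol m 0))"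

lemma write_output:
  "set js \<subseteq> {..<m} \<Longrightarrow> srun (write_output m) (1 + length js * (5 + 10 * m))
     [i, str (enc js), b, c, d, out] [i, [1], b, c, d, rev (map ((+) 3) js) @ out]"
proof (induction js arbitrary: out)
  case Nil
  show ?case unfolding write_output_def by (rule srun_While_endI) simp_all
next
  case (Cons j js)
  have 1: "srun (Seq (pop 1) (write_symbol m 0)) (4 + 10 * m) [i, str (enc (j # js)), b, c, d, out]
     [i, str (enc js), b, c, d, (3 + j) # out]"
    by (rule srun_pop_Seq) (use write_symbol[of j m 0] Cons.prems in simp_all)
  have "srun (write_output m) (1 + length js * (5 + 10 * m))
     [i, str (enc js), b, c, d, (3 + j) # out] [i, [1], b, c, d, rev (map ((+) 3) js) @ (3 + j) # out]"
    using Cons by simp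
  from srun_WhileI[OF _ _ 1 this[unfolded write_output_def], of "1 + length (j # js) * (5 + 10 * m)"]
  show ?case unfolding write_output_def by simp
qed

lemma writes_io:
  "writes rewind = {}" "writes (read_symbol m) \<subseteq> {..2}" "writes (write_symbol m j) \<subseteq> {..<3 + m + j}"
proof -
  show "writes rewind = {}" by (simp add: rewind_def)
  show "writes (read_symbol m) \<subseteq> {..2}"
  proof (induction m)
    case (Suc m)
    then show ?case using str_set[of "enc m"] by auto
  qed simp
  show "writes (write_symbol m j) \<subseteq> {..<3 + m + j}"
  proof (induction m arbitrary: j)
    case (Suc m)
    then show ?case using Suc.IH[of "Suc j"] by auto
  qed simp
qed

text \<open>\<open>F\<close> is \<open>f\<close> with symbols replaced by their positions in
  \<open>\<sigma>\<close>. The list \<open>\<sigma>\<close> may go beyond \<open>A\<close>, as the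
  output uses symbols of its own.\<close>

theorem poly_time_computable_polyf:
  fixes F :: "nat list \<Rightarrow> nat list" and f :: "'c list \<Rightarrow> 'c list"
  assumes F: "polyf F" and \<sigma>: "distinct \<sigma>" "A \<subseteq> set \<sigma>"
    and f: "\<And>js. set js \<subseteq> {..<length \<sigma>} \<Longrightarrow> map ((!) \<sigma>) js \<in> lists A \<Longrightarrow>
      set (F js) \<subseteq> {..<length \<sigma>} \<and> f (map ((!) \<sigma>) js) = map ((!) \<sigma>) (F js)"
  shows "poly_time_computable A f"
proof -
  let ?m = "length \<sigma>"
  \<comment> \<open>Numbers that stand for no symbol are also sent to \<open>Aux\<close>, so that
    \<open>sy\<close> is injective on all natural numbers.\<close>
  define sy where "sy s = (if s = 0 then Blank else if s < 3 then Aux s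
     else if s - 3 < ?m then Sym (\<sigma> ! (s - 3)) else Aux s)" for s
  have sy: "inj sy"
  proof (rule injI)
    fix s t assume "sy s = sy t"
    then show "s = t" using nth_eq_iff_index_eq[OF \<sigma>(1), of "s - 3" "t - 3"]
      by (auto simp: sy_def split: if_splits)
  qed
  have sy3: "sy (3 + j) = Sym (\<sigma> ! j)" if "j < ?m" for j using that by (simp add: sy_def)
  obtain c d where c: "computes c d F" using F unfolding polyf_def by blast
  let ?c = "Seq rewind (Seq (read_input ?m) (Seq c (write_output ?m)))"
  \<comment> \<open>Size of the encoded input: an entry is a number below \<open>?m\<close> and thus
    has bounded size, in spite of the unary notation.\<close>
  let ?E = "\<lambda>n. n * (2 * ?m + 2) + 1"
  let ?T = "\<lambda>n. 50 + 2 * n + n * (21 + 20 * ?m) + (?E n + 2) ^ d + (?E n + 2) ^ d * (5 + 10 * ?m)"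
  have "poly_bounded ?T" by (intro poly_bounded_intros)
  then obtain e where e: "\<And>n. ?T n \<le> (n + 2) ^ e" unfolding poly_bounded_def by blast
  show ?thesis
  proof (rule poly_time_computableI[where sy = sy and c = ?c and n = "3 + ?m" and K = 6 and p = "[:2, 1:] ^ e"])
    have "{..2} \<subseteq> {..<3 + ?m}" by auto
    then show "writes ?c \<subseteq> {..<3 + ?m}"
      using c writes_io(1) writes_io(2)[of ?m] writes_io(3)[of ?m 0]
      by (auto simp: computes_def read_input_def write_output_def)
    show "Sym ` A \<subseteq> sy ` {..<3 + ?m}"
    proof
      fix x assume "x \<in> Sym ` A"
      then obtain a where "a \<in> set \<sigma>" "x = Sym a" using \<sigma>(2) by auto
      then obtain j where "j < ?m" "x = Sym (\<sigma> ! j)" by (auto simp: in_set_conv_nth)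
      then show "x \<in> sy ` {..<3 + ?m}" by (intro image_eqI[of _ _ "3 + j"]) (auto simp: sy3)
    qed
    fix w assume w: "w \<in> lists A"
    have "\<exists>js. set js \<subseteq> {..<?m} \<and> w = map ((!) \<sigma>) js" using w
    proof (induction w)
      case (Cons a w)
      then obtain js where "set js \<subseteq> {..<?m}" "w = map ((!) \<sigma>) js" by auto
      moreover have "a \<in> set \<sigma>" using Cons \<sigma>(2) by auto
      then obtain j where "j < ?m" "a = \<sigma> ! j" by (auto simp: in_set_conv_nth)
      ultimately show ?case by (intro exI[of _ "j # js"]) auto
    qed auto
    then obtain js where js: "set js \<subseteq> {..<?m}" "w = map ((!) \<sigma>) js" by blast
    have Fs: "set (F js) \<subseteq> {..<?m}" "f w = map ((!) \<sigma>) (F js)" using f[OF js(1)] w js(2) by auto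
    have n: "length js = length w" using js by simp
    have E: "esize js \<le> ?E (length w)"
    proof -
      have "esize j \<le> 2 * ?m + 1" if "j \<in> set js" for j
        using that js(1) by (auto simp: esize_nat)
      from esize_list_le[of js, OF this] show ?thesis using n by simp
    qed
    have "length (F js) \<le> esize (F js)" by (rule length_le_esize)
    also have "\<dots> \<le> (esize js + 2) ^ d" using c by (simp add: computes_def)
    also have "\<dots> \<le> (?E (length w) + 2) ^ d" by (intro power_mono) (use E in auto)
    finally have l: "length (F js) * (5 + 10 * ?m) \<le> (?E (length w) + 2) ^ d * (5 + 10 * ?m)"
      by (rule mult_right_mono) simp
    let ?cw = "map ((+) 3) js" and ?cv = "map ((+) 3) (F js)"
    have 1: "runs rewind (20 + 2 * length js) ((ncontent ?cw, 0) # replicate 5 (ncontent [], 0))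
     (map tape_of [rev ?cw, [], [], [], [], []])"
    proof -
      have "0 \<notin> set ?cw" by auto
      from rewind[OF this] show ?thesis by simp
    qed
    have 2: "srun c ((?E (length w) + 2) ^ d) (state [] (enc js) [] []) (state [] (enc (F js)) [] [])"
      by (rule computes_run[OF c E order_refl])
    have 3: "srun (write_output ?m) (1 + length (F js) * (5 + 10 * ?m))
     (state [] (enc (F js)) [] []) [[], [1], [], [], [], rev ?cv]"
      using write_output[OF Fs(1), of "[]" "[]" "[]" "[]" "[]"] by (simp add: state_def)
    have "runs ?c (?T (length w)) ((ncontent ?cw, 0) # replicate 5 (ncontent [], 0))
       (map tape_of [[], [1], [], [], [], rev ?cv])"
      by (rule runs_mono[OF runs_Seq[OF 1 srun_Seq[OF read_input[OF js(1)] srun_Seq[OF 2 3], unfolded srun_def]]])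
         (use l in \<open>unfold n, linarith\<close>)
    then obtain t where t: "t \<le> ?T (length w)"
      "(pstep ^^ t) ([?c], (ncontent ?cw, 0) # replicate 5 (ncontent [], 0)) = ([], map tape_of [[], [1], [], [], [], rev ?cv])"
      unfolding runs_def by blast
    have "poly ([:2, 1:] ^ e) (length w) = (length w + 2) ^ e" by (simp add: poly_power add.commute)
    then have "t \<le> poly ([:2, 1:] ^ e) (length w)" using t(1) e[of "length w"] by linarith
    moreover have "fst (last (map tape_of [[], [1], [], [], [], rev ?cv])) = ncontent ?cv"
      by (simp add: tape_of_def)
    moreover have "map sy ?cw = map Sym w" using js by (auto simp: sy3)
    moreover have "map sy ?cv = map Sym (f w)" using Fs by (auto simp: sy3)
    ultimately show "\<exists>cw t ts cv. map sy cw = map Sym w \<and> t \<le> poly ([:2, 1:] ^ e) (length w) \<and>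
        (pstep ^^ t) ([?c], (ncontent cw, 0) # replicate (6 - 1) (ncontent [], 0)) = ([], ts) \<and>
        fst (last ts) = ncontent cv \<and> map sy cv = map Sym (f w)"
      using t(2) by (intro exI[of _ ?cw] exI[of _ t] exI[of _ "map tape_of [[], [1], [], [], [], rev ?cv]"] exI[of _ ?cv]) simp
  qed (use sy in \<open>simp_all add: sy_def\<close>)
qed

section \<open>Dehn's algorithm\<close>

text \<open>A list with at most one element replaces an option, so that
  \<open>polyf_case_list\<close> applies to the result.\<close>

fun strip_prefix :: "nat list \<Rightarrow> nat list \<Rightarrow> nat list list" where
  "strip_prefix [] w = [w]"
| "strip_prefix (a # u) w = (case w of [] \<Rightarrow> [] | b # w' \<Rightarrow> if b = a then strip_prefix u w' else [])"

type_synonym rewrite_rules = "(nat list \<times> nat list) list"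

fun rewrite_head :: "rewrite_rules \<Rightarrow> nat list \<Rightarrow> nat list \<Rightarrow> nat list" where
  "rewrite_head [] w d = d"
| "rewrite_head (r # tab) w d =
     (case strip_prefix (fst r) w of [] \<Rightarrow> rewrite_head tab w d | x # _ \<Rightarrow> snd r @ x)"

text \<open>A single rewriting step, at the leftmost position where some rule matches.\<close>

fun shorten :: "rewrite_rules \<Rightarrow> nat list \<Rightarrow> nat list" where
  "shorten tab [] = []"
| "shorten tab (a # w) = rewrite_head tab (a # w) (a # shorten tab w)"

text \<open>The list folded over merely counts. As many steps as \<open>w\<close> has letters are
  enough, since a step on a nonempty word of value 1 removes at least one letter.\<close>

definition trivial_word :: "rewrite_rules \<Rightarrow> nat list \<Rightarrow> bool" where
  "trivial_word tab w \<longleftrightarrow> fold (\<lambda>_. shorten tab) w w = []"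

lemma strip_prefix_eq: "strip_prefix u w = (if take (length u) w = u then [drop (length u) w] else [])"
  by (induction u arbitrary: w) (auto split: list.split)

lemma polyf_strip_prefix:
  assumes "polyf f" shows "polyf (\<lambda>e. strip_prefix u (f e))"
proof -
  have "polyf (strip_prefix u)"
  proof (induction u)
    case Nil
    show ?case unfolding strip_prefix.simps by (intro polyf_intros)
  next
    case (Cons a u)
    show ?case unfolding strip_prefix.simps by (intro polyf_intros polyf_comp[OF Cons])
  qed
  from polyf_comp[OF this assms] show ?thesis .
qed

text \<open>The table is a constant, so the recursion over it unrolls into finitely many nested case
  distinctions.\<close>

lemma polyf_rewrite_head:
  assumes "polyf f" "polyf g"
  shows "polyf (\<lambda>e. rewrite_head tab (f e) (g e))"
proof (induction tab)
  case Nil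
  show ?case unfolding rewrite_head.simps by (rule assms(2))
next
  case (Cons r tab)
  show ?case unfolding rewrite_head.simps
    by (rule polyf_case_list[OF polyf_strip_prefix[OF assms(1)] Cons]) (intro polyf_intros)
qed

lemma esize_drop: "esize (drop n w) \<le> esize w"
proof -
  have "esize w + 1 = esize (take n w) + esize (drop n w)"
    using esize_append[of "take n w" "drop n w"] by simp
  then show ?thesis using esize_pos[of "take n w"] by linarith
qed

lemma rewrite_head_size:
  "rewrite_head tab w d = d \<or> esize (rewrite_head tab w d) \<le> esize tab + esize w"
proof (induction tab)
  case (Cons r tab)
  show ?case
  proof (cases "strip_prefix (fst r) w")
    case Nil
    then show ?thesis using Cons by auto
  next
    case (Cons x xs)
    then have x: "x = drop (length (fst r)) w" by (auto simp: strip_prefix_eq split: if_splits)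
    have "esize (snd r @ x) + 1 = esize (snd r) + esize x" by (rule esize_append)
    moreover have "esize x \<le> esize w" unfolding x by (rule esize_drop)
    moreover have "esize (snd r) \<le> esize r" by (cases r) simp
    moreover have "rewrite_head (r # tab) w d = snd r @ x" using Cons by simp
    ultimately show ?thesis by simp
  qed
qed simp

lemma shorten_size: "esize (shorten tab w) \<le> esize w + esize tab"
proof (induction w)
  case (Cons a w)
  then show ?case using rewrite_head_size[of tab "a # w" "a # shorten tab w"] by auto
qed simp

lemma polyf_shorten:
  assumes "polyf f" shows "polyf (\<lambda>e. shorten tab (f e))"
proof -
  \<comment> \<open>The recursion becomes a fold over the reversed word. The original suffix is
    carried along with its shortened form because rules are matched against the former.\<close>
  define g where "g = (\<lambda>a s. (a # fst s, rewrite_head tab (a # fst s) (a # snd s)))"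
  have g: "fold g ys ([], []) = (rev ys, shorten tab (rev ys))" for ys
    by (induction ys rule: rev_induct) (auto simp: g_def)
  have "polyf (\<lambda>w. fold g (rev w) ([], []))"
  proof (rule polyf_fold)
    show "polyf (\<lambda>p::nat list \<times> nat \<times> nat list \<times> nat list. g (fst (snd p)) (snd (snd p)))"
      unfolding g_def by (intro polyf_intros polyf_rewrite_head)
    show "poly_bounded (\<lambda>n. 1 + (n + (n + esize tab)))" by (intro poly_bounded_intros)
    fix w ys zs :: "nat list" assume "rev w = ys @ zs"
    then have "w = rev zs @ rev ys" by (metis rev_append rev_rev_ident)
    then have "esize (rev ys) \<le> esize w"
      using esize_append[of "rev zs" "rev ys"] esize_pos[of "rev zs"] by (simp del: esize_pos)
    then show "esize (fold g ys ([], [])) \<le> 1 + (esize w + (esize w + esize tab))"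
      unfolding g using shorten_size[of tab "rev ys"] by simp
  qed (intro polyf_intros)+
  from polyf_comp[OF polyf_snd[OF this] assms] show ?thesis by (simp add: g)
qed

lemma polyf_trivial_word:
  assumes "polyf f" shows "polyf (\<lambda>e. trivial_word tab (f e))"
proof -
  have "polyf (\<lambda>w. fold (\<lambda>_. shorten tab) w w)"
    by (rule polyf_fold_additive[where q = "\<lambda>_. esize tab"])
       (intro polyf_intros polyf_shorten poly_bounded_intros shorten_size)+
  then have "polyf (\<lambda>w. trivial_word tab w)" unfolding trivial_word_def by (rule polyf_null)
  from polyf_comp[OF this assms] show ?thesis .
qed

section \<open>Words of logarithmic length\<close>

definition extend :: "nat \<Rightarrow> nat list list \<Rightarrow> nat list list" where
  "extend m B = [] # concat (map (\<lambda>w. map (\<lambda>j. j # w) [0..<m]) B)"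

fun ball_words :: "nat \<Rightarrow> nat \<Rightarrow> nat list list" where
  "ball_words m 0 = [[]]"
| "ball_words m (Suc t) = extend m (ball_words m t)"

lemma set_ball_words: "set (ball_words m t) = {w \<in> lists {..<m}. length w \<le> t}"
proof (induction t)
  case (Suc t)
  show ?case
  proof (intro equalityI subsetI)
    fix w assume "w \<in> {w \<in> lists {..<m}. length w \<le> Suc t}"
    then show "w \<in> set (ball_words m (Suc t))" using Suc
      by (cases w) (auto simp: extend_def)
  qed (use Suc in \<open>auto simp: extend_def\<close>)
qed auto

lemma length_ball_words: "length (ball_words m t) \<le> (m + 1) ^ t"
proof (induction t)
  case (Suc t)
  have "length (ball_words m (Suc t)) = 1 + m * length (ball_words m t)"
    by (simp add: extend_def length_concat comp_def sum_list_triv)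
  also have "\<dots> \<le> 1 + m * (m + 1) ^ t" using Suc by simp
  also have "\<dots> \<le> (m + 1) ^ Suc t" by simp
  finally show ?case .
qed simp

lemma extend_funpow: "(extend m ^^ k) (ball_words m t) = ball_words m (k + t)"
  by (induction k) auto

lemma polyf_extend_funpow: "polyf f \<Longrightarrow> polyf (\<lambda>e. (extend m ^^ k) (f e))"
proof (induction k)
  case (Suc k)
  then show ?case unfolding funpow.simps o_apply extend_def
    by (intro polyf_intros) auto
qed simp

text \<open>The first component runs through the powers of two, so that the second one is a ball whose
  radius grows logarithmically.\<close>

definition grow :: "nat \<Rightarrow> nat \<Rightarrow> nat \<Rightarrow> nat \<times> nat list list \<Rightarrow> nat \<times> nat list list" where
  "grow m K n s = (if fst s \<le> n then (fst s + fst s, (extend m ^^ K) (snd s)) else s)"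

definition log_ball :: "nat \<Rightarrow> nat \<Rightarrow> nat \<Rightarrow> nat list \<Rightarrow> nat \<times> nat list list" where
  "log_ball m K C u = fold (\<lambda>_. grow m K (length u)) u (1, ball_words m C)"

text \<open>Either every element of \<open>ys\<close> has doubled the counter, or the counter has
  passed \<open>n\<close> and come to rest. For a list of length \<open>n\<close> the former also
  makes it exceed \<open>n\<close>. The upper bound says that it overshoots by one doubling at
  most.\<close>

lemma fold_grow:
  "\<exists>t\<le>length ys. fold (\<lambda>_. grow m K n) ys (1, ball_words m C) = (2 ^ t, ball_words m (K * t + C)) \<and>
     (t = length ys \<or> n < 2 ^ t) \<and> 2 ^ t \<le> 2 * n + 1"
proof (induction ys rule: rev_induct)
  case (snoc y ys)
  then obtain t where t: "t \<le> length ys"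
    "fold (\<lambda>_. grow m K n) ys (1, ball_words m C) = (2 ^ t, ball_words m (K * t + C))"
    "t = length ys \<or> n < 2 ^ t" "2 ^ t \<le> 2 * n + 1" by blast
  have s: "fold (\<lambda>_. grow m K n) (ys @ [y]) (1, ball_words m C)
      = grow m K n (2 ^ t, ball_words m (K * t + C))" using t(2) by simp
  show ?case
  proof (cases "2 ^ t \<le> n")
    case True
    then show ?thesis unfolding s
      using t(1,3,4)
      by (intro exI[of _ "Suc t"]) (auto simp: grow_def extend_funpow algebra_simps)
  next
    case False
    then show ?thesis unfolding s
      using t(1,3,4) by (intro exI[of _ t]) (auto simp: grow_def)
  qed
qed simp

lemma log_ball:
  "\<exists>t. snd (log_ball m K C u) = ball_words m (K * t + C) \<and> length u < 2 ^ t"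
  using fold_grow[where ys = u and n = "length u" and m = m and K = K and C = C]
  unfolding log_ball_def by (metis less_exp snd_conv)

text \<open>The number of words is at most the power of m + 1 with exponent Kt + C. By m + 1 \<le>
  \<open>2 ^ (m + 1)\<close>, its part with exponent Kt is at most a fixed power of
  \<open>2 ^ t\<close>, hence polynomial in n.\<close>

lemma ball_words_size:
  assumes "2 ^ t \<le> 2 * n + (1 :: nat)"
  shows "esize (ball_words m (K * t + C)) \<le>
    (2 * n + 1) ^ (Suc m * K) * (m + 1) ^ C * ((K * (2 * n + 1) + C) * (2 * m + 2) + 2) + 1"
proof -
  have t: "t \<le> 2 * n + 1" using assms less_exp[of t] by linarith
  have "esize w \<le> (K * (2 * n + 1) + C) * (2 * m + 2) + 1" if "w \<in> set (ball_words m (K * t + C))" for w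
  proof -
    have w: "w \<in> lists {..<m}" "length w \<le> K * t + C" using that by (auto simp: set_ball_words)
    have "esize j \<le> 2 * m + 1" if "j \<in> set w" for j using that w by (auto simp: esize_nat)
    from esize_list_le[of w, OF this] have "esize w \<le> length w * (2 * m + 2) + 1" by simp
    also have "length w * (2 * m + 2) \<le> (K * (2 * n + 1) + C) * (2 * m + 2)"
    proof (rule mult_right_mono)
      have "K * t \<le> K * (2 * n + 1)" using t by (rule mult_left_mono) simp
      then show "length w \<le> K * (2 * n + 1) + C" using w(2) by linarith
    qed simp
    finally show ?thesis by simp
  qed
  from esize_list_le[of "ball_words m (K * t + C)", OF this]
  have 1: "esize (ball_words m (K * t + C)) \<le>
    length (ball_words m (K * t + C)) * ((K * (2 * n + 1) + C) * (2 * m + 2) + 2) + 1" by simp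
  have "length (ball_words m (K * t + C)) \<le> (m + 1) ^ (K * t) * (m + 1) ^ C"
    using length_ball_words[of m "K * t + C"] by (simp add: power_add)
  also have "(m + 1) ^ (K * t) \<le> (2 ^ Suc m) ^ (K * t)"
    by (rule power_mono) (use less_exp[of "Suc m"] in simp_all)
  also have "(2 ^ Suc m) ^ (K * t) = (2 ^ t :: nat) ^ (Suc m * K)"
    unfolding power_mult[symmetric] by (simp only: ac_simps)
  also have "\<dots> \<le> (2 * n + 1) ^ (Suc m * K)" by (rule power_mono) (use assms in simp_all)
  finally have "length (ball_words m (K * t + C)) \<le> (2 * n + 1) ^ (Suc m * K) * (m + 1) ^ C"
    by simp
  from mult_right_mono[OF this, of "(K * (2 * n + 1) + C) * (2 * m + 2) + 2"] 1
  show ?thesis by linarith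
qed

lemma polyf_log_ball: "polyf (\<lambda>u. log_ball m K C u)"
proof -
  let ?S = "\<lambda>n. (2 * n + 1) ^ (Suc m * K) * (m + 1) ^ C * ((K * (2 * n + 1) + C) * (2 * m + 2) + 2) + 1"
  show ?thesis unfolding log_ball_def
  proof (rule polyf_fold)
    show "polyf (\<lambda>p::nat list \<times> nat \<times> nat \<times> nat list list. grow m K (length (fst p)) (snd (snd p)))"
      unfolding grow_def by (intro polyf_intros polyf_extend_funpow)
    show "poly_bounded (\<lambda>n. 1 + ((2 * (2 * n + 1) + 1) + ?S n))" by (intro poly_bounded_intros)
    fix u ys zs :: "nat list"
    obtain t where t: "fold (\<lambda>_. grow m K (length u)) ys (1, ball_words m C) = (2 ^ t, ball_words m (K * t + C))"
      "2 ^ t \<le> 2 * length u + 1"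
      using fold_grow[where ys = ys and n = "length u" and m = m and K = K and C = C] by blast
    have t2: "2 ^ t \<le> 2 * esize u + 1" using t(2) length_le_esize[of u] by linarith
    show "esize (fold (\<lambda>_. grow m K (length u)) ys (1, ball_words m C)) \<le> 1 + ((2 * (2 * esize u + 1) + 1) + ?S (esize u))"
    proof -
      have "2 * 2 ^ t + 1 \<le> 2 * (2 * esize u + 1) + 1" using t2 by simp
      from add_mono[OF this ball_words_size[OF t2, of m K C]]
      show ?thesis unfolding t(1) esize_simps esize_nat by simp
    qed
  qed (intro polyf_intros)+
qed

section \<open>Saturation of a labelled graph\<close>

text \<open>Stands for a path from \<open>src\<close> to \<open>tgt\<close> whose value is that of
  the word \<open>lab\<close> and along which the decisions \<open>sel\<close> are taken. Edges of
  the graph have the same form.\<close>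

type_synonym fact = "nat \<times> nat \<times> nat list \<times> bool list"

abbreviation src :: "fact \<Rightarrow> nat" where "src x \<equiv> fst x"
abbreviation tgt :: "fact \<Rightarrow> nat" where "tgt x \<equiv> fst (snd x)"
abbreviation lab :: "fact \<Rightarrow> nat list" where "lab x \<equiv> fst (snd (snd x))"
abbreviation sel :: "fact \<Rightarrow> bool list" where "sel x \<equiv> snd (snd (snd x))"

definition cost :: "bool list \<Rightarrow> nat" where "cost bs = length (filter (\<lambda>b. b) bs)"

definition same_key :: "fact \<Rightarrow> fact \<Rightarrow> bool" where
  "same_key x y \<longleftrightarrow> src x = src y \<and> tgt x = tgt y \<and> lab x = lab y"

definition insert_fact :: "fact \<Rightarrow> fact list \<Rightarrow> fact list" where
  "insert_fact x T = (if \<exists>y\<in>set T. same_key x y \<and> cost (sel y) \<le> cost (sel x) then T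
     else x # filter (\<lambda>y. \<not> same_key x y) T)"

text \<open>Without it, each round could square the number of facts. One cheapest selection per key
  is all that an optimum needs.\<close>

definition prune :: "fact list \<Rightarrow> fact list" where
  "prune xs = fold insert_fact xs []"

fun lookup :: "'b list \<Rightarrow> 'b \<Rightarrow> nat \<Rightarrow> 'b" where
  "lookup [] d j = d"
| "lookup (x # xs) d j = (case j of 0 \<Rightarrow> x | Suc k \<Rightarrow> lookup xs d k)"

definition inv_word :: "nat list \<Rightarrow> nat list \<Rightarrow> nat list" where
  "inv_word ivt w = rev (map (lookup ivt 0) w)"

definition initial_facts :: "rewrite_rules \<Rightarrow> nat list \<Rightarrow> nat list list \<Rightarrow> fact list \<Rightarrow> fact list" where
  "initial_facts tab ivt B E = concat (map (\<lambda>x. map (\<lambda>c. (src x, tgt x, c, sel x))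
     (filter (\<lambda>c. trivial_word tab (lab x @ inv_word ivt c)) B)) E)"

text \<open>A fact is produced for every word \<open>c\<close> of the ball with the right value
  rather than for a normal form, so that any geodesic word picked in the completeness proof is
  present.\<close>

definition combine :: "rewrite_rules \<Rightarrow> nat list \<Rightarrow> nat list list \<Rightarrow> fact list \<Rightarrow> fact list" where
  "combine tab ivt B T = concat (map (\<lambda>x. concat (map (\<lambda>y. map (\<lambda>c. (src x, tgt y, c, sel x @ sel y))
     (filter (\<lambda>c. tgt x = src y \<and> trivial_word tab (lab x @ lab y @ inv_word ivt c)) B)) T)) T)"

definition saturate ::
    "rewrite_rules \<Rightarrow> nat list \<Rightarrow> nat list list \<Rightarrow> fact list \<Rightarrow> nat \<Rightarrow> fact list" where
  "saturate tab ivt B E n = fold (\<lambda>_ T. prune (T @ combine tab ivt B T)) (replicate n ())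
     (prune (initial_facts tab ivt B E))"

lemma lookup_eq: "lookup xs d j = (if j < length xs then xs ! j else d)"
  by (induction xs arbitrary: j) (auto split: nat.split)

lemma polyf_lookup:
  assumes "polyf f" shows "polyf (\<lambda>e. lookup xs d (f e))"
proof -
  have "polyf (lookup xs d)"
  proof (induction xs)
    case Nil
    show ?case unfolding lookup.simps by (intro polyf_intros)
  next
    case (Cons x xs)
    show ?case unfolding lookup.simps by (intro polyf_intros polyf_comp[OF Cons])
  qed
  from polyf_comp[OF this assms] show ?thesis .
qed

lemma polyf_inv_word: "polyf f \<Longrightarrow> polyf (\<lambda>e. inv_word ivt (f e))"
  unfolding inv_word_def by (intro polyf_intros polyf_lookup)

lemma polyf_cost: "polyf f \<Longrightarrow> polyf (\<lambda>e. cost (f e))"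
  unfolding cost_def by (intro polyf_intros)

lemma esize_filter: "esize (filter P xs) \<le> esize xs"
  by (induction xs) auto

lemma polyf_prune:
  assumes "polyf f" shows "polyf (\<lambda>e. prune (f e))"
proof -
  have "polyf (\<lambda>xs. fold insert_fact xs [])"
  proof (rule polyf_fold_additive[where q = "\<lambda>n. 1 + n"])
    show "polyf (\<lambda>p::fact list \<times> fact \<times> fact list. insert_fact (fst (snd p)) (snd (snd p)))"
      unfolding insert_fact_def same_key_def by (intro polyf_intros polyf_cost)
    fix xs and y :: fact and T :: "fact list" assume "y \<in> set xs"
    then show "esize (insert_fact y T) \<le> esize T + (1 + esize xs)"
      using esize_mem[of y xs] esize_filter[of "\<lambda>z. \<not> same_key y z" T] by (simp add: insert_fact_def)
  qed (intro polyf_intros poly_bounded_intros)+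
  then have "polyf prune" unfolding prune_def .
  from polyf_comp[OF this assms] show ?thesis .
qed

lemma polyf_initial_facts:
  "polyf B \<Longrightarrow> polyf E \<Longrightarrow> polyf (\<lambda>e. initial_facts tab ivt (B e) (E e))"
proof -
  have "polyf (\<lambda>p. initial_facts tab ivt (fst p) (snd p))"
    unfolding initial_facts_def by (intro polyf_intros polyf_trivial_word polyf_inv_word)
  then show "polyf B \<Longrightarrow> polyf E \<Longrightarrow> polyf (\<lambda>e. initial_facts tab ivt (B e) (E e))"
    by (rule polyf_comp2)
qed

lemma polyf_combine:
  "polyf B \<Longrightarrow> polyf T \<Longrightarrow> polyf (\<lambda>e. combine tab ivt (B e) (T e))"
proof -
  have "polyf (\<lambda>p. combine tab ivt (fst p) (snd p))"
    unfolding combine_def by (intro polyf_intros polyf_trivial_word polyf_inv_word)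
  then show "polyf B \<Longrightarrow> polyf T \<Longrightarrow> polyf (\<lambda>e. combine tab ivt (B e) (T e))"
    by (rule polyf_comp2)
qed

text \<open>Edges lead upwards and carry at most one decision, so a selection is no longer than the
  difference of its ends. This bounds the size of facts independently of the number of
  rounds.\<close>

definition bounded_facts :: "nat \<Rightarrow> nat list list \<Rightarrow> fact list \<Rightarrow> bool" where
  "bounded_facts N B T \<longleftrightarrow>
     (\<forall>x\<in>set T. tgt x \<le> N \<and> lab x \<in> set B \<and> src x + length (sel x) \<le> tgt x)"

lemma set_insert_fact: "set (insert_fact x T) \<subseteq> insert x (set T)"
  by (auto simp: insert_fact_def)

lemma set_prune: "set (prune xs) \<subseteq> set xs"
proof -
  have "set (fold insert_fact xs T) \<subseteq> set xs \<union> set T" for T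
  proof (induction xs arbitrary: T)
    case (Cons x xs)
    then show ?case using Cons[of "insert_fact x T"] set_insert_fact[of x T] by auto
  qed simp
  then show ?thesis unfolding prune_def by (metis Un_empty_right list.set(1))
qed

definition key :: "fact \<Rightarrow> nat \<times> nat \<times> nat list" where "key x = (src x, tgt x, lab x)"

lemma same_key_iff: "same_key x y \<longleftrightarrow> key x = key y"
  by (simp add: same_key_def key_def)

lemma distinct_prune: "distinct (map key (prune xs))"
proof -
  have "distinct (map key (insert_fact x T))" if "distinct (map key T)" for x T
    using that by (auto simp add: insert_fact_def same_key_iff distinct_map_filter simp del: split_paired_All split_paired_Ex)
  then have "distinct (map key (fold insert_fact xs T))" if "distinct (map key T)" for T
    using that by (induction xs arbitrary: T) auto
  then show ?thesis unfolding prune_def by simp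
qed

lemma set_initial_facts: "x \<in> set (initial_facts tab ivt B E) \<longleftrightarrow>
    (\<exists>y\<in>set E. \<exists>c\<in>set B. trivial_word tab (lab y @ inv_word ivt c) \<and> x = (src y, tgt y, c, sel y))"
  unfolding initial_facts_def by (simp del: split_paired_Ex split_paired_All) blast

lemma set_combine: "x \<in> set (combine tab ivt B T) \<longleftrightarrow>
    (\<exists>y\<in>set T. \<exists>z\<in>set T. \<exists>c\<in>set B. tgt y = src z \<and> trivial_word tab (lab y @ lab z @ inv_word ivt c) \<and>
       x = (src y, tgt z, c, sel y @ sel z))"
  unfolding combine_def by (simp del: split_paired_Ex split_paired_All) blast

lemma bounded_initial_facts:
  assumes "\<And>x. x \<in> set E \<Longrightarrow> tgt x \<le> N \<and> src x + length (sel x) \<le> tgt x"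
  shows "bounded_facts N B (initial_facts tab ivt B E)"
  unfolding bounded_facts_def
proof
  fix x assume "x \<in> set (initial_facts tab ivt B E)"
  then obtain y c where "y \<in> set E" "c \<in> set B" "x = (src y, tgt y, c, sel y)"
    unfolding set_initial_facts by blast
  then show "tgt x \<le> N \<and> lab x \<in> set B \<and> src x + length (sel x) \<le> tgt x"
    using assms[of y] by simp
qed

lemma bounded_combine:
  assumes "bounded_facts N B T"
  shows "bounded_facts N B (combine tab ivt B T)"
  unfolding bounded_facts_def
proof
  fix x assume "x \<in> set (combine tab ivt B T)"
  then obtain y z c where "y \<in> set T" "z \<in> set T" "c \<in> set B" "tgt y = src z"
    "x = (src y, tgt z, c, sel y @ sel z)"
    unfolding set_combine by blast
  moreover from this have "src y + length (sel y) \<le> tgt y" "tgt z \<le> N" "src z + length (sel z) \<le> tgt z"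
    using assms unfolding bounded_facts_def by blast+
  ultimately show "tgt x \<le> N \<and> lab x \<in> set B \<and> src x + length (sel x) \<le> tgt x"
    by simp
qed

lemma bounded_prune: "bounded_facts N B T \<Longrightarrow> bounded_facts N B (prune T)"
  using set_prune[of T] by (auto simp: bounded_facts_def)

lemma saturate_Suc:
  "saturate tab ivt B E (Suc n) = prune (saturate tab ivt B E n @ combine tab ivt B (saturate tab ivt B E n))"
proof -
  have "replicate (Suc n) () = replicate n () @ [()]" by (simp add: replicate_append_same)
  then show ?thesis unfolding saturate_def by simp
qed

lemma saturate_bounded:
  assumes "\<And>x. x \<in> set E \<Longrightarrow> tgt x \<le> N \<and> src x + length (sel x) \<le> tgt x"
  shows "bounded_facts N B (saturate tab ivt B E n) \<and> distinct (map key (saturate tab ivt B E n))"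
proof (induction n)
  case 0
  have "bounded_facts N B (initial_facts tab ivt B E)" by (rule bounded_initial_facts) (rule assms)
  then show ?case using bounded_prune distinct_prune by (simp add: saturate_def)
next
  case (Suc n)
  let ?T = "saturate tab ivt B E n"
  have "bounded_facts N B (?T @ combine tab ivt B ?T)"
    using conjunct1[OF Suc] bounded_combine[OF conjunct1[OF Suc], of tab ivt]
    unfolding bounded_facts_def by (simp del: split_paired_All split_paired_Ex) blast
  then show ?case unfolding saturate_Suc using bounded_prune distinct_prune by blast
qed

lemma bounded_facts_size:
  assumes T: "bounded_facts N B T" "distinct (map key T)"
  shows "esize T \<le> (N + 1) * (N + 1) * esize B * (10 + 8 * N + esize B) + 1"
proof -
  have "esize x \<le> 9 + 8 * N + esize B" if "x \<in> set T" for x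
  proof -
    have x: "tgt x \<le> N" "src x \<le> N" "length (sel x) \<le> N" "lab x \<in> set B"
      using T(1) that by (auto simp: bounded_facts_def)
    have "esize b \<le> 3" for b :: bool by (cases b) auto
    from esize_list_le[of "sel x", OF this] have "esize (sel x) \<le> length (sel x) * 4 + 1" by simp
    moreover have "esize x = esize (src x, tgt x, lab x, sel x)" by simp
    ultimately show ?thesis using x esize_mem[OF x(4)] by (simp add: esize_nat del: prod.collapse)
  qed
  from esize_list_le[of T, OF this] have 1: "esize T \<le> length T * (10 + 8 * N + esize B) + 1"
    by (simp add: add.assoc)
  have "length T = card (set (map key T))" using distinct_card[OF T(2)] by simp
  also have "\<dots> \<le> card ({..N} \<times> {..N} \<times> set B)"
  proof (rule card_mono)
    show "set (map key T) \<subseteq> {..N} \<times> {..N} \<times> set B"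
      using T(1) by (fastforce simp: bounded_facts_def key_def)
  qed simp
  also have "\<dots> = (N + 1) * (N + 1) * card (set B)"
    by (simp add: card_cartesian_product algebra_simps)
  also have "\<dots> \<le> (N + 1) * (N + 1) * esize B"
    using order_trans[OF card_length length_le_esize, of B] by (rule mult_left_mono) simp
  finally have "length T * (10 + 8 * N + esize B) \<le> (N + 1) * (N + 1) * esize B * (10 + 8 * N + esize B)"
    by (rule mult_right_mono) simp
  then show ?thesis using 1 by linarith
qed

lemma polyf_saturate:
  assumes B: "polyf B" and E: "polyf E" and n: "polyf n" and N: "polyf N"
    and bnd: "\<And>e x. x \<in> set (E e) \<Longrightarrow> tgt x \<le> N e \<and> src x + length (sel x) \<le> tgt x"
  shows "polyf (\<lambda>e. saturate tab ivt (B e) (E e) (n e))"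
proof -
  obtain dB where dB: "\<And>e. esize (B e) \<le> (esize e + 2) ^ dB" using polyf_size[OF B] by blast
  obtain dN where dN: "\<And>e. esize (N e) \<le> (esize e + 2) ^ dN" using polyf_size[OF N] by blast
  let ?S = "\<lambda>N B. (N + 1) * (N + 1) * B * (10 + 8 * N + B) + (1 :: nat)"
  show ?thesis unfolding saturate_def
  proof (rule polyf_fold)
    show "polyf (\<lambda>p. prune (snd (snd p) @ combine tab ivt (B (fst p)) (snd (snd p))))"
      by (intro polyf_prune polyf_append polyf_combine polyf_basic polyf_comp[OF B])
    show "polyf (\<lambda>e. replicate (n e) ())" by (rule polyf_comp[OF polyf_replicate_unit n])
    show "polyf (\<lambda>e. prune (initial_facts tab ivt (B e) (E e)))"
      by (intro polyf_prune polyf_initial_facts B E)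
    show "poly_bounded (\<lambda>k. ?S ((k + 2) ^ dN) ((k + 2) ^ dB))" by (intro poly_bounded_intros)
    fix e ys zs assume "replicate (n e) () = ys @ zs"
    then have ys: "ys = replicate (length ys) ()" by (simp add: replicate_length_unit)
    have "N e \<le> (esize e + 2) ^ dN" using dN[of e] by (simp add: esize_nat)
    have "esize (saturate tab ivt (B e) (E e) (length ys)) \<le> ?S (N e) (esize (B e))"
      using bounded_facts_size saturate_bounded bnd by blast
    also have "\<dots> \<le> ?S ((esize e + 2) ^ dN) ((esize e + 2) ^ dB)"
      using \<open>N e \<le> _\<close> dB[of e] by (intro add_mono mult_mono order_refl) auto
    finally show "esize (fold (\<lambda>_ T. prune (T @ combine tab ivt (B e) T)) ys
       (prune (initial_facts tab ivt (B e) (E e)))) \<le> ?S ((esize e + 2) ^ dN) ((esize e + 2) ^ dB)"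
      unfolding saturate_def ys[symmetric] .
  qed
qed

section \<open>The graph of an instance\<close>

text \<open>Current vertex, vertex at which the word being read began, edges. The second one is
  where the edge that skips this word has to start.\<close>

type_synonym graph = "nat \<times> nat \<times> fact list"

definition letter_edge :: "nat list \<Rightarrow> graph \<Rightarrow> graph" where
  "letter_edge a st = (Suc (fst st), fst (snd st), (fst st, Suc (fst st), a, []) # snd (snd st))"

definition sep_edges :: "graph \<Rightarrow> graph" where
  "sep_edges st = (Suc (fst st), Suc (fst st), (fst st, Suc (fst st), [], [True]) #
     (fst (snd st), Suc (fst st), [], [False]) # snd (snd st))"

text \<open>Saturation records nonempty paths only. The additional edge with empty label keeps the
  target apart from the source 0 even if all words are empty.\<close>

definition start_edge :: "graph \<Rightarrow> graph" where
  "start_edge st = (Suc (fst st), Suc (fst st), (fst st, Suc (fst st), [], []) # snd (snd st))"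

definition read_token :: "nat list list \<Rightarrow> nat \<Rightarrow> graph \<Rightarrow> graph" where
  "read_token tr t st = (case t of 0 \<Rightarrow> sep_edges st | Suc j \<Rightarrow> letter_edge (lookup tr [] j) st)"

text \<open>A separator discards what has been collected, because only the end of the input reveals
  which word was the last one. Prepending reverses the order of the letters, as inversion
  demands.\<close>

definition last_inverse :: "nat list list \<Rightarrow> nat list \<Rightarrow> nat list \<Rightarrow> nat list list" where
  "last_inverse tr ivt u =
     fold (\<lambda>t w. case t of 0 \<Rightarrow> [] | Suc j \<Rightarrow> inv_word ivt (lookup tr [] j) # w) u []"

text \<open>The letters of g after the last separator are read like all others and form a tail
  behind the vertex where the sought paths end; edges lead upwards, so no such path enters the
  tail.\<close>

definition graph_of :: "nat list list \<Rightarrow> nat list \<Rightarrow> nat list \<Rightarrow> graph" where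
  "graph_of tr ivt u =
     fold (read_token tr) u (start_edge (fold letter_edge (last_inverse tr ivt u) (0, 0, [])))"

text \<open>Each token adds one vertex, so the vertex numbers, though written in unary, stay linear
  and the edge list at most quadratic.\<close>

lemma fold_graph:
  assumes "\<And>t st. t \<in> set ys \<Longrightarrow> fst (snd st) \<le> fst st \<Longrightarrow>
      fst (g t st) = Suc (fst st) \<and> fst (snd (g t st)) \<le> fst (g t st) \<and>
      esize (g t st) \<le> esize st + (12 * fst st + W)"
    and "fst (snd st) \<le> fst st"
  shows "fst (fold g ys st) = fst st + length ys \<and> fst (snd (fold g ys st)) \<le> fst (fold g ys st) \<and>
     esize (fold g ys st) \<le> esize st + length ys * (12 * (fst st + length ys) + W)"
  using assms
proof (induction ys rule: rev_induct)
  case (snoc y ys)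
  let ?s = "fold g ys st"
  have IH: "fst ?s = fst st + length ys" "fst (snd ?s) \<le> fst ?s"
     "esize ?s \<le> esize st + length ys * (12 * (fst st + length ys) + W)"
    using snoc.IH[OF snoc.prems(1) snoc.prems(2)] by auto
  have g: "fst (g y ?s) = Suc (fst ?s) \<and> fst (snd (g y ?s)) \<le> fst (g y ?s) \<and>
      esize (g y ?s) \<le> esize ?s + (12 * fst ?s + W)"
    by (rule snoc.prems(1)) (use IH in auto)
  have "esize (g y ?s) \<le> esize st + (length ys * (12 * (fst st + length ys) + W) + (12 * (fst st + length ys) + W))"
  proof -
    have "esize (g y ?s) \<le> esize ?s + (12 * (fst st + length ys) + W)" using g IH(1) by simp
    from order_trans[OF this add_right_mono[OF IH(3)]] show ?thesis by (simp only: add.assoc)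
  qed
  also have "\<dots> \<le> esize st + Suc (length ys) * (12 * (fst st + Suc (length ys)) + W)"
    by (simp add: algebra_simps)
  finally show ?case using g IH by simp
qed simp

lemma letter_edge_size:
  assumes "fst (snd st) \<le> fst st" "esize a + 60 \<le> W"
  shows "fst (letter_edge a st) = Suc (fst st) \<and> fst (snd (letter_edge a st)) \<le> fst (letter_edge a st) \<and>
      esize (letter_edge a st) \<le> esize st + (12 * fst st + W)"
  using assms by (cases st) (auto simp: letter_edge_def esize_nat)

lemma esize_lookup: "esize (lookup xs d j) \<le> esize xs + esize d"
  unfolding lookup_eq using esize_mem[of "xs ! j" xs] by (simp add: trans_le_add1)

lemma read_token_size:
  assumes "fst (snd st) \<le> fst st" "esize tr + 61 \<le> W"
  shows "fst (read_token tr t st) = Suc (fst st) \<and> fst (snd (read_token tr t st)) \<le> fst (read_token tr t st) \<and>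
      esize (read_token tr t st) \<le> esize st + (12 * fst st + W)"
proof (cases t)
  case 0
  then show ?thesis using assms by (cases st) (auto simp: read_token_def sep_edges_def esize_nat)
next
  case (Suc j)
  have "esize (lookup tr [] j) + 60 \<le> W" using esize_lookup[of tr "[]" j] assms(2) by simp
  from letter_edge_size[OF assms(1) this] show ?thesis by (simp add: Suc read_token_def)
qed

lemma polyf_last_inverse: "polyf (\<lambda>u. last_inverse tr ivt u)"
proof -
  let ?h = "\<lambda>(u :: nat list) t. inv_word ivt (lookup tr [] (t - 1))"
  have "polyf (\<lambda>p. ?h (fst p) (snd p))"
    by (intro polyf_inv_word polyf_lookup polyf_diff polyf_basic)
  from polyf_elem_size[OF this polyf_id] obtain q where
    q: "poly_bounded q" "\<And>u t. t \<in> set u \<Longrightarrow> esize (?h u t) \<le> q (esize u)" by blast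
  show ?thesis unfolding last_inverse_def
  proof (rule polyf_fold_additive[where q = "\<lambda>n. 1 + q n"])
    show "polyf (\<lambda>p::nat list \<times> nat \<times> nat list list. case fst (snd p) of 0 \<Rightarrow> []
        | Suc j \<Rightarrow> inv_word ivt (lookup tr [] j) # snd (snd p))"
      by (intro polyf_intros polyf_inv_word polyf_lookup)
    fix u :: "nat list" and t and w :: "nat list list" assume "t \<in> set u"
    from q(2)[OF this] show "esize (case t of 0 \<Rightarrow> [] | Suc j \<Rightarrow> inv_word ivt (lookup tr [] j) # w)
       \<le> esize w + (1 + q (esize u))"
      by (cases t) (auto simp: Suc_le_eq)
  qed (intro polyf_intros poly_bounded_intros q)+
qed

lemma polyf_graph_of: "polyf (\<lambda>u. graph_of tr ivt u)"
proof -
  obtain d where d: "\<And>u. esize (last_inverse tr ivt u) \<le> (esize u + 2) ^ d"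
    using polyf_size[OF polyf_last_inverse] by blast
  let ?T1 = "\<lambda>L. 5 + L * (12 * L + (L + (60 :: nat)))"
  let ?first = "\<lambda>u. fold letter_edge (last_inverse tr ivt u) (0, 0, [])"
  have first: "fst (fold letter_edge ys (0, 0, [])) = length ys \<and>
      fst (snd (fold letter_edge ys (0, 0, []))) \<le> fst (fold letter_edge ys (0, 0, [])) \<and>
     esize (fold letter_edge ys (0, 0, [])) \<le> ?T1 L" if ys: "esize xs \<le> L" "xs = ys @ zs" for ys L xs zs
  proof -
    have l: "length ys \<le> L" using ys length_le_esize[of xs] by simp
    have "esize a + 60 \<le> L + 60" if "a \<in> set ys" for a
      using ys esize_mem[of a xs] that by simp
    then have h: "fst (letter_edge t st) = Suc (fst st) \<and> fst (snd (letter_edge t st)) \<le> fst (letter_edge t st) \<and>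
        esize (letter_edge t st) \<le> esize st + (12 * fst st + (L + 60))"
      if "t \<in> set ys" "fst (snd st) \<le> fst st" for t st
      using letter_edge_size[OF that(2)] that(1) by blast
    have "fst (fold letter_edge ys (0, 0, [])) = 0 + length ys \<and>
      fst (snd (fold letter_edge ys (0, 0, []))) \<le> fst (fold letter_edge ys (0, 0, [])) \<and>
      esize (fold letter_edge ys (0, 0, [])) \<le> esize (0::nat, 0::nat, [] :: fact list) + length ys * (12 * (0 + length ys) + (L + 60))"
      using fold_graph[of ys letter_edge "L + 60" "(0, 0, [])", OF h] by simp
    moreover have "length ys * (12 * (0 + length ys) + (L + 60)) \<le> L * (12 * L + (L + 60))"
      using l by (intro mult_mono add_mono) auto
    ultimately show ?thesis by simp
  qed
  have P1: "polyf ?first"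
  proof (rule polyf_fold)
    show "polyf (\<lambda>p::nat list \<times> nat list \<times> graph. letter_edge (fst (snd p)) (snd (snd p)))"
      unfolding letter_edge_def by (intro polyf_intros)
    show "poly_bounded (\<lambda>n. ?T1 ((n + 2) ^ d))" by (intro poly_bounded_intros)
    show "polyf (\<lambda>u. last_inverse tr ivt u)" by (rule polyf_last_inverse)
    show "polyf (\<lambda>u::nat list. (0::nat, 0::nat, [] :: fact list))" by (intro polyf_intros)
    fix u ys zs assume "last_inverse tr ivt u = ys @ zs"
    from first[OF d this] show "esize (fold letter_edge ys (0, 0, [])) \<le> ?T1 ((esize u + 2) ^ d)" by simp
  qed
  let ?W = "esize tr + 61"
  have P2: "polyf (\<lambda>u. start_edge (?first u))"
    unfolding start_edge_def by (intro polyf_intros P1)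
  obtain d2 where d2: "\<And>u. esize (start_edge (?first u)) \<le> (esize u + 2) ^ d2"
    using polyf_size[OF P2] by blast
  let ?B = "\<lambda>n. (n + 2) ^ d2 + n * (12 * ((n + 2) ^ d2 + n) + ?W)"
  show ?thesis unfolding graph_of_def
  proof (rule polyf_fold)
    show "polyf (\<lambda>p::nat list \<times> nat \<times> graph. read_token tr (fst (snd p)) (snd (snd p)))"
      unfolding read_token_def sep_edges_def letter_edge_def by (intro polyf_intros polyf_lookup)
    show "polyf (\<lambda>u. u)" by (rule polyf_id)
    show "polyf (\<lambda>u. start_edge (?first u))" by (rule P2)
    show "poly_bounded ?B" by (intro poly_bounded_intros)
    fix u ys zs :: "nat list" assume u: "u = ys @ zs"
    let ?s = "start_edge (?first u)"
    have s: "fst (snd ?s) \<le> fst ?s" by (simp add: start_edge_def)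
    have "fst ?s \<le> esize ?s" by (cases ?s) (simp add: esize_nat)
    with d2[of u] have s2: "fst ?s \<le> (esize u + 2) ^ d2" by linarith
    have l: "length ys \<le> esize u" using length_le_esize[of u] u by simp
    have "esize (fold (read_token tr) ys ?s) \<le> esize ?s + length ys * (12 * (fst ?s + length ys) + ?W)"
      using fold_graph[of ys "read_token tr" ?W ?s] read_token_size s by blast
    also have "\<dots> \<le> ?B (esize u)"
      using l s2 d2[of u] by (intro add_mono mult_mono) auto
    finally show "esize (fold (read_token tr) ys ?s) \<le> ?B (esize u)" .
  qed
qed

text \<open>The label \<open>[]\<close> expresses that the path has value 1. The rounds are as many
  as the highest vertex number, which bounds the length of every path.\<close>

definition solutions ::
    "rewrite_rules \<Rightarrow> nat list \<Rightarrow> nat list list \<Rightarrow> nat \<Rightarrow> nat \<Rightarrow> nat \<Rightarrow> nat list \<Rightarrow> bool list list" where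
  "solutions tab ivt tr m K C u =
     map sel (filter (\<lambda>x. src x = 0 \<and> tgt x = fst (snd (graph_of tr ivt u)) \<and> lab x = [])
       (saturate tab ivt (snd (log_ball m K C u)) (snd (snd (graph_of tr ivt u))) (fst (graph_of tr ivt u))))"

lemma graph_fold_invariant: "P s \<Longrightarrow> (\<And>x s. P s \<Longrightarrow> P (f x s)) \<Longrightarrow> P (fold f xs s)"
  by (induction xs arbitrary: s) auto

lemma graph_of_edges:
  assumes "x \<in> set (snd (snd (graph_of tr ivt u)))"
  shows "tgt x \<le> fst (graph_of tr ivt u)" "src x < tgt x" "length (sel x) \<le> 1"
proof -
  let ?P = "\<lambda>st::graph. fst (snd st) \<le> fst st \<and>
     (\<forall>x\<in>set (snd (snd st)). tgt x \<le> fst st \<and> src x < tgt x \<and> length (sel x) \<le> 1)"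
  have "?P (graph_of tr ivt u)" unfolding graph_of_def
  proof (rule graph_fold_invariant)
    have l: "?P (letter_edge a st)" if "?P st" for a st
      using that by (auto simp: letter_edge_def simp del: split_paired_All)
    have "?P (fold letter_edge (last_inverse tr ivt u) (0, 0, []))"
      by (rule graph_fold_invariant[where P = ?P, OF _ l]) auto
    then show "?P (start_edge (fold letter_edge (last_inverse tr ivt u) (0, 0, [])))"
      by (auto simp: start_edge_def simp del: split_paired_All)
    show "?P (read_token tr t st)" if "?P st" for t st
    proof (cases t)
      case 0
      then show ?thesis using that by (auto simp: read_token_def sep_edges_def simp del: split_paired_All)
    next
      case (Suc j)
      then show ?thesis using l[OF that] by (simp add: read_token_def)
    qed
  qed
  then show "tgt x \<le> fst (graph_of tr ivt u)" "src x < tgt x" "length (sel x) \<le> 1" using assms by auto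
qed

lemma polyf_solutions: "polyf (\<lambda>u. solutions tab ivt tr m K C u)"
proof -
  have "polyf (\<lambda>u. saturate tab ivt (snd (log_ball m K C u)) (snd (snd (graph_of tr ivt u)))
      (fst (graph_of tr ivt u)))"
  proof (rule polyf_saturate)
    fix u x assume "x \<in> set (snd (snd (graph_of tr ivt u)))"
    from graph_of_edges[OF this]
    show "tgt x \<le> fst (graph_of tr ivt u) \<and> src x + length (sel x) \<le> tgt x" by simp
  qed (intro polyf_basic polyf_log_ball polyf_graph_of)+
  then show ?thesis unfolding solutions_def
    by (intro polyf_intros polyf_comp[OF polyf_graph_of])
qed

section \<open>Correctness of the saturation\<close>

lemma rewrite_head_cases:
  "(rewrite_head tab w d = d \<and> (\<forall>r\<in>set tab. take (length (fst r)) w \<noteq> fst r)) \<or>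
   (\<exists>r\<in>set tab. \<exists>x. w = fst r @ x \<and> rewrite_head tab w d = snd r @ x)"
proof (induction tab)
  case (Cons r tab)
  show ?case
  proof (cases "take (length (fst r)) w = fst r")
    case True
    then have "w = fst r @ drop (length (fst r)) w" by (metis append_take_drop_id)
    moreover have "rewrite_head (r # tab) w d = snd r @ drop (length (fst r)) w"
      using True by (simp add: strip_prefix_eq)
    ultimately show ?thesis by (metis list.set_intros(1))
  next
    case False
    then have "rewrite_head (r # tab) w d = rewrite_head tab w d" by (simp add: strip_prefix_eq)
    then show ?thesis using Cons False by (metis list.set_intros(2) set_ConsD)
  qed
qed simp

lemma shorten_Cons_cases:
  obtains "shorten tab (a # w) = a # shorten tab w" "\<forall>r\<in>set tab. take (length (fst r)) (a # w) \<noteq> fst r"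
  | u u' x where "(u, u') \<in> set tab" "a # w = u @ x" "shorten tab (a # w) = u' @ x"
proof -
  from rewrite_head_cases[of tab "a # w" "a # shorten tab w"] show thesis
  proof
    assume "\<exists>r\<in>set tab. \<exists>x. a # w = fst r @ x \<and> rewrite_head tab (a # w) (a # shorten tab w) = snd r @ x"
    then obtain r x where "r \<in> set tab" "a # w = fst r @ x" "shorten tab (a # w) = snd r @ x"
      unfolding shorten.simps by blast
    then show thesis using that(2)[of "fst r" "snd r" x] by simp
  qed (use that(1) in simp)
qed

section \<open>Dehn's algorithm decides the word problem\<close>

locale dehn = hyperbolic_word_group +
  fixes h :: nat and tab :: rewrite_rules
  assumes h: "2 * \<delta> < real h"
    and sound: "\<And>u u'. (u, u') \<in> set tab \<Longrightarrow> u' \<in> lists {..<m} \<and> ev u' = ev u \<and> length u' < length u"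
    and complete: "\<And>u. u \<in> lists {..<m} \<Longrightarrow> length u \<le> 4 * h \<Longrightarrow> nrm (ev u) < length u \<Longrightarrow>
      \<exists>u'. (u, u') \<in> set tab"
begin

lemma shorten:
  "w \<in> lists {..<m} \<Longrightarrow> shorten tab w \<in> lists {..<m} \<and> ev (shorten tab w) = ev w \<and>
     length (shorten tab w) \<le> length w"
proof (induction w)
  case (Cons a w)
  then have IH: "shorten tab w \<in> lists {..<m}" "ev (shorten tab w) = ev w"
     "length (shorten tab w) \<le> length w" by auto
  show ?case
  proof (cases rule: shorten_Cons_cases[of tab a w])
    case 1
    then show ?thesis using IH Cons.prems by simp
  next
    case (2 u u' x)
    have "x \<in> lists {..<m}" using Cons.prems 2(2) by (metis append_in_lists_conv)
    moreover have "ev (a # w) = ev u \<otimes> ev x" unfolding 2(2) by (rule ev_append)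
    moreover have "length (a # w) = length u + length x" unfolding 2(2) by simp
    ultimately show ?thesis unfolding 2(3) using sound[OF 2(1)] by (simp add: ev_append)
  qed
qed simp

text \<open>If the first letter is kept, no rule matches at the head; so the occurrence of
  \<open>u\<close> lies in the tail, where the induction hypothesis applies.\<close>

lemma shorten_less:
  "(u, u') \<in> set tab \<Longrightarrow> w \<in> lists {..<m} \<Longrightarrow> w = a @ u @ b \<Longrightarrow> length (shorten tab w) < length w"
proof (induction w arbitrary: a)
  case Nil
  then show ?case using sound[of u u'] by simp
next
  case (Cons c w)
  show ?case
  proof (cases rule: shorten_Cons_cases[of tab c w])
    case 1
    have "a \<noteq> []"
    proof
      assume "a = []"
      then have "take (length u) (c # w) = u" using Cons.prems(3) by simp
      then show False using 1(2) Cons.prems(1) by force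
    qed
    then obtain a' where "w = a' @ u @ b" using Cons.prems(3) by (cases a) auto
    then show ?thesis using Cons.IH[OF Cons.prems(1)] Cons.prems(2) 1(1) by simp
  next
    case (2 r r' x)
    then have "length (c # w) = length r + length x" by (metis length_append)
    then show ?thesis unfolding 2(3) using sound[OF 2(1)] by simp
  qed
qed

lemma trivial_word:
  assumes w: "w \<in> lists {..<m}"
  shows "trivial_word tab w \<longleftrightarrow> ev w = \<one>"
proof -
  have inv: "fold (\<lambda>_. shorten tab) xs w \<in> lists {..<m} \<and> ev (fold (\<lambda>_. shorten tab) xs w) = ev w" for xs :: "nat list"
    by (induction xs rule: rev_induct) (use w shorten in auto)
  \<comment> \<open>A nonempty word of value 1 contains a short non-geodesic subword, which is the
    left-hand side of a rule; so a letter disappears in each round.\<close>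
  have "length (fold (\<lambda>_. shorten tab) xs w) \<le> length w - length xs" if one: "ev w = \<one>" for xs :: "nat list"
  proof (induction xs rule: rev_induct)
    case (snoc x xs)
    let ?w = "fold (\<lambda>_. shorten tab) xs w"
    show ?case
    proof (cases "?w = []")
      case True
      then show ?thesis by simp
    next
      case False
      obtain a u b where u: "?w = a @ u @ b" "length u \<le> 4 * h" "nrm (ev u) < length u"
        using non_geodesic_subword[of ?w h, OF _ False _ h] inv[of xs] one by auto
      have "u \<in> lists {..<m}" using inv[of xs] u(1) by (metis append_in_lists_conv)
      then obtain u' where "(u, u') \<in> set tab" using complete u by blast
      from shorten_less[OF this _ u(1)] inv[of xs] have "length (shorten tab ?w) < length ?w" by blast
      then show ?thesis using snoc by simp
    qed
  qed simp
  from this[of w] inv[of w] show ?thesis unfolding trivial_word_def by force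
qed

abbreviation ivt :: "nat list" where "ivt \<equiv> map iv [0..<m]"

lemma inv_word: "w \<in> lists {..<m} \<Longrightarrow> inv_word ivt w = winv w"
  unfolding inv_word_def winv_def lookup_eq by (simp add: in_lists_conv_set)

lemma trivial_quotient:
  assumes "w \<in> lists {..<m}" "c \<in> lists {..<m}"
  shows "trivial_word tab (w @ inv_word ivt c) \<longleftrightarrow> ev w = ev c"
proof -
  have "trivial_word tab (w @ inv_word ivt c) \<longleftrightarrow> ev w \<otimes> inv (ev c) = \<one>"
    using assms winv_lists[OF assms(2)] trivial_word[of "w @ inv_word ivt c"]
    by (simp add: inv_word ev_append ev_winv)
  also have "\<dots> \<longleftrightarrow> ev w = ev c"
    using inv_equality[of "ev w" "inv (ev c)"] by auto
  finally show ?thesis .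
qed

section \<open>Paths and the facts that represent them\<close>

fun path :: "fact list \<Rightarrow> nat \<Rightarrow> fact list \<Rightarrow> nat \<Rightarrow> bool" where
  "path E i [] j \<longleftrightarrow> i = j"
| "path E i (x # xs) j \<longleftrightarrow> x \<in> set E \<and> src x = i \<and> path E (tgt x) xs j"

definition pval :: "fact list \<Rightarrow> 'a" where "pval xs = ev (concat (map lab xs))"

definition pout :: "fact list \<Rightarrow> bool list" where "pout xs = concat (map sel xs)"

lemma pval_simps [simp]: "pval [] = \<one>" "pval (x # xs) = ev (lab x) \<otimes> pval xs"
  "pval (xs @ ys) = pval xs \<otimes> pval ys" "pval xs \<in> carrier G"
  by (simp_all add: pval_def ev_append)

lemma pout_simps [simp]: "pout [] = []" "pout (x # xs) = sel x @ pout xs"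
  "pout (xs @ ys) = pout xs @ pout ys"
  by (simp_all add: pout_def)

lemma path_append: "path E i (xs @ ys) j \<longleftrightarrow> (\<exists>k. path E i xs k \<and> path E k ys j)"
  by (induction xs arbitrary: i) auto

lemma cost_append [simp]: "cost (xs @ ys) = cost xs + cost ys"
  by (simp add: cost_def)

lemma insert_fact_cover:
  "y = x \<or> y \<in> set T \<Longrightarrow> \<exists>z\<in>set (insert_fact x T). key z = key y \<and> cost (sel z) \<le> cost (sel y)"
  by (auto simp: insert_fact_def same_key_iff simp del: split_paired_All split_paired_Ex)

text \<open>A fact that is rejected or displaced leaves behind one with the same key and no greater
  cost; this relation is transitive along the fold, whose accumulator has to be generalised.\<close>

lemma prune_cover:
  assumes "x \<in> set xs"
  shows "\<exists>z\<in>set (prune xs). key z = key x \<and> cost (sel z) \<le> cost (sel x)"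
proof -
  have "\<exists>z\<in>set (fold insert_fact xs T). key z = key x \<and> cost (sel z) \<le> cost (sel x)"
    if "x \<in> set xs \<union> set T" for T
    using that
  proof (induction xs arbitrary: T x)
    case (Cons y xs)
    show ?case
    proof (cases "x \<in> set xs")
      case True
      then show ?thesis using Cons.IH[of x "insert_fact y T"] by simp
    next
      case False
      then have "x = y \<or> x \<in> set T" using Cons.prems by auto
      from insert_fact_cover[OF this] obtain z where z: "z \<in> set (insert_fact y T)" "key z = key x" "cost (sel z) \<le> cost (sel x)" by blast
      then show ?thesis using Cons.IH[of z "insert_fact y T"] by force
    qed
  qed auto
  then show ?thesis using assms unfolding prune_def by blast
qed

lemma saturate_sound:
  assumes E: "\<And>x. x \<in> set E \<Longrightarrow> lab x \<in> lists {..<m}" and B: "set B \<subseteq> lists {..<m}"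
    and "x \<in> set (saturate tab ivt B E n)"
  shows "lab x \<in> set B \<and> (\<exists>xs. path E (src x) xs (tgt x) \<and> ev (lab x) = pval xs \<and> sel x = pout xs)"
  using assms(3)
proof (induction n arbitrary: x)
  case 0
  then have "x \<in> set (initial_facts tab ivt B E)" using set_prune by (auto simp: saturate_def)
  then obtain y c where y: "y \<in> set E" "c \<in> set B" "trivial_word tab (lab y @ inv_word ivt c)"
      "x = (src y, tgt y, c, sel y)"
    unfolding set_initial_facts by blast
  then have "ev (lab y) = ev c" using trivial_quotient[OF E[OF y(1)], of c] B by blast
  then show ?case using y by (intro conjI exI[of _ "[y]"]) auto
next
  case (Suc n)
  let ?T = "saturate tab ivt B E n"
  have "x \<in> set ?T \<or> x \<in> set (combine tab ivt B ?T)"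
    using Suc.prems set_prune unfolding saturate_Suc by fastforce
  then show ?case
  proof
    assume "x \<in> set (combine tab ivt B ?T)"
    then obtain y z c where x: "y \<in> set ?T" "z \<in> set ?T" "c \<in> set B" "tgt y = src z"
      "trivial_word tab (lab y @ lab z @ inv_word ivt c)" "x = (src y, tgt z, c, sel y @ sel z)"
      unfolding set_combine by blast
    obtain ys zs where "lab y \<in> set B" "lab z \<in> set B"
       "path E (src y) ys (tgt y)" "ev (lab y) = pval ys" "sel y = pout ys"
       "path E (src z) zs (tgt z)" "ev (lab z) = pval zs" "sel z = pout zs"
      using Suc.IH[OF x(1)] Suc.IH[OF x(2)] by blast
    moreover from this have "ev (lab y @ lab z) = ev c"
      using trivial_quotient[of "lab y @ lab z" c] x B by auto
    ultimately show ?thesis using x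
      by (intro conjI exI[of _ "ys @ zs"]) (auto simp: path_append ev_append)
  qed (rule Suc.IH)
qed

text \<open>What one round has found remains available in later rounds up to improvement of the
  cost. This carries the facts for single edges forward.\<close>

lemma saturate_cover:
  assumes "x \<in> set (saturate tab ivt B E n)" "n \<le> k"
  shows "\<exists>z\<in>set (saturate tab ivt B E k). key z = key x \<and> cost (sel z) \<le> cost (sel x)"
  using assms(2)
proof (induction k rule: dec_induct)
  case base
  then show ?case using assms(1) by blast
next
  case (step k)
  then obtain z where z: "z \<in> set (saturate tab ivt B E k)" "key z = key x" "cost (sel z) \<le> cost (sel x)" by blast
  then have "z \<in> set (saturate tab ivt B E k @ combine tab ivt B (saturate tab ivt B E k))" by simp
  from prune_cover[OF this] obtain z' where "z' \<in> set (saturate tab ivt B E (Suc k))"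
    "key z' = key z" "cost (sel z') \<le> cost (sel z)"
    unfolding saturate_Suc by blast
  then show ?case using z(2,3) by (intro bexI[of _ z']) simp_all
qed

text \<open>The word \<open>c\<close> is arbitrary among those of the ball with the right value, so
  that the two parts can be treated with geodesic words of their own. A cut makes both parts
  strictly shorter, whence paths with n + 1 edges are covered after n rounds.\<close>

lemma saturate_complete:
  assumes E: "\<And>x. x \<in> set E \<Longrightarrow> lab x \<in> lists {..<m} \<and> nrm (ev (lab x)) \<le> c0"
    and B: "set B = {w \<in> lists {..<m}. length w \<le> L}"
    and L: "4 * \<delta> * real \<tau> + 3 * real c0 + 4 \<le> real L"
  shows "path E i xs j \<Longrightarrow> xs \<noteq> [] \<Longrightarrow> length xs \<le> Suc n \<Longrightarrow> length xs \<le> 2 ^ \<tau> \<Longrightarrow> nrm (pval xs) \<le> L \<Longrightarrow>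
    c \<in> set B \<Longrightarrow> ev c = pval xs \<Longrightarrow>
    \<exists>x\<in>set (saturate tab ivt B E n). key x = (i, j, c) \<and> cost (sel x) \<le> cost (pout xs)"
proof (induction "length xs" arbitrary: xs i j n c rule: less_induct)
  case less
  have BL: "set B \<subseteq> lists {..<m}" using B by blast
  show ?case
  proof (cases "length xs = 1")
    case True
    then obtain y where xs: "xs = [y]" by (metis One_nat_def length_0_conv length_Suc_conv)
    then have y: "y \<in> set E" "src y = i" "tgt y = j" "ev (lab y) = ev c" using less.prems by auto
    then have "trivial_word tab (lab y @ inv_word ivt c)"
      using trivial_quotient[of "lab y" c] E BL less.prems(6) by blast
    then have "(i, j, c, sel y) \<in> set (initial_facts tab ivt B E)"
      unfolding set_initial_facts using y less.prems(6) by blast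
    from prune_cover[OF this] obtain z where z: "z \<in> set (saturate tab ivt B E 0)"
        "key z = key (i, j, c, sel y)" "cost (sel z) \<le> cost (sel (i, j, c, sel y))"
      unfolding saturate_def replicate_0 fold_simps by blast
    from saturate_cover[OF z(1), of n] obtain x where x: "x \<in> set (saturate tab ivt B E n)"
      "key x = key z" "cost (sel x) \<le> cost (sel z)" by blast
    have "key x = (i, j, c)" using x(2) z(2) by (simp add: key_def)
    moreover have "cost (sel x) \<le> cost (pout xs)" using x(3) z(3) xs by simp
    ultimately show ?thesis using x(1) by blast
  next
    case False
    then have l: "2 \<le> length xs" using less.prems(2) by (cases xs) (auto simp: Suc_le_eq)
    \<comment> \<open>The values of the initial segments form a path in the group with steps of
      length at most \<open>c0\<close>, to which \<open>split_path\<close> applies.\<close>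
    define p where "p k = pval (take k xs)" for k
    have p: "p k \<in> carrier G" for k by (simp add: p_def)
    have pd: "gdist (p a) (p b) = real (nrm (pval (take (b - a) (drop a xs))))" if "a \<le> b" for a b
    proof -
      have "take b xs = take a xs @ take (b - a) (drop a xs)" using that by (metis le_add_diff_inverse take_add)
      then have "p b = p a \<otimes> pval (take (b - a) (drop a xs))" by (simp add: p_def)
      then show ?thesis using p by (simp add: gdist_def flip: m_assoc)
    qed
    have xE: "x \<in> set E" if "x \<in> set xs" for x
      using less.prems(1) that
    proof (induction xs arbitrary: i)
      case (Cons y ys) then show ?case by auto
    qed simp
    have step: "gdist (p k) (p (Suc k)) \<le> real c0" if "k < length xs" for k
    proof -
      have "take (Suc k - k) (drop k xs) = [xs ! k]" using that by (simp add: take_Suc_conv_app_nth hd_drop_conv_nth take_Suc)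
      then show ?thesis using pd[of k "Suc k"] E[OF xE[of "xs ! k"]] that by simp
    qed
    have "gdist (p 0) (p (length xs)) \<le> real L" using pd[of 0 "length xs"] less.prems(5) by simp
    from split_path[OF p l less.prems(4) step this] L
    obtain k where k: "0 < k" "k < length xs" "gdist (p 0) (p k) \<le> real L" "gdist (p k) (p (length xs)) \<le> real L" by blast
    let ?ys = "take k xs" and ?zs = "drop k xs"
    have n1: "nrm (pval ?ys) \<le> L" "nrm (pval ?zs) \<le> L" using k pd[of 0 k] pd[of k "length xs"] by auto
    obtain n' where n: "n = Suc n'" using less.prems(3) l by (cases n) auto
    obtain q where q: "path E i ?ys q" "path E q ?zs j"
      using less.prems(1) path_append[of E i ?ys ?zs j] by auto
    \<comment> \<open>Geodesic words for the two parts; their lengths are the norms just bounded by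
      \<open>L\<close>, so they belong to the ball.\<close>
    obtain a b where a: "a \<in> lists {..<m}" "length a = nrm (pval ?ys)" "ev a = pval ?ys"
      and b: "b \<in> lists {..<m}" "length b = nrm (pval ?zs)" "ev b = pval ?zs"
      using nrm_ex[of "pval ?ys"] nrm_ex[of "pval ?zs"] pval_simps(4) by metis
    have ab: "a \<in> set B" "b \<in> set B" using a b n1 B by auto
    have ly: "length ?ys < length xs" "length ?ys \<le> Suc n'" "length ?ys \<le> 2 ^ \<tau>" "?ys \<noteq> []"
    proof -
      have "length ?ys = k" using k(2) by simp
      then show "length ?ys < length xs" "length ?ys \<le> Suc n'" "length ?ys \<le> 2 ^ \<tau>" "?ys \<noteq> []"
        using k(1,2) less.prems(3,4) unfolding n by (linarith, linarith, linarith, auto)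
    qed
    obtain y where y: "y \<in> set (saturate tab ivt B E n')" "key y = (i, q, a)" "cost (sel y) \<le> cost (pout ?ys)"
      using less.hyps[OF ly(1) q(1) ly(4) ly(2) ly(3) n1(1) ab(1) a(3)] by blast
    have l: "length ?zs < length xs" "length ?zs \<le> Suc n'" "length ?zs \<le> 2 ^ \<tau>" "?zs \<noteq> []"
    proof -
      have "length ?zs = length xs - k" by simp
      then show "length ?zs < length xs" "length ?zs \<le> Suc n'" "length ?zs \<le> 2 ^ \<tau>" "?zs \<noteq> []"
        using k(1,2) less.prems(3,4) unfolding n by (linarith, linarith, linarith, auto)
    qed
    obtain z where z: "z \<in> set (saturate tab ivt B E n')" "key z = (q, j, b)" "cost (sel z) \<le> cost (pout ?zs)"
      using less.hyps[OF l(1) q(2) l(4) l(2) l(3) n1(2) ab(2) b(3)] by blast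
    have pv: "pval xs = pval ?ys \<otimes> pval ?zs" using pval_simps(3)[of ?ys ?zs] by simp
    have po: "pout xs = pout ?ys @ pout ?zs" using pout_simps(3)[of ?ys ?zs] by simp
    have "ev (a @ b) = ev c" using less.prems(7) a b pv by (simp add: ev_append)
    then have "trivial_word tab ((a @ b) @ inv_word ivt c)"
      using trivial_quotient[of "a @ b" c] a(1) b(1) BL less.prems(6) by auto
    then have "(i, j, c, sel y @ sel z) \<in> set (combine tab ivt B (saturate tab ivt B E n'))"
      unfolding set_combine using y(1,2) z(1,2) less.prems(6)
      by (intro bexI[of _ y] bexI[of _ z] bexI[of _ c]) (simp_all add: key_def)
    then have "(i, j, c, sel y @ sel z) \<in> set (saturate tab ivt B E n' @ combine tab ivt B (saturate tab ivt B E n'))"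
      by simp
    from prune_cover[OF this] obtain x where x: "x \<in> set (saturate tab ivt B E n)"
      "key x = key (i, j, c, sel y @ sel z)" "cost (sel x) \<le> cost (sel (i, j, c, sel y @ sel z))"
      unfolding n saturate_Suc by blast
    have "cost (sel x) \<le> cost (pout xs)" using x(3) y(3) z(3) po by simp
    moreover have "key x = (i, j, c)" using x(2) by (simp add: key_def)
    ultimately show ?thesis using x(1) by blast
  qed
qed

end

section \<open>The paths in the graph of an instance\<close>

locale ssop_graph = dehn +
  fixes tr :: "nat list list" and c0 :: nat
  assumes tr: "a \<in> set tr \<Longrightarrow> a \<in> lists {..<m} \<and> length a \<le> c0"
begin

text \<open>Letter number j is token j + 1, since token 0 is the separator.\<close>

definition label :: "nat \<Rightarrow> nat list" where "label t = lookup tr [] (t - 1)"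

definition wval :: "nat list \<Rightarrow> 'a" where "wval w = ev (concat (map label w))"

lemma label: "label t \<in> lists {..<m}" "length (label t) \<le> c0"
  using tr[OF nth_mem] unfolding label_def lookup_eq by auto

lemma wval_simps [simp]: "wval [] = \<one>" "wval (t # w) = ev (label t) \<otimes> wval w"
  "wval (u @ w) = wval u \<otimes> wval w" "wval w \<in> carrier G"
  by (simp_all add: wval_def ev_append)

lemma path_length:
  "\<lbrakk>\<And>x. x \<in> set E \<Longrightarrow> src x < tgt x; path E i xs j\<rbrakk> \<Longrightarrow> i + length xs \<le> j"
proof (induction xs arbitrary: i)
  case (Cons x xs)
  then have x: "x \<in> set E" "src x = i" "path E (tgt x) xs j" by auto
  from Cons.IH[OF Cons.prems(1) x(3)] Cons.prems(1)[OF x(1)] x(2) show ?case by simp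
qed simp

lemma path_mono: "path E i xs j \<Longrightarrow> set E \<subseteq> set E' \<Longrightarrow> path E' i xs j"
  by (induction xs arbitrary: i) auto

lemma path_old:
  assumes "\<And>x. x \<in> set (es @ E) \<Longrightarrow> src x < tgt x" "\<And>x. x \<in> set es \<Longrightarrow> q < tgt x"
  shows "path (es @ E) i xs q \<Longrightarrow> path E i xs q"
proof (induction xs arbitrary: i)
  case (Cons x xs)
  then have "path (es @ E) (tgt x) xs q" by simp
  from path_length[OF assms(1) this] have "tgt x \<le> q" by simp
  then have "x \<notin> set es" using assms(2)[of x] by auto
  then show ?case using Cons by auto
qed simp

definition reach :: "fact list \<Rightarrow> nat \<Rightarrow> ('a \<times> bool list) set" where
  "reach E q = {(pval xs, pout xs) | xs. path E 0 xs q}"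

definition wfg :: "graph \<Rightarrow> bool" where
  "wfg st \<longleftrightarrow> fst (snd st) \<le> fst st \<and> (\<forall>x\<in>set (snd (snd st)). src x < tgt x \<and> tgt x \<le> fst st \<and>
     lab x \<in> lists {..<m} \<and> length (lab x) \<le> c0)"

text \<open>Vertex numbers increase along a path, so an edge whose target lies beyond
  \<open>q\<close> cannot occur on a path to \<open>q\<close>.\<close>

lemma reach_old:
  assumes "\<And>x. x \<in> set (es @ E) \<Longrightarrow> src x < tgt x" "\<And>x. x \<in> set es \<Longrightarrow> q < tgt x"
  shows "reach (es @ E) q = reach E q"
proof -
  have "path (es @ E) 0 xs q \<longleftrightarrow> path E 0 xs q" for xs
    using path_old[OF assms, where i = 0 and xs = xs] path_mono[of E 0 xs q "es @ E"] by auto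
  then show ?thesis by (simp add: reach_def)
qed

text \<open>The last edge of a path to the new vertex must be new, and the rest of the path ends
  below it and therefore consists of old edges.\<close>

lemma reach_new:
  assumes lt: "\<And>x. x \<in> set (es @ E) \<Longrightarrow> src x < tgt x" and es: "\<And>x. x \<in> set es \<Longrightarrow> tgt x = Suc p"
    and E: "\<And>x. x \<in> set E \<Longrightarrow> tgt x \<le> p"
  shows "reach (es @ E) (Suc p) =
    (\<Union>x\<in>set es. (\<lambda>(g, bs). (g \<otimes> ev (lab x), bs @ sel x)) ` reach E (src x))"
    (is "?L = ?R")
proof (intro equalityI subsetI)
  fix z assume "z \<in> ?L"
  then obtain xs where xs: "path (es @ E) 0 xs (Suc p)" "z = (pval xs, pout xs)" by (auto simp: reach_def)
  then have "xs \<noteq> []" by auto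
  then obtain ys x where ys: "xs = ys @ [x]" by (cases xs rule: rev_exhaust) auto
  then have x: "path (es @ E) 0 ys (src x)" "x \<in> set (es @ E)" "tgt x = Suc p"
    using xs(1) by (auto simp: path_append)
  then have xes: "x \<in> set es" using E[of x] by auto
  have "src x \<le> p" using lt[OF x(2)] x(3) by simp
  then have "path E 0 ys (src x)" using path_old[OF lt _ x(1)] es by auto
  then have "(pval ys, pout ys) \<in> reach E (src x)" by (auto simp: reach_def)
  moreover have "z = (pval ys \<otimes> ev (lab x), pout ys @ sel x)" using xs(2) ys by simp
  ultimately show "z \<in> ?R" using xes by (intro UN_I[of x] image_eqI[of _ _ "(pval ys, pout ys)"]) simp_all
next
  fix z assume "z \<in> ?R"
  then obtain x y where "x \<in> set es" "y \<in> reach E (src x)"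
    "z = (\<lambda>(g, bs). (g \<otimes> ev (lab x), bs @ sel x)) y" by blast
  then obtain ys where x: "x \<in> set es" "path E 0 ys (src x)" "z = (pval ys \<otimes> ev (lab x), pout ys @ sel x)"
    unfolding reach_def by auto
  then have "path (es @ E) 0 (ys @ [x]) (Suc p)"
    using es[OF x(1)] path_mono[OF x(2), of "es @ E"] by (auto simp: path_append)
  moreover have "z = (pval (ys @ [x]), pout (ys @ [x]))" using x(3) by simp
  ultimately show "z \<in> ?L" unfolding reach_def by blast
qed

text \<open>\<open>P\<close> collects the values and selections of the paths to the current vertex,
  \<open>S\<close> those of the paths to the vertex where the current word began. A separator joins
  the two: the word is taken from \<open>P\<close> or skipped from \<open>S\<close>.\<close>

definition inv_graph :: "graph \<Rightarrow> ('a \<times> bool list) set \<Rightarrow> ('a \<times> bool list) set \<Rightarrow> bool" where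
  "inv_graph st P S \<longleftrightarrow> wfg st \<and> reach (snd (snd st)) (fst st) = P \<and> reach (snd (snd st)) (fst (snd st)) = S \<and>
     P \<subseteq> carrier G \<times> UNIV \<and> S \<subseteq> carrier G \<times> UNIV"

abbreviation branch :: "('a \<times> bool list) set \<Rightarrow> ('a \<times> bool list) set \<Rightarrow> ('a \<times> bool list) set" where
  "branch P S \<equiv> (\<lambda>(g, bs). (g, bs @ [True])) ` P \<union> (\<lambda>(g, bs). (g, bs @ [False])) ` S"

lemma inv_graph_letter:
  assumes "inv_graph st P S" "a \<in> lists {..<m}" "length a \<le> c0"
  shows "inv_graph (letter_edge a st) ((\<lambda>(g, bs). (g \<otimes> ev a, bs)) ` P) S"
proof -
  obtain p s E where st: "st = (p, s, E)" by (cases st) auto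
  let ?e = "(p, Suc p, a, [])"
  have w: "s \<le> p" "\<And>x. x \<in> set E \<Longrightarrow> src x < tgt x \<and> tgt x \<le> p \<and> lab x \<in> lists {..<m} \<and> length (lab x) \<le> c0"
    and r: "reach E p = P" "reach E s = S" "P \<subseteq> carrier G \<times> UNIV" "S \<subseteq> carrier G \<times> UNIV"
    using assms(1) unfolding inv_graph_def wfg_def st fst_conv snd_conv by blast+
  have tE: "tgt x \<le> p" if "x \<in> set E" for x using w(2)[OF that] by blast
  have wE: "\<forall>x\<in>set E. src x < tgt x \<and> tgt x \<le> Suc p \<and> lab x \<in> lists {..<m} \<and> length (lab x) \<le> c0"
    using w(2) le_SucI by blast
  have lt: "src x < tgt x" if "x \<in> set ([?e] @ E)" for x
    using that w(2)[of x] by (cases "x = ?e") simp_all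
  have "reach ([?e] @ E) (Suc p) = (\<lambda>(g, bs). (g \<otimes> ev a, bs)) ` P"
  proof -
    have "reach ([?e] @ E) (Suc p) = (\<Union>x\<in>set [?e]. (\<lambda>(g, bs). (g \<otimes> ev (lab x), bs @ sel x)) ` reach E (src x))"
      by (rule reach_new[OF lt _ tE]) simp_all
    then show ?thesis using r(1) by simp
  qed
  moreover have "reach ([?e] @ E) s = S"
  proof -
    have "reach ([?e] @ E) s = reach E s" by (rule reach_old[OF lt]) (use w(1) in simp_all)
    then show ?thesis using r(2) by simp
  qed
  moreover have "wfg (letter_edge a st)"
    unfolding wfg_def letter_edge_def st fst_conv snd_conv using wE w(1) assms(2,3) by simp
  moreover have "(\<lambda>(g, bs). (g \<otimes> ev a, bs)) ` P \<subseteq> carrier G \<times> UNIV" using r(3) by auto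
  ultimately show ?thesis using r(4) unfolding inv_graph_def by (simp add: letter_edge_def st)
qed

lemma image_mult_one:
  assumes "P \<subseteq> carrier G \<times> UNIV"
  shows "(\<lambda>(g, bs). (g \<otimes> \<one>, bs)) ` P = P"
proof -
  have "(\<lambda>(g, bs). (g \<otimes> \<one>, bs)) z = id z" if "z \<in> P" for z
    using subsetD[OF assms that] by (cases z) simp
  then have "(\<lambda>(g, bs). (g \<otimes> \<one>, bs)) ` P = id ` P" by (intro image_cong refl)
  then show ?thesis by simp
qed

lemma inv_graph_start:
  assumes "inv_graph st P S"
  shows "inv_graph (start_edge st) P P"
proof -
  have P: "P \<subseteq> carrier G \<times> UNIV" using assms unfolding inv_graph_def by blast
  have "inv_graph (letter_edge [] st) ((\<lambda>(g, bs). (g \<otimes> ev [], bs)) ` P) S"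
    by (rule inv_graph_letter[OF assms]) simp_all
  then have "inv_graph (letter_edge [] st) P S" unfolding ev_simps image_mult_one[OF P] .
  then show ?thesis
    unfolding inv_graph_def wfg_def letter_edge_def start_edge_def fst_conv snd_conv by blast
qed

lemma inv_graph_sep:
  assumes "inv_graph st P S"
  shows "inv_graph (sep_edges st) (branch P S) (branch P S)"
proof -
  obtain p s E where st: "st = (p, s, E)" by (cases st) auto
  let ?es = "[(p, Suc p, [], [True]), (s, Suc p, [], [False])]"
  have w: "s \<le> p" "\<And>x. x \<in> set E \<Longrightarrow> src x < tgt x \<and> tgt x \<le> p \<and> lab x \<in> lists {..<m} \<and> length (lab x) \<le> c0"
    and r: "reach E p = P" "reach E s = S" "P \<subseteq> carrier G \<times> UNIV" "S \<subseteq> carrier G \<times> UNIV"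
    using assms(1) unfolding inv_graph_def wfg_def st fst_conv snd_conv by blast+
  have tE: "tgt x \<le> p" if "x \<in> set E" for x using w(2)[OF that] by blast
  have wE: "\<forall>x\<in>set E. src x < tgt x \<and> tgt x \<le> Suc p \<and> lab x \<in> lists {..<m} \<and> length (lab x) \<le> c0"
    using w(2) le_SucI by blast
  have lt: "src x < tgt x" if "x \<in> set (?es @ E)" for x
    using that w(1) w(2)[of x] by (cases "x \<in> set ?es") auto
  have "reach (?es @ E) (Suc p) =
      (\<Union>x\<in>set ?es. (\<lambda>(g, bs). (g \<otimes> ev (lab x), bs @ sel x)) ` reach E (src x))"
    by (rule reach_new[OF lt _ tE]) auto
  also have "\<dots> = (\<lambda>(g, bs). (g \<otimes> \<one>, bs @ [True])) ` P \<union> (\<lambda>(g, bs). (g \<otimes> \<one>, bs @ [False])) ` S"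
    using r(1,2) by simp
  also have "\<dots> = branch P S"
    using r(3,4) by (intro arg_cong2[where f = "(\<union>)"] image_cong) auto
  finally have R: "reach (?es @ E) (Suc p) = branch P S" .
  have "wfg (sep_edges st)"
    unfolding wfg_def sep_edges_def st fst_conv snd_conv using wE w(1) by simp
  moreover have "branch P S \<subseteq> carrier G \<times> UNIV"
    using r(3,4) by auto
  ultimately show ?thesis using R unfolding inv_graph_def by (simp add: sep_edges_def st)
qed

lemma inv_graph_letters:
  assumes "inv_graph st P S" "\<And>a. a \<in> set as \<Longrightarrow> a \<in> lists {..<m} \<and> length a \<le> c0"
  shows "inv_graph (fold letter_edge as st) ((\<lambda>(g, bs). (g \<otimes> ev (concat as), bs)) ` P) S"
  using assms
proof (induction as arbitrary: st P)
  case Nil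
  have "P \<subseteq> carrier G \<times> UNIV" using Nil.prems(1) unfolding inv_graph_def by blast
  from image_mult_one[OF this] show ?case using Nil by simp
next
  case (Cons a as)
  have "inv_graph (letter_edge a st) ((\<lambda>(g, bs). (g \<otimes> ev a, bs)) ` P) S"
    by (rule inv_graph_letter) (use Cons.prems in auto)
  from Cons.IH[OF this] Cons.prems(2)
  have "inv_graph (fold letter_edge (a # as) st)
     ((\<lambda>(g, bs). (g \<otimes> ev (concat as), bs)) ` (\<lambda>(g, bs). (g \<otimes> ev a, bs)) ` P) S" by simp
  moreover have "(\<lambda>(g, bs). (g \<otimes> ev (concat as), bs)) ` (\<lambda>(g, bs). (g \<otimes> ev a, bs)) ` P
     = (\<lambda>(g, bs). (g \<otimes> ev (concat (a # as)), bs)) ` P"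
    unfolding image_image
  proof (rule image_cong[OF refl])
    fix z assume "z \<in> P"
    then have "fst z \<in> carrier G" using Cons.prems(1) unfolding inv_graph_def by auto
    then show "(case case z of (g, bs) \<Rightarrow> (g \<otimes> ev a, bs) of (g, bs) \<Rightarrow> (g \<otimes> ev (concat as), bs))
      = (case z of (g, bs) \<Rightarrow> (g \<otimes> ev (concat (a # as)), bs))"
      by (cases z) (simp add: ev_append m_assoc)
  qed
  ultimately show ?case by simp
qed

lemma read_word:
  assumes "0 \<notin> set w"
  shows "fold (read_token tr) w st = fold letter_edge (map label w) st"
  using assms
proof (induction w arbitrary: st)
  case (Cons t w)
  then have "read_token tr t st = letter_edge (label t) st"
    by (cases t) (auto simp: read_token_def label_def)
  then show ?case using Cons by simp
qed simp

definition select :: "nat list list \<Rightarrow> bool list \<Rightarrow> 'a" where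
  "select ws bs = foldr (\<otimes>) (map2 (\<lambda>w b. if b then wval w else \<one>) ws bs) \<one>"

lemma select_simps [simp]: "select [] bs = \<one>"
  "select (w # ws) (b # bs) = (if b then wval w else \<one>) \<otimes> select ws bs"
  by (simp_all add: select_def)

lemma select_closed [simp]: "select ws bs \<in> carrier G"
proof (induction ws arbitrary: bs)
  case (Cons w ws)
  then show ?case by (cases bs) (simp_all add: select_def)
qed simp

abbreviation extensions :: "nat list list \<Rightarrow> ('a \<times> bool list) set \<Rightarrow> ('a \<times> bool list) set" where
  "extensions ws A \<equiv> {(g \<otimes> select ws ds, bs @ ds) | g bs ds. (g, bs) \<in> A \<and> length ds = length ws}"

text \<open>At the start of a word the two sets agree, and the separator after it makes them agree
  again; hence the single set \<open>A\<close>. For one word it becomes \<open>branch\<close>, and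
  iterating this yields all selections.\<close>

lemma inv_graph_words:
  assumes "inv_graph st A A" "\<And>w. w \<in> set ws \<Longrightarrow> 0 \<notin> set w"
  shows "inv_graph (fold (read_token tr) (concat (map (\<lambda>w. w @ [0]) ws)) st)
     (extensions ws A) (extensions ws A)"
  using assms
proof (induction ws arbitrary: st A)
  case Nil
  have "extensions [] A = A"
  proof -
    have "A \<subseteq> carrier G \<times> UNIV" using Nil.prems(1) unfolding inv_graph_def by blast
    note A = image_mult_one[OF this]
    have "extensions [] A
      = {(g \<otimes> \<one>, bs) | g bs. (g, bs) \<in> A}" by simp
    also have "\<dots> = (\<lambda>(g, bs). (g \<otimes> \<one>, bs)) ` A" by auto
    finally show ?thesis unfolding A .
  qed
  then show ?case using Nil by simp
next
  case (Cons w ws)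
  let ?st = "sep_edges (fold letter_edge (map label w) st)"
  let ?P = "(\<lambda>(g, bs). (g \<otimes> wval w, bs)) ` A"
  let ?A = "branch ?P A"
  have "inv_graph (fold letter_edge (map label w) st) ?P A"
    using inv_graph_letters[OF Cons.prems(1), of "map label w"] label by (auto simp: wval_def)
  from inv_graph_sep[OF this] have 1: "inv_graph ?st ?A ?A" .
  have 2: "fold (read_token tr) (concat (map (\<lambda>w. w @ [0]) (w # ws))) st
      = fold (read_token tr) (concat (map (\<lambda>w. w @ [0]) ws)) ?st"
    using read_word[of w st] Cons.prems(2) by (simp add: read_token_def)
  have A: "g \<in> carrier G" if "(g, bs) \<in> A" for g bs using Cons.prems(1) that unfolding inv_graph_def by auto
  have 3: "extensions ws ?A
    = extensions (w # ws) A" (is "?L = ?R")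
  proof (intro equalityI subsetI)
    fix z assume "z \<in> ?L"
    then obtain g bs ds where z: "z = (g \<otimes> select ws ds, bs @ ds)" "(g, bs) \<in> ?A" "length ds = length ws" by blast
    from z(2) obtain g' bs' b where g: "(g', bs') \<in> A" "g = g' \<otimes> (if b then wval w else \<one>)" "bs = bs' @ [b]"
    proof
      assume "(g, bs) \<in> (\<lambda>(g, bs). (g, bs @ [True])) ` ?P"
      then obtain y where "y \<in> A" "g = fst y \<otimes> wval w" "bs = snd y @ [True]" by auto
      then show thesis using that[of "fst y" "snd y" True] by simp
    next
      assume "(g, bs) \<in> (\<lambda>(g, bs). (g, bs @ [False])) ` A"
      then obtain y where y: "y \<in> A" "g = fst y" "bs = snd y @ [False]" by auto
      then show thesis using that[of "fst y" "snd y" False] A[of "fst y" "snd y"] by simp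
    qed
    then have "z = (g' \<otimes> select (w # ws) (b # ds), bs' @ b # ds)"
      using A[OF g(1)] z(1) by (simp add: m_assoc)
    then show "z \<in> ?R" using g(1) z(3) by (intro CollectI exI[of _ g'] exI[of _ bs'] exI[of _ "b # ds"]) simp
  next
    fix z assume "z \<in> ?R"
    then obtain g bs ds where z: "z = (g \<otimes> select (w # ws) ds, bs @ ds)" "(g, bs) \<in> A" "length ds = length (w # ws)" by blast
    then obtain b ds' where ds: "ds = b # ds'" "length ds' = length ws" by (cases ds) auto
    have "(g \<otimes> (if b then wval w else \<one>), bs @ [b]) \<in> ?A"
    proof (cases b)
      case True
      have "(g \<otimes> wval w, bs) \<in> ?P" by (rule image_eqI[OF _ z(2)]) simp
      then show ?thesis using True by (intro UnI1) (rule image_eqI[rotated], assumption, simp)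
    next
      case False
      then show ?thesis using A[OF z(2)] by (intro UnI2 image_eqI[OF _ z(2)]) simp
    qed
    moreover have "z = ((g \<otimes> (if b then wval w else \<one>)) \<otimes> select ws ds', (bs @ [b]) @ ds')"
      using z(1) ds(1) A[OF z(2)] by (simp add: m_assoc)
    ultimately show "z \<in> ?L" using ds(2) by blast
  qed
  show ?case unfolding 2 using Cons.IH[OF 1] Cons.prems(2) unfolding 3 by simp
qed

lemma last_inverse_append_sep:
  "last_inverse tr iv' (u @ 0 # w) = last_inverse tr iv' w"
  by (simp add: last_inverse_def)

lemma last_inverse_word:
  assumes "0 \<notin> set w"
  shows "last_inverse tr ivt w = rev (map (\<lambda>t. winv (label t)) w)"
proof -
  let ?f = "\<lambda>t w. case t of 0 \<Rightarrow> [] | Suc j \<Rightarrow> inv_word ivt (lookup tr [] j) # w"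
  have "fold ?f w l = rev (map (\<lambda>t. winv (label t)) w) @ l" for l
    using assms
  proof (induction w arbitrary: l)
    case (Cons t w)
    then have "?f t l = winv (label t) # l"
      using label(1)[of t] inv_word[of "label t"] by (cases t) (auto simp: label_def)
    then show ?case using Cons by simp
  qed simp
  then show ?thesis by (simp add: last_inverse_def)
qed

lemma last_inverse_instance:
  assumes "0 \<notin> set w"
  shows "last_inverse tr ivt (concat (map (\<lambda>w. w @ [0]) ws) @ w) = rev (map (\<lambda>t. winv (label t)) w)"
proof (cases ws rule: rev_exhaust)
  case Nil
  then show ?thesis using last_inverse_word[OF assms] by simp
next
  case (snoc ws' w')
  then show ?thesis
    using last_inverse_word[OF assms] last_inverse_append_sep[of ivt "concat (map (\<lambda>w. w @ [0]) ws') @ w'" w]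
    by simp
qed

lemma ev_inverse_word: "ev (concat (rev (map (\<lambda>t. winv (label t)) w))) = inv (wval w)"
  by (induction w) (simp_all add: ev_append ev_winv label inv_mult_group)

text \<open>In the vertex count the last word appears twice, inverted in front and with its own
  tokens at the end; the start edge adds the 1.\<close>

lemma graph_of_instance:
  assumes ws: "\<forall>w\<in>set ws. 0 \<notin> set w" and w: "0 \<notin> set w"
    and u: "u = concat (map (\<lambda>w. w @ [0]) ws) @ w"
  shows "wfg (graph_of tr ivt u)"
    and "reach (snd (snd (graph_of tr ivt u))) (fst (snd (graph_of tr ivt u)))
      = {(inv (wval w) \<otimes> select ws ds, ds) | ds. length ds = length ws}"
    and "fst (graph_of tr ivt u) \<le> 2 * length u + 1"
    and "0 < fst (snd (graph_of tr ivt u))"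
proof -
  let ?l = "rev (map (\<lambda>t. winv (label t)) w)"
  let ?g = "inv (wval w)"
  let ?st = "start_edge (fold letter_edge ?l (0, 0, []))"
  let ?B = "{(?g \<otimes> select ws ds, ds) | ds. length ds = length ws}"
  have "path [] 0 xs 0 \<longleftrightarrow> xs = []" for xs by (cases xs) auto
  then have "inv_graph (0, 0, []) {(\<one>, [])} {(\<one>, [])}" by (auto simp: inv_graph_def wfg_def reach_def)
  from inv_graph_letters[OF this, of ?l]
  moreover have "a \<in> lists {..<m} \<and> length a \<le> c0" if a: "a \<in> set ?l" for a
  proof -
    obtain t where "a = winv (label t)" using a by auto
    then show ?thesis using winv_lists[OF label(1)[of t]] label(2)[of t] by simp
  qed
  ultimately have "inv_graph (fold letter_edge ?l (0, 0, [])) {(?g, [])} {(\<one>, [])}"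
    using ev_inverse_word[of w] by simp
  from inv_graph_start[OF this] have "inv_graph ?st {(?g, [])} {(?g, [])}" .
  from inv_graph_words[OF this, of ws] ws
  have "inv_graph (fold (read_token tr) (concat (map (\<lambda>w. w @ [0]) ws)) ?st) ?B ?B"
    by simp
  from inv_graph_letters[OF this, of "map label w"] label
  have "inv_graph (fold letter_edge (map label w) (fold (read_token tr) (concat (map (\<lambda>w. w @ [0]) ws)) ?st))
      ((\<lambda>(g, bs). (g \<otimes> wval w, bs)) ` ?B) ?B" by (auto simp: wval_def)
  moreover have g: "graph_of tr ivt u = fold letter_edge (map label w) (fold (read_token tr) (concat (map (\<lambda>w. w @ [0]) ws)) ?st)"
    unfolding graph_of_def u last_inverse_instance[OF w] by (simp add: read_word[OF w])
  ultimately have "inv_graph (graph_of tr ivt u) ((\<lambda>(g, bs). (g \<otimes> wval w, bs)) ` ?B) ?B" by simp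
  then show "wfg (graph_of tr ivt u)" "reach (snd (snd (graph_of tr ivt u))) (fst (snd (graph_of tr ivt u))) = ?B"
    by (simp_all add: inv_graph_def)
  have l: "fst (fold letter_edge as st) = fst st + length as" for as st
    by (induction as arbitrary: st) (auto simp: letter_edge_def)
  have r: "fst (fold (read_token tr) as st) = fst st + length as" for as st
    by (induction as arbitrary: st) (auto simp: read_token_def letter_edge_def sep_edges_def split: nat.split)
  have s: "fst (start_edge st) = Suc (fst st)" for st by (simp add: start_edge_def)
  have "fst (graph_of tr ivt u) = Suc (length w) + length u"
    unfolding graph_of_def r s l by (simp add: u last_inverse_instance[OF w])
  then show "fst (graph_of tr ivt u) \<le> 2 * length u + 1" by (simp add: u)
  have l': "fst (snd (fold letter_edge as st)) = fst (snd st)" for as st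
    by (induction as arbitrary: st) (auto simp: letter_edge_def)
  have r': "0 < fst (snd (fold (read_token tr) as st))" if "0 < fst (snd st)" for as st
    using that by (induction as arbitrary: st) (auto simp: read_token_def letter_edge_def sep_edges_def split: nat.split)
  show "0 < fst (snd (graph_of tr ivt u))"
    unfolding graph_of_def by (rule r') (simp add: start_edge_def)
qed

text \<open>A listed selection is sound because a path of value 1 stands behind its fact. It is
  optimal because keys are distinct: the fact supplied by completeness for any competing selection
  has the same key and must be the same fact.\<close>

theorem solutions_correct:
  assumes ws: "\<forall>w\<in>set ws. 0 \<notin> set w" and w: "0 \<notin> set w"
    and u: "u = concat (map (\<lambda>w. w @ [0]) ws) @ w"
    and K: "4 * \<delta> \<le> real K" and C: "4 * \<delta> + 3 * real c0 + 4 \<le> real C"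
  shows "ds \<in> set (solutions tab ivt tr m K C u) \<Longrightarrow> length ds = length ws \<and> select ws ds = wval w \<and>
      (\<forall>ds'. length ds' = length ws \<and> select ws ds' = wval w \<longrightarrow> cost ds \<le> cost ds')"
    and "length ds' = length ws \<Longrightarrow> select ws ds' = wval w \<Longrightarrow> solutions tab ivt tr m K C u \<noteq> []"
proof -
  let ?g = "graph_of tr ivt u" and ?B = "snd (log_ball m K C u)"
  let ?E = "snd (snd ?g)" and ?n = "fst ?g" and ?s = "fst (snd ?g)"
  let ?T = "saturate tab ivt ?B ?E ?n"
  note graph = graph_of_instance[OF ws w u]
  obtain t where t: "?B = ball_words m (K * t + C)" "length u < 2 ^ t" using log_ball by blast
  have B: "set ?B = {w \<in> lists {..<m}. length w \<le> K * t + C}" unfolding t(1) by (rule set_ball_words)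
  have E: "src x < tgt x" "tgt x \<le> ?n" "lab x \<in> lists {..<m}" "nrm (ev (lab x)) \<le> c0" if "x \<in> set ?E" for x
  proof -
    show *: "src x < tgt x" "tgt x \<le> ?n" "lab x \<in> lists {..<m}" using graph(1) that unfolding wfg_def by blast+
    have "length (lab x) \<le> c0" using graph(1) that unfolding wfg_def by blast
    then show "nrm (ev (lab x)) \<le> c0" using nrm_le[OF *(3)] by simp
  qed
  \<comment> \<open>A path has at most \<open>2 * length u + 1\<close> edges, which is below
    \<open>2 ^ Suc t\<close>. \<open>K\<close> pays for t of the doublings, \<open>C\<close> for the
    remaining one and the constants.\<close>
  have L: "4 * \<delta> * real (Suc t) + 3 * real c0 + 4 \<le> real (K * t + C)"
  proof -
    have "4 * \<delta> * real t \<le> real K * real t" using K by (intro mult_right_mono) auto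
    then show ?thesis using C by (simp add: algebra_simps)
  qed
  have iff: "(inv (wval w) \<otimes> select ws ds = \<one>) \<longleftrightarrow> select ws ds = wval w" for ds
  proof
    assume "inv (wval w) \<otimes> select ws ds = \<one>"
    then have "inv (select ws ds) = inv (wval w)" by (rule inv_equality) simp_all
    then have "inv (inv (select ws ds)) = inv (inv (wval w))" by simp
    then show "select ws ds = wval w" by simp
  qed simp
  have opt: "\<exists>x\<in>set ?T. key x = (0, ?s, []) \<and> cost (sel x) \<le> cost ds"
    if ds: "length ds = length ws" "select ws ds = wval w" for ds
  proof -
    have "(\<one>, ds) \<in> reach ?E ?s" unfolding graph(2)
      by (intro CollectI exI[of _ ds]) (use ds iff[of ds] in simp)
    then obtain xs where xs: "path ?E 0 xs ?s" "pval xs = \<one>" "pout xs = ds" unfolding reach_def by force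
    have "0 + length xs \<le> ?s" by (rule path_length[OF _ xs(1)]) (rule E(1))
    then have "length xs \<le> ?s" by simp
    moreover have "?s \<le> ?n" using graph(1) unfolding wfg_def by blast
    ultimately have l: "length xs \<le> Suc ?n" "length xs \<le> 2 ^ Suc t" using graph(3) t(2) by auto
    have "xs \<noteq> []" using xs(1) graph(4) by auto
    have "\<exists>x\<in>set ?T. key x = (0, ?s, []) \<and> cost (sel x) \<le> cost (pout xs)"
    proof (rule saturate_complete[OF _ B L xs(1) \<open>xs \<noteq> []\<close> l])
      show "lab x \<in> lists {..<m} \<and> nrm (ev (lab x)) \<le> c0" if "x \<in> set ?E" for x
        using E(3,4)[OF that] by blast
      show "nrm (pval xs) \<le> K * t + C" "ev [] = pval xs" using xs(2) by simp_all
      show "[] \<in> set ?B" unfolding B by simp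
    qed
    then show ?thesis unfolding xs(3) .
  qed
  have dist: "distinct (map key ?T)"
  proof (rule conjunct2[OF saturate_bounded[of ?E ?n]])
    fix x assume "x \<in> set ?E"
    from graph_of_edges[OF this] show "tgt x \<le> ?n \<and> src x + length (sel x) \<le> tgt x" by simp
  qed
  {
    fix ds assume "ds \<in> set (solutions tab ivt tr m K C u)"
    then obtain x where x: "x \<in> set ?T" "src x = 0" "tgt x = ?s" "lab x = []" "ds = sel x"
      unfolding solutions_def set_map set_filter by blast
    have BB: "set ?B \<subseteq> lists {..<m}" unfolding B by blast
    have "lab x \<in> set ?B \<and> (\<exists>xs. path ?E (src x) xs (tgt x) \<and> ev (lab x) = pval xs \<and> sel x = pout xs)"
      by (rule saturate_sound[OF _ BB x(1)]) (rule E(3))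
    then obtain xs where xs: "path ?E (src x) xs (tgt x)" "ev (lab x) = pval xs" "sel x = pout xs" by blast
    have "(pval xs, pout xs) \<in> reach ?E ?s" using xs(1) unfolding reach_def x(2,3) by blast
    moreover have "pval xs = \<one>" using xs(2) unfolding x(4) by simp
    ultimately have "(\<one>, ds) \<in> reach ?E ?s" using xs(3) x(5) by simp
    then have "length ds = length ws" "select ws ds = wval w" unfolding graph(2) using iff[of ds] by simp_all
    moreover have "cost ds \<le> cost ds'" if ds': "length ds' = length ws" "select ws ds' = wval w" for ds'
    proof -
      obtain y where y: "y \<in> set ?T" "key y = (0, ?s, [])" "cost (sel y) \<le> cost ds'" using opt[OF ds'] by blast
      have "key x = key y" using x y(2) by (simp add: key_def)
      moreover have "inj_on key (set ?T)" using dist by (simp add: distinct_map)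
      ultimately have "x = y" using x(1) y(1) by (blast dest: inj_onD)
      then show ?thesis using y(3) x(5) by simp
    qed
    ultimately show "length ds = length ws \<and> select ws ds = wval w \<and>
      (\<forall>ds'. length ds' = length ws \<and> select ws ds' = wval w \<longrightarrow> cost ds \<le> cost ds')" by blast
  }
  assume "length ds' = length ws" "select ws ds' = wval w"
  from opt[OF this] obtain x where "x \<in> set ?T" "key x = (0, ?s, [])" by blast
  then show "solutions tab ivt tr m K C u \<noteq> []"
    unfolding solutions_def key_def map_is_Nil_conv filter_empty_conv by blast
qed

end

section \<open>Hyperbolic groups\<close>

lemma word_val_simps [simp]:
  "word_val G [] = \<one>\<^bsub>G\<^esub>" "word_val G (a # w) = letter_val G a \<otimes>\<^bsub>G\<^esub> word_val G w"
  by (simp_all add: word_val_def)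

lemma (in group) letter_val_closed: "S \<subseteq> carrier G \<Longrightarrow> a \<in> letters S \<Longrightarrow> letter_val G a \<in> carrier G"
  by (cases a) (auto simp: letters_def)

lemma (in group) word_val_closed:
  "S \<subseteq> carrier G \<Longrightarrow> w \<in> lists (letters S) \<Longrightarrow> word_val G w \<in> carrier G"
  by (induction w) (auto simp: letter_val_closed)

lemma (in group) word_val_append:
  "S \<subseteq> carrier G \<Longrightarrow> u \<in> lists (letters S) \<Longrightarrow> w \<in> lists (letters S) \<Longrightarrow>
   word_val G (u @ w) = word_val G u \<otimes> word_val G w"
proof (induction u)
  case Nil
  then show ?case using word_val_closed[of S w] by simp
next
  case (Cons a u)
  then show ?case using word_val_closed[of S u] word_val_closed[of S w] letter_val_closed[of S a]
    by (simp add: m_assoc)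
qed

lemma (in group) generate_word:
  assumes S: "S \<subseteq> carrier G" and "g \<in> generate G S"
  shows "\<exists>w\<in>lists (letters S). word_val G w = g"
  using assms(2)
proof (induction rule: generate.induct)
  case one
  show ?case by (intro bexI[of _ "[]"]) auto
next
  case (incl x)
  then show ?case using S by (intro bexI[of _ "[Pos x]"]) (auto simp: letters_def)
next
  case (inv x)
  then show ?case using S by (intro bexI[of _ "[Neg x]"]) (auto simp: letters_def)
next
  case (eng g h)
  then obtain u w where "u \<in> lists (letters S)" "w \<in> lists (letters S)" "word_val G u = g" "word_val G w = h"
    by blast
  then show ?case using word_val_append[OF S, of u w] by (intro bexI[of _ "u @ w"]) auto
qed

fun flip :: "'a letter \<Rightarrow> 'a letter" where
  "flip (Pos x) = Neg x"
| "flip (Neg x) = Pos x"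

lemma flip_letters: "a \<in> letters S \<Longrightarrow> flip a \<in> letters S"
  by (auto simp: letters_def)

lemma (in group) letter_val_flip:
  "S \<subseteq> carrier G \<Longrightarrow> a \<in> letters S \<Longrightarrow> letter_val G (flip a) = inv (letter_val G a)"
  by (auto simp: letters_def)

lemma finite_letters: "finite S \<Longrightarrow> finite (letters S)"
  by (simp add: letters_def)

lemma lists_nth:
  assumes "w \<in> lists (set l)"
  shows "\<exists>js\<in>lists {..<length l}. map ((!) l) js = w"
  using assms
proof (induction w)
  case (Cons a w)
  then obtain js where "js \<in> lists {..<length l}" "map ((!) l) js = w" by auto
  moreover have "a \<in> set l" using Cons by simp
  then obtain j where "j < length l" "l ! j = a" by (auto simp: in_set_conv_nth)
  ultimately show ?case by (intro bexI[of _ "j # js"]) auto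
qed auto

section \<open>Numbering the generators, and the table of Dehn's algorithm\<close>

lemma hyperbolic_word_group_exists:
  fixes G (structure)
  assumes "hyperbolic_group G"
  shows "\<exists>m v iv \<delta>. hyperbolic_word_group G m v iv \<delta>"
proof -
  interpret group G using assms by (simp add: hyperbolic_group_def)
  obtain S where S: "finite_generating_set G S" "gromov_hyperbolic (carrier G) (word_dist G S)"
    using assms unfolding hyperbolic_group_def by blast
  have SG: "S \<subseteq> carrier G" and gen: "generate G S = carrier G" and fin: "finite S"
    using S(1) unfolding finite_generating_set_def by auto
  obtain sl where sl: "set sl = letters S" using finite_list[OF finite_letters[OF fin]] by blast
  define m where "m = length sl"
  \<comment> \<open>The default value keeps every list of numbers evaluating into the group, so that
    \<open>ev\<close> is closed without side conditions.\<close>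
  define v where "v j = (if j < m then letter_val G (sl ! j) else \<one>)" for j
  define iv where "iv j = (SOME j'. j' < m \<and> sl ! j' = flip (sl ! j))" for j
  have nth: "sl ! j \<in> letters S" if "j < m" for j
    using nth_mem[of j sl] that unfolding sl m_def by simp
  have iv: "iv j < m \<and> sl ! iv j = flip (sl ! j)" if "j < m" for j
  proof -
    have "flip (sl ! j) \<in> set sl" unfolding sl by (rule flip_letters[OF nth[OF that]])
    then have "\<exists>j'. j' < m \<and> sl ! j' = flip (sl ! j)" unfolding in_set_conv_nth m_def .
    from someI_ex[OF this] show ?thesis unfolding iv_def .
  qed
  interpret word_group G m v iv
  proof
    show "v j \<in> carrier G" for j using letter_val_closed[OF SG nth] by (simp add: v_def)
    show "iv j < m" if "j < m" for j using iv[OF that] by simp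
    show "v (iv j) = inv (v j)" if "j < m" for j
      using iv[OF that] letter_val_flip[OF SG nth[OF that]] that by (simp add: v_def)
  qed
  have ev: "ev w = word_val G (map ((!) sl) w)" if "w \<in> lists {..<m}" for w
  proof -
    have "v j = letter_val G (sl ! j)" if "j < m" for j using that by (simp add: v_def)
    with that show ?thesis by (induction w) auto
  qed
  have ex: "(\<exists>w\<in>lists {..<m}. length w = n \<and> ev w = g) \<longleftrightarrow>
     (\<exists>w\<in>lists (letters S). length w = n \<and> word_val G w = g)" for n g
  proof
    assume "\<exists>w\<in>lists {..<m}. length w = n \<and> ev w = g"
    then obtain w where w: "w \<in> lists {..<m}" "length w = n" "ev w = g" by blast
    then show "\<exists>w\<in>lists (letters S). length w = n \<and> word_val G w = g"
      using ev[OF w(1)] nth w by (intro bexI[of _ "map ((!) sl) w"]) auto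
  next
    assume "\<exists>w\<in>lists (letters S). length w = n \<and> word_val G w = g"
    then obtain w where w: "w \<in> lists (set sl)" "length w = n" "word_val G w = g" using sl by auto
    obtain js where js: "js \<in> lists {..<m}" "map ((!) sl) js = w"
      using lists_nth[OF w(1)] unfolding m_def by blast
    then show "\<exists>w\<in>lists {..<m}. length w = n \<and> ev w = g"
      using ev[OF js(1)] w(2,3) by (intro bexI[OF _ js(1)]) (simp flip: js(2))
  qed
  \<comment> \<open>Generators and formal inverses are both numbered, so words keep their lengths,
    the metrics coincide and \<delta> carries over unchanged.\<close>
  have dist: "gdist = word_dist G S"
    by (intro ext) (simp only: gdist_def word_dist_def nrm_def word_length_def ex)
  from S(2) obtain \<delta> where \<delta>: "0 \<le> \<delta> \<and> (\<forall>w\<in>carrier G. \<forall>x\<in>carrier G. \<forall>y\<in>carrier G. \<forall>z\<in>carrier G.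
      min (gromov_product gdist w x y) (gromov_product gdist w y z) - \<delta> \<le> gromov_product gdist w x z)"
    unfolding gromov_hyperbolic_def dist by (elim exE)
  have "hyperbolic_word_group G m v iv \<delta>"
  proof
    show "0 \<le> \<delta>" using \<delta> by (rule conjunct1)
    show "min (gromov_product gdist w x y) (gromov_product gdist w y z) - \<delta> \<le> gromov_product gdist w x z"
      if "w \<in> carrier G" "x \<in> carrier G" "y \<in> carrier G" "z \<in> carrier G" for w x y z
      by (rule bspec[OF bspec[OF bspec[OF bspec[OF conjunct2[OF \<delta>]]]]]) (rule that)+
    fix g assume "g \<in> carrier G"
    then obtain w where "w \<in> lists (letters S)" "word_val G w = g"
      using generate_word[OF SG] gen by blast
    then show "\<exists>w\<in>lists {..<m}. ev w = g" using ex[of "length w" g] by blast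
  qed
  then show ?thesis by blast
qed

text \<open>There are only finitely many words of length at most 4h, and a non-geodesic one has a
  shorter word of the same value, for instance a geodesic one, to serve as right-hand side.\<close>

lemma (in hyperbolic_word_group) dehn_exists: "\<exists>h tab. dehn G m v iv \<delta> h tab"
proof -
  obtain h where h: "2 * \<delta> < real h" using reals_Archimedean2 by blast
  let ?U = "{u \<in> lists {..<m}. length u \<le> 4 * h \<and> nrm (ev u) < length u}"
  have "finite {u. set u \<subseteq> {..<m} \<and> length u \<le> 4 * h}" by (rule finite_lists_length_le) simp
  moreover have "?U \<subseteq> {u. set u \<subseteq> {..<m} \<and> length u \<le> 4 * h}"
    unfolding lists_eq_set by blast
  ultimately have "finite ?U" by (rule rev_finite_subset)
  from finite_list[OF this] obtain ul where ul: "set ul = ?U" by (elim exE)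
  define r where "r u = (SOME u'. u' \<in> lists {..<m} \<and> ev u' = ev u \<and> length u' < length u)" for u
  have r: "r u \<in> lists {..<m} \<and> ev (r u) = ev u \<and> length (r u) < length u" if "u \<in> ?U" for u
  proof -
    obtain u' where "u' \<in> lists {..<m}" "length u' = nrm (ev u)" "ev u' = ev u"
      using nrm_ex[OF ev_closed] by blast
    moreover have "nrm (ev u) < length u" using that by blast
    ultimately have "\<exists>u'. u' \<in> lists {..<m} \<and> ev u' = ev u \<and> length u' < length u" by metis
    from someI_ex[OF this] show ?thesis unfolding r_def .
  qed
  have "dehn G m v iv \<delta> h (map (\<lambda>u. (u, r u)) ul)"
  proof
    show "2 * \<delta> < real h" by (rule h)
    fix u
    show "u' \<in> lists {..<m} \<and> ev u' = ev u \<and> length u' < length u"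
      if "(u, u') \<in> set (map (\<lambda>u. (u, r u)) ul)" for u'
    proof -
      have "u \<in> ?U" "u' = r u" using that unfolding ul[symmetric] by auto
      then show ?thesis using r by blast
    qed
    show "\<exists>u'. (u, u') \<in> set (map (\<lambda>u. (u, r u)) ul)"
      if "u \<in> lists {..<m}" "length u \<le> 4 * h" "nrm (ev u) < length u"
    proof -
      have "u \<in> set ul" unfolding ul using that by blast
      then show ?thesis by auto
    qed
  qed
  then show ?thesis by blast
qed

lemma cost_eq_ssop_cost: "cost ds = ssop_cost ds"
  by (induction ds) (auto simp: cost_def ssop_cost_def)

theorem theorem5p12:
  fixes G :: "('a, 'b) monoid_scheme" and X :: "'a set"
  assumes "hyperbolic_group G"
    and "finite_generating_set G X"
  shows "search_problem_in_P (ssop_alphabet X) (SSOP G X)"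
proof -
  obtain m v iv \<delta> where "hyperbolic_word_group G m v iv \<delta>"
    using hyperbolic_word_group_exists[OF assms(1)] by blast
  then interpret hyperbolic_word_group G m v iv \<delta> .
  obtain h tab where "dehn G m v iv \<delta> h tab" using dehn_exists by blast
  then interpret dehn G m v iv \<delta> h tab .
  have XG: "X \<subseteq> carrier G" and finX: "finite X"
    using assms(2) unfolding finite_generating_set_def by auto
  obtain xl where xl: "set xl = letters X" "distinct xl"
    using finite_distinct_list[OF finite_letters[OF finX]] by blast
  \<comment> \<open>Bridges the two generating sets: each letter of an instance gets a fixed word
    over the generators for which hyperbolicity is known.\<close>
  define wd where "wd a = (SOME w. w \<in> lists {..<m} \<and> ev w = letter_val G a)" for a
  have wd: "wd a \<in> lists {..<m} \<and> ev (wd a) = letter_val G a" if "a \<in> letters X" for a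
  proof -
    have "\<exists>w. w \<in> lists {..<m} \<and> ev w = letter_val G a"
      using gen[OF letter_val_closed[OF XG that]] by blast
    from someI_ex[OF this] show ?thesis unfolding wd_def .
  qed
  define tr where "tr = map wd xl"
  define c0 where "c0 = sum_list (map length tr)"
  interpret ssop_graph G m v iv \<delta> h tab tr c0
  proof
    fix a assume a: "a \<in> set tr"
    then have "length a \<le> c0" unfolding c0_def by (intro member_le_sum_list) auto
    then show "a \<in> lists {..<m} \<and> length a \<le> c0" using a wd xl(1) by (auto simp: tr_def)
  qed
  obtain K where K: "4 * \<delta> \<le> real K" using real_arch_simple by blast
  obtain C where C: "4 * \<delta> + 3 * real c0 + 4 \<le> real C" using real_arch_simple by blast
  \<comment> \<open>The separator takes position 0 and the letters follow, so positions are the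
    tokens that \<open>read_token\<close> expects. The symbols at the end occur in outputs
    only.\<close>
  define \<sigma> where "\<sigma> = Sep # map Letter xl @ [Bit False, Bit True, NoSolutions]"
  let ?n = "length xl"
  have dist: "distinct \<sigma>" using xl(2) by (auto simp: \<sigma>_def distinct_map inj_on_def)
  have \<sigma>: "\<sigma> ! 0 = Sep" "j < ?n \<Longrightarrow> \<sigma> ! Suc j = Letter (xl ! j)" "\<sigma> ! (?n + 1) = Bit False"
    "\<sigma> ! (?n + 2) = Bit True" "\<sigma> ! (?n + 3) = NoSolutions" "length \<sigma> = ?n + 4" for j
    by (simp_all add: \<sigma>_def nth_append)
  have A: "ssop_alphabet X \<subseteq> set \<sigma>" using xl(1) by (auto simp: \<sigma>_def ssop_alphabet_def)
  define sols where "sols = solutions tab ivt tr m K C"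
  define F where "F u = (case sols u of [] \<Rightarrow> [?n + 3]
      | ds # _ \<Rightarrow> map (\<lambda>b. if b then ?n + 2 else ?n + 1) ds)" for u
  have "polyf F"
    unfolding F_def sols_def by (intro polyf_intros polyf_solutions)
  \<comment> \<open>\<open>F\<close> transported to strings of symbols; the choice is unique because
    \<open>\<sigma>\<close> is distinct.\<close>
  define f where "f w = map ((!) \<sigma>) (F (SOME js. set js \<subseteq> {..<length \<sigma>} \<and> map ((!) \<sigma>) js = w))" for w
  have f: "f (map ((!) \<sigma>) js) = map ((!) \<sigma>) (F js)" if js: "set js \<subseteq> {..<length \<sigma>}" for js
  proof -
    define js' where "js' = (SOME js'. set js' \<subseteq> {..<length \<sigma>} \<and> map ((!) \<sigma>) js' = map ((!) \<sigma>) js)"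
    have js': "set js' \<subseteq> {..<length \<sigma>} \<and> map ((!) \<sigma>) js' = map ((!) \<sigma>) js"
      unfolding js'_def by (rule someI[of _ js]) (use js in simp)
    have "inj_on ((!) \<sigma>) (set js' \<union> set js)"
      using dist js js' by (intro inj_on_nth) auto
    then have "js' = js" using js' by (intro map_inj_on[of "(!) \<sigma>"]) auto
    then show ?thesis unfolding f_def js'_def by simp
  qed
  have "poly_time_computable (ssop_alphabet X) f"
  proof (rule poly_time_computable_polyf[OF \<open>polyf F\<close> dist A])
    fix js :: "nat list" assume js: "set js \<subseteq> {..<length \<sigma>}"
    have "set (F js) \<subseteq> {..<length \<sigma>}" by (auto simp: F_def \<sigma>(6) split: list.split)
    with f[OF js] show "set (F js) \<subseteq> {..<length \<sigma>} \<and> f (map ((!) \<sigma>) js) = map ((!) \<sigma>) (F js)" by blast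
  qed
  moreover have "SSOP G X w (f w)" if w: "w \<in> lists (ssop_alphabet X)" for w
  proof -
    obtain gs g where gs: "gs \<in> lists (lists (letters X))" "g \<in> lists (letters X)" "w = encode_input gs g"
      using encode_input_surj[OF w] by blast
    define idx where "idx a = (SOME j. j < ?n \<and> xl ! j = a)" for a
    have idx: "idx a < ?n \<and> xl ! idx a = a" if "a \<in> letters X" for a
    proof -
      have "\<exists>j. j < ?n \<and> xl ! j = a" using that xl(1) by (metis in_set_conv_nth)
      from someI_ex[OF this] show ?thesis unfolding idx_def .
    qed
    define tok where "tok = map (\<lambda>a. Suc (idx a))"
    define js where "js = concat (map (\<lambda>w. w @ [0]) (map tok gs)) @ tok g"
    have tok: "map ((!) \<sigma>) (tok u) = map Letter u" "set (tok u) \<subseteq> {..<length \<sigma>}" "0 \<notin> set (tok u)"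
      "wval (tok u) = word_val G u" if "u \<in> lists (letters X)" for u
    proof -
      show "map ((!) \<sigma>) (tok u) = map Letter u" "0 \<notin> set (tok u)"
        using that idx by (auto simp: tok_def \<sigma>(2))
      have "Suc (idx a) < length \<sigma>" if "a \<in> letters X" for a
        using idx[OF that] unfolding \<sigma>(6) by simp
      with that show "set (tok u) \<subseteq> {..<length \<sigma>}" by (auto simp: tok_def)
      have "ev (label (Suc (idx a))) = letter_val G a" if "a \<in> letters X" for a
      proof -
        have "label (Suc (idx a)) = tr ! idx a"
          unfolding label_def using idx[OF that] by (simp add: lookup_eq tr_def)
        also have "\<dots> = wd a" using idx[OF that] by (simp add: tr_def)
        finally show ?thesis using wd[OF that] by simp
      qed
      with that show "wval (tok u) = word_val G u" by (induction u) (auto simp: tok_def)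
    qed
    have w': "map ((!) \<sigma>) js = w" unfolding gs(3) js_def
      using gs(1,2) tok(1) \<sigma>(1) by (induction gs) auto
    have js: "set js \<subseteq> {..<length \<sigma>}"
      using gs(1,2) tok(2) \<sigma>(6) unfolding js_def by (auto dest!: subsetD)
    have fw: "f w = map ((!) \<sigma>) (F js)" using f[OF js] w' by simp
    have sel: "select (map tok gs) ds = subset_product G gs ds" for ds
      using gs(1)
    proof (induction gs arbitrary: ds)
      case (Cons u gs)
      then show ?case
        using tok(4)[of u] word_val_closed[OF XG, of u]
        by (cases ds) (auto simp: select_def subset_product_def)
    qed (simp add: subset_product_def)
    have feas: "ssop_feasible G gs g ds \<longleftrightarrow> length ds = length (map tok gs) \<and> select (map tok gs) ds = wval (tok g)" for ds
      unfolding ssop_feasible_def sel tok(4)[OF gs(2)] by auto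
    have ws: "\<forall>u\<in>set (map tok gs). 0 \<notin> set u" "0 \<notin> set (tok g)" using tok(3) gs(1,2) by auto
    note correct = solutions_correct[OF ws js_def K C, folded sols_def]
    show ?thesis
    proof (cases "sols js")
      case Nil
      then have "f w = encode_output None" using fw \<sigma>(5) by (simp add: F_def)
      moreover have "ssop_correct G gs g None" using correct(2) Nil feas by auto
      ultimately show ?thesis unfolding SSOP_def using gs by blast
    next
      case (Cons ds dss)
      then have "F js = map (\<lambda>b. if b then ?n + 2 else ?n + 1) ds" by (simp add: F_def)
      then have "f w = encode_output (Some ds)" using fw \<sigma>(3,4) by auto
      moreover have "ssop_correct G gs g (Some ds)"
        using correct(1)[of ds] Cons feas by (auto simp flip: cost_eq_ssop_cost)
      ultimately show ?thesis unfolding SSOP_def using gs by blast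
    qed
  qed
  ultimately show ?thesis unfolding search_problem_in_P_def by blast
qed

end
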